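(* Let $\mathcal C$ be a (finite or infinite) collection of distributions over $[0,1]$ and $\delta>0$. (a) If $\mathcal C$ is $\delta$-easy and $\delta$-non-dominant, then every $\mathcal C$-consistent problem instance admits a BIC bandit algorithm, with number of rounds fixed in advance, which almost surely collects at least $N_{TS}$ samples of each arm within $\tilde O(K^3/\delta^4)$ rounds (with $\tilde O$ hiding absolute constants and polylogarithmic factors). (b) If $\mathcal C$ is $\delta$-hard, then there is $c_\delta>0$ depending only on $\delta$ such that for all sufficiently large $K$ some $\mathcal C$-consistent $K$-armed instance has $R_{LB}>\exp(c_\delta K)$. If $\mathcal C$ is finite and $\min_{\mathcal P\in\mathcal C}\sup(\mathcal P)\neq\Phi_{\mathcal C}$, then $\mathcal C$ is either $\delta$-easy or $\delta$-hard for some $\delta>0$.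
   Context: $\sup(\mathcal P)$ is the supremum of the support of $\mathcal P$; $\Phi_{\mathcal C}=\sup_{\mathcal P\in\mathcal C}\mathbb E_{\mu\sim\mathcal P}[\mu]$. $\mathcal C$ is $\delta$-easy if $\inf_{\mathcal P\in\mathcal C}\mathbb E_{\mu\sim\mathcal P}[(\mu-\Phi_{\mathcal C})_+]>\delta$; $\delta$-hard if $\inf_{\mathcal P\in\mathcal C}\Pr_{\mu\sim\mathcal P}[\mu\geq\Phi_{\mathcal C}-\delta]=0$; $\delta$-non-dominant if $\mathbb E[(\mu_j^0-\mu_i)_+]\geq\delta$ for all arms $i,j$ of every $\mathcal C$-consistent instance. A problem instance is $\mathcal C$-consistent if all its priors lie in $\mathcal C$. Incentivized exploration model: mean rewards $\mu_1,\dots,\mu_K\in[0,1]$ drawn independently, $\mu_i\sim\mathcal P_i$; Bernoulli rewards (each arm has an i.i.d. $\{0,1\}$ sample sequence with mean $\mu_i$, revealed one per choice); each round the algorithm recommends $A_t$ and the agent chooses $A'_t$; with $\mathcal E_{t-1}=\{A'_s=A_s\ \forall s<t\}$, the algorithm is BIC if $\mathbb E[\mu_i-\mu_j\mid A_t=i,\mathcal E_{t-1}]\geq0$ for all $t$ and all $i,j$ with $\Pr[A_t=i]>0$. Prior means $\mu_i^0=\mathbb E[\mu_i]$, arms indexed so $\mu_1^0\geq\dots\geq\mu_K^0$. $A^*=\min(\arg\max_j\mu_j)$. $N_{TS}=C_{TS}\varepsilon_{TS}^{-2}\log(\delta_{TS}^{-1})$, $\varepsilon_{TS}=\min_{i,j}\mathbb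 E[(\mu_i-\mu_j)_+]$, $\delta_{TS}=\min_i\Pr[A^*=i]$, $C_{TS}$ a sufficiently large absolute constant. $\Delta_K$: distributions over arms, $\mu_q=\sum_iq_i\mu_i$; $L=\max_{j,q\in\Delta_K}\mathbb E[(\mu_j-\mu_q)_-]/\mathbb E[(\mu_j-\mu_q)_+]$. $\mathrm{ZEROS}_{j,N_0}$: the first $N_0$ samples of every arm $i<j$ are $0$; $N_{boot}=\min\{N_0:\mathbb E[\mu_j-\mu_i\mid\mathrm{ZEROS}_{j,N_0}]>0\ \forall j,\forall i<j\}$; $R_{LB}=\max(K,N_{boot},L)$. *)

theory Defs
  imports "HOL-Probability.Probability"
begin

definition dist01 :: "real measure \<Rightarrow> bool" where
  "dist01 P \<longleftrightarrow> prob_space P \<and> sets P = sets borel \<and> measure P {0..1} = 1"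

definition support :: "real measure \<Rightarrow> real set" where
  "support P = {x. \<forall>e>0. measure P {x - e <..< x + e} > 0}"

definition sup_supp :: "real measure \<Rightarrow> real" where
  "sup_supp P = Sup (support P)"

definition mean :: "real measure \<Rightarrow> real" where
  "mean P = (\<integral>x. x \<partial>P)"

definition Phi :: "real measure set \<Rightarrow> real" where
  "Phi C = (SUP P\<in>C. mean P)"

definition delta_easy :: "real measure set \<Rightarrow> real \<Rightarrow> bool" where
  "delta_easy C \<delta> \<longleftrightarrow> (INF P\<in>C. (\<integral>x. max (x - Phi C) 0 \<partial>P)) > \<delta>"

definition delta_hard :: "real measure set \<Rightarrow> real \<Rightarrow> bool" where
  "delta_hard C \<delta> \<longleftrightarrow> (INF P\<in>C. measure P {Phi C - \<delta> ..}) = 0"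

definition consistent :: "real measure set \<Rightarrow> nat \<Rightarrow> (nat \<Rightarrow> real measure) \<Rightarrow> bool" where
  "consistent C K P \<longleftrightarrow> (\<forall>i<K. P i \<in> C)"

definition delta_nondominant :: "real measure set \<Rightarrow> real \<Rightarrow> bool" where
  "delta_nondominant C \<delta> \<longleftrightarrow>
     (\<forall>K P. consistent C K P \<longrightarrow>
        (\<forall>i<K. \<forall>j<K. i \<noteq> j \<longrightarrow> (\<integral>x. max (mean (P j) - x) 0 \<partial>(P i)) \<ge> \<delta>))"

(* Primitive random sources: mean reward of arm i; uniform variable used to
   generate the n-th Bernoulli sample of arm i (the sample is 1 iff
   Unif i n < Mu i); the algorithm's internal random seed. *)
datatype src = Mu nat | Unif nat nat | Seed

definition realization ::
  "nat \<Rightarrow> (nat \<Rightarrow> real measure) \<Rightarrow> 'w measure \<Rightarrow> (src \<Rightarrow> 'w \<Rightarrow> real) \<Rightarrow> bool" where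
  "realization K P M X \<longleftrightarrow>
     prob_space M \<and>
     prob_space.indep_vars M (\<lambda>_. borel) X UNIV \<and>
     (\<forall>i<K. distr M borel (X (Mu i)) = P i) \<and>
     (\<forall>i n. distr M borel (X (Unif i n)) = uniform_measure lborel {0..1}) \<and>
     distr M borel (X Seed) = uniform_measure lborel {0..1}"

(* n-th sample (0-indexed) of arm i: True = reward 1, False = reward 0 *)
definition sample :: "(src \<Rightarrow> 'w \<Rightarrow> real) \<Rightarrow> nat \<Rightarrow> nat \<Rightarrow> 'w \<Rightarrow> bool" where
  "sample X i n \<omega> \<longleftrightarrow> X (Unif i n) \<omega> < X (Mu i) \<omega>"

(* A (randomized) algorithm: given its random seed and the history of
   (chosen arm, observed reward) pairs, recommends an arm. *)
type_synonym alg = "real \<Rightarrow> (nat \<times> bool) list \<Rightarrow> nat"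

definition alg_ok :: "nat \<Rightarrow> alg \<Rightarrow> bool" where
  "alg_ok K A \<longleftrightarrow> (\<forall>u h. A u h < K) \<and> (\<forall>h. (\<lambda>u. A u h) \<in> borel \<rightarrow>\<^sub>M count_space UNIV)"

(* history before round t, when all agents follow the recommendations *)
fun hist :: "alg \<Rightarrow> (src \<Rightarrow> 'w \<Rightarrow> real) \<Rightarrow> 'w \<Rightarrow> nat \<Rightarrow> (nat \<times> bool) list" where
  "hist A X \<omega> 0 = []"
| "hist A X \<omega> (Suc t) =
     (let h = hist A X \<omega> t; a = A (X Seed \<omega>) h; n = length (filter (\<lambda>p. fst p = a) h)
      in h @ [(a, sample X a n \<omega>)])"

definition rec_arm :: "alg \<Rightarrow> (src \<Rightarrow> 'w \<Rightarrow> real) \<Rightarrow> nat \<Rightarrow> 'w \<Rightarrow> nat" where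
  "rec_arm A X t \<omega> = A (X Seed \<omega>) (hist A X \<omega> t)"

definition cexp :: "'w measure \<Rightarrow> ('w \<Rightarrow> real) \<Rightarrow> 'w set \<Rightarrow> real" where
  "cexp M Y B = (\<integral>\<omega>. indicator B \<omega> * Y \<omega> \<partial>M) / measure M B"

definition BIC :: "nat \<Rightarrow> alg \<Rightarrow> nat \<Rightarrow> 'w measure \<Rightarrow> (src \<Rightarrow> 'w \<Rightarrow> real) \<Rightarrow> bool" where
  "BIC K A T M X \<longleftrightarrow>
     (\<forall>t<T. \<forall>i<K. \<forall>j<K.
        measure M {\<omega>\<in>space M. rec_arm A X t \<omega> = i} > 0 \<longrightarrow>
        cexp M (\<lambda>\<omega>. X (Mu i) \<omega> - X (Mu j) \<omega>) {\<omega>\<in>space M. rec_arm A X t \<omega> = i} \<ge> 0)"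

definition best_arm :: "nat \<Rightarrow> (src \<Rightarrow> 'w \<Rightarrow> real) \<Rightarrow> 'w \<Rightarrow> nat" where
  "best_arm K X \<omega> = (LEAST i. i < K \<and> (\<forall>j<K. X (Mu j) \<omega> \<le> X (Mu i) \<omega>))"

definition eps_TS :: "nat \<Rightarrow> 'w measure \<Rightarrow> (src \<Rightarrow> 'w \<Rightarrow> real) \<Rightarrow> real" where
  "eps_TS K M X = Min {(\<integral>\<omega>. max (X (Mu i) \<omega> - X (Mu j) \<omega>) 0 \<partial>M) | i j. i < K \<and> j < K \<and> i \<noteq> j}"

definition delta_TS :: "nat \<Rightarrow> 'w measure \<Rightarrow> (src \<Rightarrow> 'w \<Rightarrow> real) \<Rightarrow> real" where
  "delta_TS K M X = Min {measure M {\<omega>\<in>space M. best_arm K X \<omega> = i} | i. i < K}"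

definition N_TS :: "real \<Rightarrow> nat \<Rightarrow> 'w measure \<Rightarrow> (src \<Rightarrow> 'w \<Rightarrow> real) \<Rightarrow> real" where
  "N_TS CTS K M X = CTS * (eps_TS K M X) powr (-2) * ln (1 / delta_TS K M X)"

definition arm_simplex :: "nat \<Rightarrow> (nat \<Rightarrow> real) set" where
  "arm_simplex K = {q. (\<forall>i<K. q i \<ge> 0) \<and> (\<Sum>i<K. q i) = 1}"

definition L_val :: "nat \<Rightarrow> 'w measure \<Rightarrow> (src \<Rightarrow> 'w \<Rightarrow> real) \<Rightarrow> ereal" where
  "L_val K M X = (SUP jq \<in> {..<K} \<times> arm_simplex K.
      ereal (\<integral>\<omega>. max (- (X (Mu (fst jq)) \<omega> - (\<Sum>i<K. snd jq i * X (Mu i) \<omega>))) 0 \<partial>M)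
    / ereal (\<integral>\<omega>. max (X (Mu (fst jq)) \<omega> - (\<Sum>i<K. snd jq i * X (Mu i) \<omega>)) 0 \<partial>M))"

definition ZEROS :: "'w measure \<Rightarrow> (src \<Rightarrow> 'w \<Rightarrow> real) \<Rightarrow> nat \<Rightarrow> nat \<Rightarrow> 'w set" where
  "ZEROS M X j N0 = {\<omega>\<in>space M. \<forall>i<j. \<forall>n<N0. \<not> sample X i n \<omega>}"

definition N_boot :: "nat \<Rightarrow> 'w measure \<Rightarrow> (src \<Rightarrow> 'w \<Rightarrow> real) \<Rightarrow> enat" where
  "N_boot K M X = Inf {enat N0 | N0. \<forall>j<K. \<forall>i<j.
       cexp M (\<lambda>\<omega>. X (Mu j) \<omega> - X (Mu i) \<omega>) (ZEROS M X j N0) > 0}"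

definition R_LB :: "nat \<Rightarrow> 'w measure \<Rightarrow> (src \<Rightarrow> 'w \<Rightarrow> real) \<Rightarrow> ereal" where
  "R_LB K M X = max (ereal (real K)) (max (ereal_of_enat (N_boot K M X)) (L_val K M X))"

end

theory Submission
  imports Defs
begin

text \<open>
  \<^emph>\<open>Easy classes.\<close> Sort the arms by prior mean and play in blocks of \<open>N\<close> rounds, starting with
  arm 0. Arm \<open>j\<close> is first explored on an event \<open>E\<close> of probability at least \<open>(\<delta>/2)^K\<close> that depends on
  the samples of the earlier arms and is tilted so that each of them has conditional mean exactly the
  prior mean of \<open>j\<close>: then arm \<open>j\<close> is acceptable on \<open>E\<close>, and arm 0 is acceptable off \<open>E\<close>.
  Non-domination makes such a tilt possible. Afterwards the probability that \<open>j\<close> has been explored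
  grows by a factor of about \<open>1 + \<delta>/4\<close> per block: on the part already explored, \<open>j\<close> is replayed iff
  its empirical mean is at least \<open>\<Phi>\<close>, which gains at least \<open>\<delta>/2\<close> times that probability over every
  other arm, and this pays for exploring \<open>j\<close> on a little more of the seed space. So \<open>O(K/\<delta>)\<close> blocks
  per arm suffice up to logarithms, and \<open>N\<^sub>T\<^sub>S = O(K/\<delta>\<^sup>2)\<close> up to logarithms because
  \<open>\<delta>\<^sub>T\<^sub>S \<ge> \<delta>^K\<close> and \<open>\<epsilon>\<^sub>T\<^sub>S \<ge> \<delta>\<close>.

  \<^emph>\<open>Hard classes.\<close> Take \<open>K - 1\<close> copies of a prior with mean close to \<open>\<Phi>\<close> and one prior that reaches
  \<open>\<Phi> - \<delta>\<close> with probability below \<open>exp (- K)\<close>. By Hoeffding's inequality the average of the good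
  arms beats the bad arm except with exponentially small probability, so already \<open>L\<close> is exponential.
\<close>

subsection \<open>Distributions on the unit interval\<close>

text \<open>The obstacle on the easy side is that incentives have to hold conditionally on
  adaptively produced histories. Everything is therefore arranged so that the decision in a block is
  a function of one seed, shared by all blocks, and of the success counts in the length-N prefixes
  of the reward tapes. Exploration of an arm is the event that the seed lies below a threshold. Such
  events are nested in the stage, and integrating out the seed replaces the event by its threshold,
  a mixture of a product over arms and a constant. Every incentive thus reduces to products of
  one-arm expectations. The replay cutoff is \<Phi> because \<Phi> dominates every prior mean, hence
  also every tilted mean, so one comparison serves against all arms at once. With N at least
  4/\<delta>^2 the empirical mean errs by at most \<delta>/2 in expectation; this is why \<delta>/2
  survives of each prior excess or deficit of size \<delta>.\<close>

lemma dist01_prob: "dist01 P \<Longrightarrow> prob_space P"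
  by (simp add: dist01_def)

lemma dist01_sets: "dist01 P \<Longrightarrow> sets P = sets borel"
  by (simp add: dist01_def)

lemma dist01_space: "dist01 P \<Longrightarrow> space P = UNIV"
  by (metis dist01_sets sets_eq_imp_space_eq space_borel)

lemma dist01_AE: "dist01 P \<Longrightarrow> AE x in P. x \<in> {0..1}"
  using prob_space.prob_eq_1[of P "{0..1}"] by (auto simp: dist01_def)

lemma dist01_measurable:
  fixes f :: "real \<Rightarrow> real"
  assumes "dist01 P" "f \<in> borel_measurable borel"
  shows "f \<in> borel_measurable P"
  using assms dist01_sets measurable_cong_sets by blast

lemma dist01_integrable:
  fixes f :: "real \<Rightarrow> real"
  assumes P: "dist01 P" and f: "f \<in> borel_measurable borel"
    and bd: "\<And>x. 0 \<le> x \<Longrightarrow> x \<le> 1 \<Longrightarrow> \<bar>f x\<bar> \<le> B"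
  shows "integrable P f"
proof -
  interpret prob_space P by (rule dist01_prob[OF P])
  show ?thesis
    using dist01_AE[OF P] dist01_measurable[OF P f] bd
    by (intro integrable_const_bound[where B=B]) auto
qed

lemma dist01_mean_bounds:
  assumes P: "dist01 P"
  shows "0 \<le> mean P" "mean P \<le> 1"
proof -
  interpret prob_space P by (rule dist01_prob[OF P])
  have int: "integrable P (\<lambda>x. x)" by (rule dist01_integrable[OF P, where B=1]) auto
  show "0 \<le> mean P" unfolding mean_def
    using dist01_AE[OF P] by (intro integral_nonneg_AE) auto
  show "mean P \<le> 1" unfolding mean_def
    using dist01_AE[OF P] int by (intro integral_le_const) auto
qed

lemma mean_le_Phi:
  assumes "\<forall>P\<in>C. dist01 P" "P \<in> C"
  shows "mean P \<le> Phi C"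
  unfolding Phi_def using assms dist01_mean_bounds(2)
  by (intro cSUP_upper bdd_aboveI2[where M=1]) auto

lemma Phi_bounds:
  assumes "\<forall>P\<in>C. dist01 P" "C \<noteq> {}"
  shows "0 \<le> Phi C" "Phi C \<le> 1"
proof -
  obtain P where "P \<in> C" using assms by auto
  then show "0 \<le> Phi C"
    using mean_le_Phi[OF assms(1)] dist01_mean_bounds(1) assms(1) by (meson order_trans)
  show "Phi C \<le> 1" unfolding Phi_def
    using assms dist01_mean_bounds(2) by (intro cSUP_least) auto
qed

section \<open>Supports, and the dichotomy for finite classes\<close>

lemma AE_mem_support:
  assumes P: "dist01 P"
  shows "AE x in P. x \<in> support P"
proof -
  interpret prob_space P by (rule dist01_prob[OF P])
  define F where "F = {{x - e <..< x + e} | x e. e > 0 \<and> measure P {x - e <..< x + e} = 0}"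
  have "\<And>S. S \<in> F \<Longrightarrow> open S" by (auto simp: F_def)
  \<comment> \<open>The complement of the support is a possibly uncountable union of null intervals;
    a countable subfamily with the same union shows that it is null.\<close>
  from Lindelof[OF this] obtain F' where F': "F' \<subseteq> F" "countable F'" "\<Union>F' = \<Union>F" by auto
  have null: "S \<in> null_sets P" if "S \<in> F'" for S
    using that F'(1) dist01_sets[OF P]
    by (auto simp: F_def null_sets_def emeasure_eq_measure)
  have "(\<Union>S\<in>F'. S) \<in> null_sets P"
    using F'(2) null by (intro null_sets_UN') auto
  moreover have "- support P \<subseteq> \<Union>F"
  proof
    fix x assume "x \<in> - support P"
    then obtain e where e: "e > 0" "\<not> measure P {x - e <..< x + e} > 0"
      by (auto simp: support_def)
    then have "measure P {x - e <..< x + e} = 0"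
      by (simp add: less_le)
    then show "x \<in> \<Union>F" using e unfolding F_def
      by (intro UnionI[of "{x - e <..< x + e}"]) auto
  qed
  ultimately show ?thesis
    using F'(3) by (intro AE_I'[where N="\<Union>F'"]) auto
qed

lemma support_subset:
  assumes P: "dist01 P"
  shows "support P \<subseteq> {0..1}"
proof
  fix x assume x: "x \<in> support P"
  interpret prob_space P by (rule dist01_prob[OF P])
  have null: False if "S \<inter> {0..1} = {}" "S \<in> sets borel" "measure P S > 0" for S
  proof -
    have "AE x in P. x \<notin> S" using dist01_AE[OF P] by eventually_elim (use that(1) in blast)
    then have "measure P S = 0" using that(2) dist01_sets[OF P]
      by (subst prob_eq_0) auto
    with that show False by simp
  qed
  show "x \<in> {0..1}"
  proof (rule ccontr)
    assume n: "x \<notin> {0..1}"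
    define e where "e = (if x < 0 then - x else x - 1)"
    have "e > 0" using n by (auto simp: e_def)
    then have "measure P {x - e<..<x + e} > 0" using x by (auto simp: support_def)
    then show False using n
      by (intro null[of "{x - e<..<x + e}"]) (auto simp: e_def split: if_splits)
  qed
qed

lemma support_nonempty:
  assumes P: "dist01 P"
  shows "support P \<noteq> {}"
proof
  assume "support P = {}"
  then have "AE x in P. False" using AE_mem_support[OF P] by simp
  then show False using prob_space.AE_False[OF dist01_prob[OF P]] by simp
qed

lemma le_sup_supp:
  assumes P: "dist01 P" and x: "x \<in> support P"
  shows "x \<le> sup_supp P"
  unfolding sup_supp_def
  by (rule cSup_upper[OF x bdd_above_mono[OF _ support_subset[OF P]]]) auto

text \<open>If some prior lives strictly below \<Phi>, half of the distance witnesses hardness.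
  Otherwise every prior charges an interval above \<Phi>, and finiteness turns these positive
  excesses into a uniform one. The excluded equality is the case of a prior that only just touches
  \<Phi>, whose excess is 0.\<close>

theorem finite_class_easy_or_hard:
  assumes fin: "finite C" and ne: "C \<noteq> {}" and d: "\<forall>P\<in>C. dist01 P"
    and neq: "Min (sup_supp ` C) \<noteq> Phi C"
  shows "\<exists>\<delta>>0. delta_easy C \<delta> \<or> delta_hard C \<delta>"
proof (cases "\<exists>P\<in>C. sup_supp P < Phi C")
  case True
  then obtain P where P: "P \<in> C" "sup_supp P < Phi C" by auto
  define \<delta> where "\<delta> = (Phi C - sup_supp P) / 2"
  interpret prob_space P using P d dist01_prob by auto
  have dP: "dist01 P" using P d by auto
  have "AE x in P. x \<notin> {Phi C - \<delta> ..}"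
    using AE_mem_support[OF dP]
  proof (eventually_elim)
    case (elim x)
    with le_sup_supp[OF dP elim] P(2) show ?case
      by (auto simp: \<delta>_def field_simps)
  qed
  then have z: "measure P {Phi C - \<delta> ..} = 0"
    by (subst prob_eq_0) (auto simp: dist01_sets[OF dP])
  have "(INF P\<in>C. measure P {Phi C - \<delta> ..}) \<le> measure P {Phi C - \<delta> ..}"
    using P(1) by (intro cINF_lower bdd_belowI2[where m=0]) auto
  moreover have "(INF P\<in>C. measure P {Phi C - \<delta> ..}) \<ge> 0"
    using ne by (intro cINF_greatest) auto
  ultimately have "delta_hard C \<delta>" unfolding delta_hard_def using z by linarith
  moreover have "\<delta> > 0" using P by (simp add: \<delta>_def)
  ultimately show ?thesis by blast
next
  case False
  have gt: "sup_supp P > Phi C" if "P \<in> C" for P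
  proof -
    have "Min (sup_supp ` C) \<in> sup_supp ` C" using fin ne by (intro Min_in) auto
    then have "Min (sup_supp ` C) > Phi C" using False neq by force
    then show ?thesis using fin that by (meson Min_le finite_imageI image_eqI less_le_trans)
  qed
  define f where "f P = (\<integral>x. max (x - Phi C) 0 \<partial>P)" for P
  have pos: "f P > 0" if PC: "P \<in> C" for P
  proof -
    have dP: "dist01 P" using PC d by auto
    interpret prob_space P by (rule dist01_prob[OF dP])
    obtain x where x: "x \<in> support P" "x > Phi C"
      using gt[OF PC] support_nonempty[OF dP] unfolding sup_supp_def
      by (meson less_cSupE)
    define e where "e = (x - Phi C) / 2"
    have e: "e > 0" using x by (simp add: e_def)
    let ?S = "{x - e <..< x + e}"
    have m: "measure P ?S > 0" using x e by (auto simp: support_def)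
    have i1: "integrable P (\<lambda>x. max (x - Phi C) 0)"
      using Phi_bounds[OF d ne]
      by (intro dist01_integrable[OF dP, where B=1]) auto
    have i2: "integrable P (\<lambda>y. e * indicator ?S y)"
      by (intro dist01_integrable[OF dP, where B=e]) (use e in \<open>auto simp: indicator_def\<close>)
    have "e * measure P ?S = (\<integral>y. e * indicator ?S y \<partial>P)"
      by (simp add: dist01_space[OF dP])
    also have "\<dots> \<le> f P" unfolding f_def
      by (intro integral_mono[OF i2 i1]) (auto simp: indicator_def e_def field_simps)
    finally show ?thesis using m e by (smt (verit) mult_pos_pos)
  qed
  \<comment> \<open>Easiness asks for a strict inequality, hence the half.\<close>
  define \<delta> where "\<delta> = Min (f ` C) / 2"
  have mp: "Min (f ` C) > 0" using pos fin ne by auto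
  have "\<delta> < Min (f ` C)" "\<delta> > 0" using mp by (auto simp: \<delta>_def)
  moreover have "(INF P\<in>C. f P) = Min (f ` C)"
    using fin ne by (intro cInf_eq_Min) auto
  ultimately have "delta_easy C \<delta>" unfolding delta_easy_def f_def[symmetric] by simp
  then show ?thesis using \<open>\<delta> > 0\<close> by blast
qed

subsection \<open>Realizations of an instance\<close>

text \<open>A function of the source vector rather than of an outcome, so that the same count can be
  evaluated on a realization, on the coordinates of a single arm, and on the canonical space
  \<open>arm_space\<close>.\<close>

definition successes :: "nat \<Rightarrow> nat \<Rightarrow> (src \<Rightarrow> real) \<Rightarrow> nat" where
  "successes N i x = (\<Sum>n<N. of_bool (x (Unif i n) < x (Mu i)))"

lemma successes_le: "successes N i x \<le> N"
proof -
  have "successes N i x \<le> (\<Sum>n<N. 1)" unfolding successes_def by (intro sum_mono) auto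
  then show ?thesis by simp
qed

lemma measurable_successes [measurable]:
  assumes "Mu i \<in> A" "\<And>n. Unif i n \<in> A"
  shows "successes N i \<in> measurable (PiM A (\<lambda>_. borel)) (count_space UNIV)"
proof -
  have [measurable]: "(\<lambda>x. x (Mu i)) \<in> borel_measurable (PiM A (\<lambda>_. borel :: real measure))"
    "\<And>n. (\<lambda>x. x (Unif i n)) \<in> borel_measurable (PiM A (\<lambda>_. borel :: real measure))"
    using assms by (auto intro: measurable_component_singleton)
  show ?thesis unfolding successes_def by measurable
qed

lemma measure_uniform_lessThan:
  assumes "0 \<le> t" "t \<le> (1::real)"
  shows "measure (uniform_measure lborel {0..1}) {..<t} = t"
proof -
  have "{0..1} \<inter> {..<t} = {0..<t}" using assms by auto
  then show ?thesis using assms by (simp add: measure_uniform_measure)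
qed

locale bandit =
  fixes K :: nat and P :: "nat \<Rightarrow> real measure" and M :: "'w measure"
    and X :: "src \<Rightarrow> 'w \<Rightarrow> real"
  assumes realized: "realization K P M X"
    and dist01: "\<And>i. i < K \<Longrightarrow> dist01 (P i)"
begin

sublocale prob_space M using realized by (simp add: realization_def)

abbreviation (input) x_of :: "'w \<Rightarrow> src \<Rightarrow> real" where "x_of \<omega> \<equiv> (\<lambda>s. X s \<omega>)"

lemma indep: "indep_vars (\<lambda>_. borel) X UNIV"
  using realized by (simp add: realization_def)

lemma X_measurable [measurable]: "X s \<in> borel_measurable M"
  using indep by (auto simp: indep_vars_def)

lemma distr_Mu: "i < K \<Longrightarrow> distr M borel (X (Mu i)) = P i"
  using realized by (simp add: realization_def)

lemma distr_Unif: "distr M borel (X (Unif i n)) = uniform_measure lborel {0..1}"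
  using realized by (simp add: realization_def)

lemma distr_Seed: "distr M borel (X Seed) = uniform_measure lborel {0..1}"
  using realized by (simp add: realization_def)

lemma expectation_Mu:
  fixes f :: "real \<Rightarrow> real"
  assumes "i < K" "f \<in> borel_measurable borel"
  shows "expectation (\<lambda>\<omega>. f (X (Mu i) \<omega>)) = (\<integral>x. f x \<partial>P i)"
  using integral_distr[OF X_measurable assms(2), of "Mu i"] distr_Mu[OF assms(1)] by simp

lemma expectation_Mu_mean: "i < K \<Longrightarrow> expectation (X (Mu i)) = mean (P i)"
  using expectation_Mu[of i "\<lambda>x. x"] by (simp add: mean_def)

lemma AE_Mu: 
  assumes "i < K"
  shows "AE \<omega> in M. 0 \<le> X (Mu i) \<omega> \<and> X (Mu i) \<omega> \<le> 1"
proof -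
  have "AE x in distr M borel (X (Mu i)). 0 \<le> x \<and> x \<le> 1"
    using dist01_AE[OF dist01[OF assms]] unfolding distr_Mu[OF assms] by simp
  then show ?thesis by (subst (asm) AE_distr_iff) auto
qed

lemma AE_Mu_all: "AE \<omega> in M. \<forall>i<K. 0 \<le> X (Mu i) \<omega> \<and> X (Mu i) \<omega> \<le> 1"
proof -
  have "AE \<omega> in M. \<forall>i\<in>{..<K}. 0 \<le> X (Mu i) \<omega> \<and> X (Mu i) \<omega> \<le> 1"
    using AE_Mu by (intro AE_finite_allI) auto
  then show ?thesis by eventually_elim auto
qed

lemma successes_measurable [measurable]:
  "(\<lambda>\<omega>. successes N i (x_of \<omega>)) \<in> measurable M (count_space UNIV)"
  unfolding successes_def by measurable

lemma integrable_arm: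
  assumes "i < K" "\<And>s. (\<lambda>x. \<phi> x s) \<in> borel_measurable borel"
    and "\<And>x s. 0 \<le> x \<Longrightarrow> x \<le> 1 \<Longrightarrow> s \<le> N \<Longrightarrow> \<bar>\<phi> x s\<bar> \<le> (B::real)"
  shows "integrable M (\<lambda>\<omega>. \<phi> (X (Mu i) \<omega>) (successes N i (x_of \<omega>)))"
proof (rule integrable_const_bound[where B=B])
  show "(\<lambda>\<omega>. \<phi> (X (Mu i) \<omega>) (successes N i (x_of \<omega>))) \<in> borel_measurable M"
    by (rule measurable_compose_countable[where f="\<lambda>s \<omega>. \<phi> (X (Mu i) \<omega>) s"])
      (auto intro: measurable_compose[OF X_measurable assms(2)])
  show "AE \<omega> in M. norm (\<phi> (X (Mu i) \<omega>) (successes N i (x_of \<omega>))) \<le> B"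
    using AE_Mu[OF assms(1)] by eventually_elim (use assms(3) successes_le in auto)
qed

text \<open>The mean and the tape of arm \<open>i\<close> form one block of sources, and blocks of
  different arms are disjoint. The multi-arm expectations of the easy case are factored through this
  identity; with \<open>N = 0\<close> it concerns the mean rewards alone.\<close>

lemma expectation_prod_arms:
  fixes \<phi> :: "nat \<Rightarrow> real \<Rightarrow> nat \<Rightarrow> real"
  assumes m: "\<And>i s. i < K \<Longrightarrow> (\<lambda>x. \<phi> i x s) \<in> borel_measurable borel"
    and b: "\<And>i x s. i < K \<Longrightarrow> 0 \<le> x \<Longrightarrow> x \<le> 1 \<Longrightarrow> s \<le> N \<Longrightarrow> \<bar>\<phi> i x s\<bar> \<le> B"
  shows "expectation (\<lambda>\<omega>. \<Prod>i<K. \<phi> i (X (Mu i) \<omega>) (successes N i (x_of \<omega>)))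
    = (\<Prod>i<K. expectation (\<lambda>\<omega>. \<phi> i (X (Mu i) \<omega>) (successes N i (x_of \<omega>))))"
proof -
  define blk where "blk i = insert (Mu i) (range (Unif i))" for i
  have "indep_vars (\<lambda>i. PiM (blk i) (\<lambda>_. borel)) (\<lambda>i \<omega>. restrict (x_of \<omega>) (blk i)) {..<K}"
    by (rule indep_vars_restrict[OF indep]) (auto simp: blk_def disjoint_family_on_def)
  then have "indep_vars (\<lambda>_. borel) (\<lambda>i \<omega>. (\<lambda>x. \<phi> i (x (Mu i)) (successes N i x)) 
      (restrict (x_of \<omega>) (blk i))) {..<K}"
  proof (rule indep_vars_compose2)
    fix i assume "i \<in> {..<K}"
    then have iK: "i < K" by simp
    have [measurable]: "(\<lambda>x. x (Mu i)) \<in> borel_measurable (PiM (blk i) (\<lambda>_. borel :: real measure))"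
      by (rule measurable_component_singleton) (simp add: blk_def)
    have [measurable]: "successes N i \<in> measurable (PiM (blk i) (\<lambda>_. borel)) (count_space UNIV)"
      by (rule measurable_successes) (auto simp: blk_def)
    show "(\<lambda>x. \<phi> i (x (Mu i)) (successes N i x)) \<in> borel_measurable (PiM (blk i) (\<lambda>_. borel))"
      by (rule measurable_compose_countable[where f="\<lambda>s x. \<phi> i (x (Mu i)) s"])
        (auto intro: measurable_compose[OF _ m[OF iK]])
  qed
  moreover have "successes N i (restrict x (blk i)) = successes N i x" for i x
    by (simp add: successes_def blk_def)
  moreover have "restrict x (blk i) (Mu i) = x (Mu i)" for x :: "src \<Rightarrow> real" and i
    by (simp add: blk_def)
  ultimately have "indep_vars (\<lambda>_. borel)
      (\<lambda>i \<omega>. \<phi> i (X (Mu i) \<omega>) (successes N i (x_of \<omega>))) {..<K}"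
    by (simp only:)
  then show ?thesis
    by (rule indep_vars_lebesgue_integral[rotated])
      (use m b in \<open>auto intro!: integrable_arm\<close>)
qed

text \<open>Fubini over the coordinate \<open>s\<close>: given all other sources, a uniform variable
  lies below \<open>\<theta>\<close> with probability \<open>\<theta>\<close>. Independence of
  \<open>s\<close> is expressed as invariance under restriction to the other coordinates. The
  coordinate is a tape entry in the variance bound and the seed in the incentive
  computations.\<close>

lemma expectation_threshold:
  fixes \<theta> f :: "(src \<Rightarrow> real) \<Rightarrow> real"
  assumes unif: "distr M borel (X s) = uniform_measure lborel {0..1}"
    and \<theta>[measurable]: "\<theta> \<in> borel_measurable (PiM (- {s}) (\<lambda>_. borel))"
    and f[measurable]: "f \<in> borel_measurable (PiM (- {s}) (\<lambda>_. borel))"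
    and dep: "\<And>x. \<theta> (restrict x (- {s})) = \<theta> x" "\<And>x. f (restrict x (- {s})) = f x"
    and \<theta>01: "AE \<omega> in M. 0 \<le> \<theta> (x_of \<omega>) \<and> \<theta> (x_of \<omega>) \<le> 1"
    and fB: "AE \<omega> in M. \<bar>f (x_of \<omega>)\<bar> \<le> B"
  shows "integrable M (\<lambda>\<omega>. of_bool (X s \<omega> < \<theta> (x_of \<omega>)) * f (x_of \<omega>))"
    and "expectation (\<lambda>\<omega>. of_bool (X s \<omega> < \<theta> (x_of \<omega>)) * f (x_of \<omega>))
      = expectation (\<lambda>\<omega>. \<theta> (x_of \<omega>) * f (x_of \<omega>))"
proof -
  define N where "N = PiM (- {s}) (\<lambda>_. borel :: real measure)"
  define H where "H \<omega> = restrict (x_of \<omega>) (- {s})" for \<omega>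
  have H[measurable]: "H \<in> measurable M N"
    unfolding H_def N_def by (rule measurable_restrict) simp
  note [measurable] = \<theta>[folded N_def] f[folded N_def]
  have \<theta>H: "\<theta> (H \<omega>) = \<theta> (x_of \<omega>)" and fH: "f (H \<omega>) = f (x_of \<omega>)" for \<omega>
    unfolding H_def using dep by auto
  define N1 where "N1 = PiM {s} (\<lambda>_. borel :: real measure)"
  define H1 where "H1 \<omega> = restrict (x_of \<omega>) {s}" for \<omega>
  have H1[measurable]: "H1 \<in> measurable M N1"
    unfolding H1_def N1_def by (rule measurable_restrict) simp
  have H1s: "H1 \<omega> s = X s \<omega>" for \<omega> by (simp add: H1_def)
  have s_meas[measurable]: "(\<lambda>u. u s) \<in> borel_measurable N1"
    unfolding N1_def by (rule measurable_component_singleton) simp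
  have "indep_var N1 H1 N H"
    unfolding H_def N_def H1_def N1_def by (rule indep_var_restrict[OF indep]) auto
  then have pair: "distr M N1 H1 \<Otimes>\<^sub>M distr M N H
      = distr M (N1 \<Otimes>\<^sub>M N) (\<lambda>\<omega>. (H1 \<omega>, H \<omega>))"
    unfolding indep_var_distribution_eq by simp
  define U where "U = distr M N1 H1"
  define D where "D = distr M N H"
  have setsU[measurable_cong]: "sets U = sets N1" by (simp add: U_def)
  have setsD[measurable_cong]: "sets D = sets N" by (simp add: D_def)
  interpret U: prob_space U unfolding U_def by (rule prob_space_distr) simp
  interpret D: prob_space D unfolding D_def by (rule prob_space_distr) simp
  interpret UD: pair_prob_space U D ..
  let ?g = "\<lambda>u h. of_bool (u s < \<theta> h) * f h :: real"
  have fD: "AE h in D. \<bar>f h\<bar> \<le> B"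
    unfolding D_def using fB by (subst AE_distr_iff) (auto simp: fH)
  have \<theta>D: "AE h in D. 0 \<le> \<theta> h \<and> \<theta> h \<le> 1"
    unfolding D_def using \<theta>01 by (subst AE_distr_iff) (auto simp: \<theta>H)
  have g_meas[measurable]: "case_prod ?g \<in> borel_measurable (U \<Otimes>\<^sub>M D)"
    by measurable
  show int: "integrable M (\<lambda>\<omega>. of_bool (X s \<omega> < \<theta> (x_of \<omega>)) * f (x_of \<omega>))"
  proof (rule integrable_const_bound[where B=B])
    show "AE \<omega> in M. norm (of_bool (X s \<omega> < \<theta> (x_of \<omega>)) * f (x_of \<omega>)) \<le> B"
      using fB by eventually_elim auto
    have "(\<lambda>\<omega>. of_bool (X s \<omega> < \<theta> (H \<omega>)) * f (H \<omega>)) \<in> borel_measurable M"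
      by measurable
    then show "(\<lambda>\<omega>. of_bool (X s \<omega> < \<theta> (x_of \<omega>)) * f (x_of \<omega>)) \<in> borel_measurable M"
      by (simp add: \<theta>H fH)
  qed
  have UDeq: "U \<Otimes>\<^sub>M D = distr M (N1 \<Otimes>\<^sub>M N) (\<lambda>\<omega>. (H1 \<omega>, H \<omega>))"
    using pair by (simp add: U_def D_def)
  have g_meas': "case_prod ?g \<in> borel_measurable (N1 \<Otimes>\<^sub>M N)"
    by measurable
  have int2: "integrable (U \<Otimes>\<^sub>M D) (case_prod ?g)"
    unfolding UDeq using int g_meas' by (subst integrable_distr_eq) (auto simp: \<theta>H fH H1s)
  have "expectation (\<lambda>\<omega>. of_bool (X s \<omega> < \<theta> (x_of \<omega>)) * f (x_of \<omega>))
      = expectation (\<lambda>\<omega>. case_prod ?g (H1 \<omega>, H \<omega>))"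
    by (simp add: \<theta>H fH H1s)
  also have "\<dots> = integral\<^sup>L (U \<Otimes>\<^sub>M D) (case_prod ?g)"
    unfolding UDeq using g_meas' by (subst integral_distr) auto
  also have "\<dots> = (\<integral>h. (\<integral>u. ?g u h \<partial>U) \<partial>D)"
    by (rule UD.integral_snd[OF int2, symmetric])
  also have "\<dots> = (\<integral>h. \<theta> h * f h \<partial>D)"
  proof (rule integral_cong_AE)
    show "AE h in D. (\<integral>u. ?g u h \<partial>U) = \<theta> h * f h"
      using \<theta>D
    proof eventually_elim
      case (elim h)
      have "(\<integral>u. ?g u h \<partial>U) = (\<integral>u. indicator {..<\<theta> h} (u s) \<partial>U) * f h"
        by (subst integral_mult_left_zero[symmetric])
          (auto intro!: Bochner_Integration.integral_cong simp: indicator_def)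
      also have "(\<integral>u. indicator {..<\<theta> h} (u s) \<partial>U) = (\<integral>\<omega>. indicator {..<\<theta> h} (X s \<omega>) \<partial>M :: real)"
        unfolding U_def by (subst integral_distr) (auto simp: H1s)
      also have "\<dots> = (\<integral>u. indicator {..<\<theta> h} u \<partial>distr M borel (X s))"
        by (subst integral_distr) auto
      also have "\<dots> = measure (uniform_measure lborel {0..1}) {..<\<theta> h}"
        unfolding unif by simp
      also have "\<dots> = \<theta> h" by (rule measure_uniform_lessThan) (use elim in auto)
      finally show ?case .
    qed
  qed measurable
  also have "\<dots> = expectation (\<lambda>\<omega>. \<theta> (H \<omega>) * f (H \<omega>))"
    unfolding D_def by (subst integral_distr) auto
  finally show "expectation (\<lambda>\<omega>. of_bool (X s \<omega> < \<theta> (x_of \<omega>)) * f (x_of \<omega>))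
      = expectation (\<lambda>\<omega>. \<theta> (x_of \<omega>) * f (x_of \<omega>))" by (simp add: \<theta>H fH)
qed

end

text \<open>If thresholding the estimate \<open>s\<close> decides differently from thresholding the
  true value \<open>x\<close>, then \<open>c\<close> lies between the two, so the wrong decision
  costs at most their distance.\<close>

lemma max_diff_le_indicator:
  fixes c s x :: real
  shows "max (x - c) 0 - \<bar>s - x\<bar> \<le> of_bool (c \<le> s) * (x - c)"
    and "max (c - x) 0 - \<bar>s - x\<bar> \<le> of_bool (s \<le> c) * (c - x)"
  by (cases "c \<le> s"; simp add: max_def abs_if) (cases "s \<le> c"; simp add: max_def abs_if)

context bandit
begin

subsection \<open>Concentration of the empirical mean\<close>

text \<open>Given the mean of the arm, its centred samples are uncorrelated: integrating out
  \<open>Unif i n\<close> first replaces the first indicator by \<open>X (Mu i)\<close>, and the two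
  terms cancel.\<close>

lemma expectation_sample_deviations:
  assumes i: "i < K" and nm: "n \<noteq> m"
  shows "expectation (\<lambda>\<omega>. (of_bool (X (Unif i n) \<omega> < X (Mu i) \<omega>) - X (Mu i) \<omega>)
    * (of_bool (X (Unif i m) \<omega> < X (Mu i) \<omega>) - X (Mu i) \<omega>)) = 0"
proof -
  let ?\<theta> = "\<lambda>x::src \<Rightarrow> real. x (Mu i)"
  let ?f = "\<lambda>x::src \<Rightarrow> real. of_bool (x (Unif i m) < x (Mu i)) - x (Mu i)"
  let ?A = "- {Unif i n}"
  have [measurable]: "(\<lambda>x. x (Mu i)) \<in> borel_measurable (PiM ?A (\<lambda>_. borel :: real measure))"
    "(\<lambda>x. x (Unif i m)) \<in> borel_measurable (PiM ?A (\<lambda>_. borel :: real measure))"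
    using nm by (auto intro!: measurable_component_singleton)
  have fB: "AE \<omega> in M. \<bar>?f (\<lambda>s. X s \<omega>)\<bar> \<le> 1"
    using AE_Mu[OF i] by eventually_elim auto
  have \<theta>: "AE \<omega> in M. 0 \<le> ?\<theta> (\<lambda>s. X s \<omega>) \<and> ?\<theta> (\<lambda>s. X s \<omega>) \<le> 1"
    using AE_Mu[OF i] by eventually_elim auto
  have *: "integrable M (\<lambda>\<omega>. of_bool (X (Unif i n) \<omega> < ?\<theta> (\<lambda>s. X s \<omega>)) * ?f (\<lambda>s. X s \<omega>))"
    "expectation (\<lambda>\<omega>. of_bool (X (Unif i n) \<omega> < ?\<theta> (\<lambda>s. X s \<omega>)) * ?f (\<lambda>s. X s \<omega>))
      = expectation (\<lambda>\<omega>. ?\<theta> (\<lambda>s. X s \<omega>) * ?f (\<lambda>s. X s \<omega>))"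
    using nm by (intro expectation_threshold[OF distr_Unif _ _ _ _ \<theta> fB]; simp)+
  have int: "integrable M (\<lambda>\<omega>. ?\<theta> (\<lambda>s. X s \<omega>) * ?f (\<lambda>s. X s \<omega>))"
  proof (rule integrable_const_bound[where B=1])
    show "AE \<omega> in M. norm (?\<theta> (\<lambda>s. X s \<omega>) * ?f (\<lambda>s. X s \<omega>)) \<le> 1"
      using \<theta> fB
    proof eventually_elim
      case (elim \<omega>)
      then show ?case
        using mult_mono[of "\<bar>X (Mu i) \<omega>\<bar>" 1 "\<bar>?f (\<lambda>s. X s \<omega>)\<bar>" 1] by (simp add: abs_mult)
    qed
  qed simp
  show ?thesis
    unfolding left_diff_distrib[of "of_bool _"] Bochner_Integration.integral_diff[OF *(1) int] *(2) by simp
qed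

lemma expectation_successes_deviation_sq:
  assumes i: "i < K"
  shows "expectation (\<lambda>\<omega>. (real (successes N i (\<lambda>s. X s \<omega>)) - real N * X (Mu i) \<omega>)\<^sup>2) \<le> real N"
proof -
  define D where "D n \<omega> = of_bool (X (Unif i n) \<omega> < X (Mu i) \<omega>) - X (Mu i) \<omega>" for n \<omega>
  have [measurable]: "D n \<in> borel_measurable M" for n
    unfolding D_def by measurable
  have DB: "AE \<omega> in M. \<bar>D n \<omega> * D m \<omega>\<bar> \<le> 1" for n m
    using AE_Mu[OF i]
  proof eventually_elim
    case (elim \<omega>)
    then have "\<bar>D n \<omega>\<bar> \<le> 1" "\<bar>D m \<omega>\<bar> \<le> 1" by (auto simp: D_def)
    then show ?case using mult_mono[of "\<bar>D n \<omega>\<bar>" 1 "\<bar>D m \<omega>\<bar>" 1] by (simp add: abs_mult)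
  qed
  have int: "integrable M (\<lambda>\<omega>. D n \<omega> * D m \<omega>)" for n m
    using DB by (intro integrable_const_bound[where B=1]) auto
  have sq: "(real (successes N i (\<lambda>s. X s \<omega>)) - real N * X (Mu i) \<omega>)\<^sup>2
      = (\<Sum>n<N. \<Sum>m<N. D n \<omega> * D m \<omega>)" for \<omega>
  proof -
    have "real (successes N i (\<lambda>s. X s \<omega>)) - real N * X (Mu i) \<omega> = (\<Sum>n<N. D n \<omega>)"
      by (simp add: successes_def D_def sum_subtractf)
    then show ?thesis by (simp add: power2_eq_square sum_product)
  qed
  have "expectation (\<lambda>\<omega>. (\<Sum>n<N. \<Sum>m<N. D n \<omega> * D m \<omega>))
      = (\<Sum>n<N. \<Sum>m<N. expectation (\<lambda>\<omega>. D n \<omega> * D m \<omega>))"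
    using int by (simp add: Bochner_Integration.integral_sum)
  also have "\<dots> \<le> (\<Sum>n<N. \<Sum>m<N. of_bool (n = m))"
  proof (intro sum_mono)
    fix n m
    show "expectation (\<lambda>\<omega>. D n \<omega> * D m \<omega>) \<le> of_bool (n = m)"
    proof (cases "n = m")
      case True
      have "expectation (\<lambda>\<omega>. D n \<omega> * D m \<omega>) \<le> 1"
        using DB[of n m] int by (intro integral_le_const) auto
      then show ?thesis using True by simp
    next
      case False
      then show ?thesis
        using expectation_sample_deviations[OF i False] by (simp add: D_def)
    qed
  qed
  also have "\<dots> = real N" by simp
  finally show ?thesis by (simp add: sq)
qed

lemma integrable_empirical_mean_error:
  assumes i: "i < K"
  shows "integrable M (\<lambda>\<omega>. \<bar>real (successes N i (\<lambda>s. X s \<omega>)) / real N - X (Mu i) \<omega>\<bar>)"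
proof (rule integrable_arm[OF i, where B=1 and \<phi>="\<lambda>x s. \<bar>real s / real N - x\<bar>"])
  fix x :: real and s assume a: "0 \<le> x" "x \<le> 1" "s \<le> N"
  have "0 \<le> real s / real N" "real s / real N \<le> 1"
    using a(3) by (auto simp: divide_le_eq_1)
  then show "\<bar>\<bar>real s / real N - x\<bar>\<bar> \<le> 1" using a(1,2) by linarith
qed simp

lemma expectation_empirical_mean_error:
  assumes i: "i < K" and \<delta>: "\<delta> > 0" and N: "real N \<ge> 4 / \<delta>\<^sup>2"
  shows "expectation (\<lambda>\<omega>. \<bar>real (successes N i (\<lambda>s. X s \<omega>)) / real N - X (Mu i) \<omega>\<bar>) \<le> \<delta> / 2"
proof -
  have N0: "real N > 0" using N \<delta> by (smt (verit) divide_pos_pos zero_less_power)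
  let ?e = "\<lambda>\<omega>. real (successes N i (\<lambda>s. X s \<omega>)) - real N * X (Mu i) \<omega>"
  \<comment> \<open>The inequality |y| \<le> \<delta>/4 + y^2/\<delta> turns the second-moment bound
    into a first-moment bound without square roots; the hypothesis on \<open>N\<close> makes the
    second term at most \<delta>/4 in expectation.\<close>
  have amgm: "\<bar>real S / real N - x\<bar> \<le> \<delta> / 4 + (real S - real N * x)\<^sup>2 / (\<delta> * (real N)\<^sup>2)" for S x
  proof -
    define y where "y = real S / real N - x"
    have "(real S - real N * x) = real N * y" using N0 by (simp add: y_def field_simps)
    then have "(real S - real N * x)\<^sup>2 / (\<delta> * (real N)\<^sup>2) = y\<^sup>2 / \<delta>"
      using N0 by (simp add: power_mult_distrib)
    moreover have "\<bar>y\<bar> \<le> \<delta> / 4 + y\<^sup>2 / \<delta>"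
    proof -
      have "0 \<le> (\<bar>y\<bar> - \<delta> / 2)\<^sup>2" by simp
      then have "\<delta> * \<bar>y\<bar> \<le> \<delta> * (\<delta> / 4 + y\<^sup>2 / \<delta>)"
        using \<delta> by (simp add: power2_eq_square algebra_simps)
      then show ?thesis using \<delta> by simp
    qed
    ultimately show ?thesis by (simp add: y_def)
  qed
  note i1 = integrable_empirical_mean_error[OF i, of N]
  have i2: "integrable M (\<lambda>\<omega>. (?e \<omega>)\<^sup>2)"
  proof (rule integrable_arm[OF i, where B="(real N)\<^sup>2" and \<phi>="\<lambda>x s. (real s - real N * x)\<^sup>2"])
    fix x :: real and s assume a: "0 \<le> x" "x \<le> 1" "s \<le> N"
    have "0 \<le> real N * x" "real N * x \<le> real N" "real s \<le> real N"
      using a by (auto intro: mult_left_le)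
    then have "\<bar>real s - real N * x\<bar> \<le> \<bar>real N\<bar>" by linarith
    then show "\<bar>(real s - real N * x)\<^sup>2\<bar> \<le> (real N)\<^sup>2" by (metis abs_le_square_iff abs_power2)
  qed simp
  have "expectation (\<lambda>\<omega>. \<bar>real (successes N i (\<lambda>s. X s \<omega>)) / real N - X (Mu i) \<omega>\<bar>)
      \<le> expectation (\<lambda>\<omega>. \<delta> / 4 + (?e \<omega>)\<^sup>2 / (\<delta> * (real N)\<^sup>2))"
    using amgm i1 i2 by (intro integral_mono) auto
  also have "\<dots> = \<delta> / 4 + expectation (\<lambda>\<omega>. (?e \<omega>)\<^sup>2) / (\<delta> * (real N)\<^sup>2)"
    using i2 by (simp add: prob_space)
  also have "\<dots> \<le> \<delta> / 4 + real N / (\<delta> * (real N)\<^sup>2)"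
    using expectation_successes_deviation_sq[OF i, of N] \<delta> N0
    by (intro add_left_mono divide_right_mono) auto
  also have "\<dots> = \<delta> / 4 + 1 / (\<delta> * real N)"
    using N0 by (simp add: power2_eq_square)
  also have "\<dots> \<le> \<delta> / 2"
    using N N0 \<delta> by (simp add: field_simps power2_eq_square)
  finally show ?thesis .
qed

text \<open>Used with \<open>c = \<Phi>\<close> for the replay rule. Deciding by the empirical mean
  keeps the prior excess over \<open>c\<close> up to the expected estimation error. The mirror image
  below \<open>c\<close> controls the low counts in the tilt.\<close>

lemma expectation_above_threshold:
  assumes i: "i < K" and \<delta>: "\<delta> > 0" and N: "real N \<ge> 4 / \<delta>\<^sup>2"
  shows "expectation (\<lambda>\<omega>. of_bool (real N * c \<le> real (successes N i (\<lambda>s. X s \<omega>))) * (X (Mu i) \<omega> - c))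
    \<ge> (\<integral>x. max (x - c) 0 \<partial>P i) - \<delta> / 2"
proof -
  have N0: "real N > 0" using N \<delta> by (smt (verit) divide_pos_pos zero_less_power)
  note i0 = integrable_empirical_mean_error[OF i, of N]
  have i1: "integrable M (\<lambda>\<omega>. max (X (Mu i) \<omega> - c) 0)"
    by (rule integrable_arm[OF i, where B="1 + \<bar>c\<bar>" and \<phi>="\<lambda>x s. max (x - c) 0"]) auto
  have i2: "integrable M (\<lambda>\<omega>. of_bool (real N * c \<le> real (successes N i (\<lambda>s. X s \<omega>))) * (X (Mu i) \<omega> - c))"
    by (rule integrable_arm[OF i, where B="1 + \<bar>c\<bar>" and \<phi>="\<lambda>x s. of_bool (real N * c \<le> real s) * (x - c)"])
       auto
  have "(\<integral>x. max (x - c) 0 \<partial>P i) - \<delta> / 2 \<le> expectation (\<lambda>\<omega>. max (X (Mu i) \<omega> - c) 0)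
     - expectation (\<lambda>\<omega>. \<bar>real (successes N i (\<lambda>s. X s \<omega>)) / real N - X (Mu i) \<omega>\<bar>)"
    using expectation_empirical_mean_error[OF i \<delta> N] expectation_Mu[OF i, of "\<lambda>x. max (x - c) 0"]
    by simp
  also have "\<dots> = expectation (\<lambda>\<omega>. max (X (Mu i) \<omega> - c) 0
     - \<bar>real (successes N i (\<lambda>s. X s \<omega>)) / real N - X (Mu i) \<omega>\<bar>)"
    using i0 i1 by simp
  also have "\<dots> \<le> expectation (\<lambda>\<omega>. of_bool (real N * c \<le> real (successes N i (\<lambda>s. X s \<omega>))) * (X (Mu i) \<omega> - c))"
  proof (rule integral_mono[OF Bochner_Integration.integrable_diff[OF i1 i0] i2])
    fix \<omega>
    have eq: "real N * c \<le> real S \<longleftrightarrow> c \<le> real S / real N" for S :: nat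
      using N0 by (simp add: field_simps)
    show "max (X (Mu i) \<omega> - c) 0 - \<bar>real (successes N i (\<lambda>s. X s \<omega>)) / real N - X (Mu i) \<omega>\<bar>
       \<le> of_bool (real N * c \<le> real (successes N i (\<lambda>s. X s \<omega>))) * (X (Mu i) \<omega> - c)"
      unfolding eq by (rule max_diff_le_indicator(1))
  qed
  finally show ?thesis .
qed

lemma expectation_below_threshold:
  assumes i: "i < K" and \<delta>: "\<delta> > 0" and N: "real N \<ge> 4 / \<delta>\<^sup>2"
  shows "expectation (\<lambda>\<omega>. of_bool (real (successes N i (\<lambda>s. X s \<omega>)) \<le> real N * c) * (c - X (Mu i) \<omega>))
    \<ge> (\<integral>x. max (c - x) 0 \<partial>P i) - \<delta> / 2"
proof -
  have N0: "real N > 0" using N \<delta> by (smt (verit) divide_pos_pos zero_less_power)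
  note i0 = integrable_empirical_mean_error[OF i, of N]
  have i1: "integrable M (\<lambda>\<omega>. max (c - X (Mu i) \<omega>) 0)"
    by (rule integrable_arm[OF i, where B="1 + \<bar>c\<bar>" and \<phi>="\<lambda>x s. max (c - x) 0"]) auto
  have i2: "integrable M (\<lambda>\<omega>. of_bool (real (successes N i (\<lambda>s. X s \<omega>)) \<le> real N * c) * (c - X (Mu i) \<omega>))"
    by (rule integrable_arm[OF i, where B="1 + \<bar>c\<bar>" and \<phi>="\<lambda>x s. of_bool (real s \<le> real N * c) * (c - x)"])
       auto
  have "(\<integral>x. max (c - x) 0 \<partial>P i) - \<delta> / 2 \<le> expectation (\<lambda>\<omega>. max (c - X (Mu i) \<omega>) 0)
     - expectation (\<lambda>\<omega>. \<bar>real (successes N i (\<lambda>s. X s \<omega>)) / real N - X (Mu i) \<omega>\<bar>)"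
    using expectation_empirical_mean_error[OF i \<delta> N] expectation_Mu[OF i, of "\<lambda>x. max (c - x) 0"]
    by simp
  also have "\<dots> = expectation (\<lambda>\<omega>. max (c - X (Mu i) \<omega>) 0
     - \<bar>real (successes N i (\<lambda>s. X s \<omega>)) / real N - X (Mu i) \<omega>\<bar>)"
    using i0 i1 by simp
  also have "\<dots> \<le> expectation (\<lambda>\<omega>. of_bool (real (successes N i (\<lambda>s. X s \<omega>)) \<le> real N * c) * (c - X (Mu i) \<omega>))"
  proof (rule integral_mono[OF Bochner_Integration.integrable_diff[OF i1 i0] i2])
    fix \<omega>
    have eq: "real S \<le> real N * c \<longleftrightarrow> real S / real N \<le> c" for S :: nat
      using N0 by (simp add: field_simps)
    show "max (c - X (Mu i) \<omega>) 0 - \<bar>real (successes N i (\<lambda>s. X s \<omega>)) / real N - X (Mu i) \<omega>\<bar>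
       \<le> of_bool (real (successes N i (\<lambda>s. X s \<omega>)) \<le> real N * c) * (c - X (Mu i) \<omega>)"
      unfolding eq by (rule max_diff_le_indicator(2))
  qed
  finally show ?thesis .
qed

subsection \<open>The Thompson sampling parameters\<close>

text \<open>Conditional Jensen: averaging out arm \<open>i\<close> first can only lower the positive
  part, and what is left is the deficit of arm \<open>j\<close> below the prior mean of
  \<open>i\<close>, which non-domination bounds. The averaging is carried out through the indicator
  that arm \<open>j\<close> lies below that mean.\<close>

lemma eps_TS_ge:
  assumes K: "K \<ge> 2"
    and nd: "\<And>i j. i < K \<Longrightarrow> j < K \<Longrightarrow> i \<noteq> j \<Longrightarrow> \<delta> \<le> (\<integral>x. max (mean (P j) - x) 0 \<partial>P i)"
  shows "\<delta> \<le> eps_TS K M X"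
proof -
  define E where "E i j = expectation (\<lambda>\<omega>. max (X (Mu i) \<omega> - X (Mu j) \<omega>) 0)" for i j
  let ?S = "{E i j | i j. i < K \<and> j < K \<and> i \<noteq> j}"
  have "?S \<subseteq> case_prod E ` ({..<K} \<times> {..<K})" by auto
  then have fin: "finite ?S" by (rule finite_subset) auto
  have "E 0 1 \<in> ?S" using K by (intro CollectI exI[of _ "0::nat"] exI[of _ "1::nat"]) auto
  then have ne: "?S \<noteq> {}" by blast
  have "\<delta> \<le> E i j" if ij: "i < K" "j < K" "i \<noteq> j" for i j
  proof -
    define m where "m = mean (P i)"
    define \<phi> where "\<phi> l x s = (if l = j then of_bool (x < m) else 1) * (if l = i then x else 1)"
      for l :: nat and x :: real and s :: nat
    have ind: "expectation (\<lambda>\<omega>. \<Prod>l<K. \<phi> l (X (Mu l) \<omega>) (successes 0 l (\<lambda>s. X s \<omega>)))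
      = (\<Prod>l<K. expectation (\<lambda>\<omega>. \<phi> l (X (Mu l) \<omega>) (successes 0 l (\<lambda>s. X s \<omega>))))"
      by (rule expectation_prod_arms[where B=1]) (auto simp: \<phi>_def)
    have "(\<Prod>l<K. \<phi> l (X (Mu l) \<omega>) s) = of_bool (X (Mu j) \<omega> < m) * X (Mu i) \<omega>" for \<omega> s
      using ij by (simp add: \<phi>_def prod.distrib)
    moreover have "(\<Prod>l<K. expectation (\<lambda>\<omega>. \<phi> l (X (Mu l) \<omega>) s))
      = (\<Prod>l<K. (if l = j then expectation (\<lambda>\<omega>. of_bool (X (Mu j) \<omega> < m)) else 1)
          * (if l = i then m else 1))" for s
      using ij by (intro prod.cong) (auto simp: \<phi>_def expectation_Mu_mean m_def prob_space)
    ultimately have prodE: "expectation (\<lambda>\<omega>. of_bool (X (Mu j) \<omega> < m) * X (Mu i) \<omega>)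
        = expectation (\<lambda>\<omega>. of_bool (X (Mu j) \<omega> < m)) * m"
      using ind ij by (simp add: prod.distrib successes_def)
    have i1: "integrable M (\<lambda>\<omega>. of_bool (X (Mu j) \<omega> < m) * X (Mu i) \<omega>)"
      using AE_Mu[OF ij(1)] by (intro integrable_const_bound[where B=1]) auto
    have i2: "integrable M (\<lambda>\<omega>. of_bool (X (Mu j) \<omega> < m) * X (Mu j) \<omega>)"
      using AE_Mu[OF ij(2)] by (intro integrable_const_bound[where B=1]) auto
    have i3: "integrable M (\<lambda>\<omega>. of_bool (X (Mu j) \<omega> < m) :: real)"
      by (intro integrable_const_bound[where B=1]) auto
    have i4: "integrable M (\<lambda>\<omega>. max (X (Mu i) \<omega> - X (Mu j) \<omega>) 0)"
      using AE_Mu[OF ij(1)] AE_Mu[OF ij(2)] by (intro integrable_const_bound[where B=1]) auto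
    have "\<delta> \<le> (\<integral>x. max (m - x) 0 \<partial>P j)" using nd[of j i] ij by (simp add: m_def)
    also have "\<dots> = expectation (\<lambda>\<omega>. max (m - X (Mu j) \<omega>) 0)"
      using expectation_Mu[OF ij(2), of "\<lambda>x. max (m - x) 0"] by simp
    also have "\<dots> = expectation (\<lambda>\<omega>. of_bool (X (Mu j) \<omega> < m) * m - of_bool (X (Mu j) \<omega> < m) * X (Mu j) \<omega>)"
      by (intro Bochner_Integration.integral_cong) auto
    also have "\<dots> = expectation (\<lambda>\<omega>. of_bool (X (Mu j) \<omega> < m) * X (Mu i) \<omega>
        - of_bool (X (Mu j) \<omega> < m) * X (Mu j) \<omega>)"
      using i1 i2 i3 prodE by (simp)
    also have "\<dots> \<le> E i j" unfolding E_def
      using i1 i2 i4 by (intro integral_mono) auto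
    finally show ?thesis .
  qed
  then show ?thesis unfolding eps_TS_def E_def[symmetric] using fin ne
    by (subst Min_ge_iff) auto
qed

text \<open>Arm \<open>i\<close> is the unique best arm when it exceeds \<Phi> and all others stay
  below \<Phi>. These events are independent, and each has probability at least \<delta> because the
  expected excess or deficit of a [0,1]-valued mean is at most the probability that it is
  nonzero.\<close>

lemma delta_TS_ge:
  assumes K: "K \<ge> 2" and \<delta>: "\<delta> > 0" and \<Phi>: "0 \<le> \<Phi>" "\<And>i. i < K \<Longrightarrow> mean (P i) \<le> \<Phi>"
    and nd: "\<And>i j. i < K \<Longrightarrow> j < K \<Longrightarrow> i \<noteq> j \<Longrightarrow> \<delta> \<le> (\<integral>x. max (mean (P j) - x) 0 \<partial>P i)"
    and easy: "\<And>i. i < K \<Longrightarrow> \<delta> \<le> (\<integral>x. max (x - \<Phi>) 0 \<partial>P i)"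
  shows "\<delta> ^ K \<le> delta_TS K M X"
proof -
  let ?p = "\<lambda>i. prob {\<omega> \<in> space M. best_arm K X \<omega> = i}"
  have "\<delta> ^ K \<le> ?p i" if i: "i < K" for i
  proof -
    define \<phi> :: "nat \<Rightarrow> real \<Rightarrow> nat \<Rightarrow> real"
      where "\<phi> l x s = (if l = i then of_bool (\<Phi> < x) else of_bool (x < \<Phi>))" for l x s
    have \<phi>\<delta>: "\<delta> \<le> expectation (\<lambda>\<omega>. \<phi> l (X (Mu l) \<omega>) s)" if l: "l < K" for l s
    proof -
      have i0: "integrable M (\<lambda>\<omega>. \<phi> l (X (Mu l) \<omega>) s)"
        unfolding \<phi>_def by (intro integrable_const_bound[where B=1]) auto
      show ?thesis
      proof (cases "l = i")
        case True
        have i1: "integrable M (\<lambda>\<omega>. max (X (Mu l) \<omega> - \<Phi>) 0)"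
          using AE_Mu[OF l] \<Phi>(1) by (intro integrable_const_bound[where B=1]) auto
        have "\<delta> \<le> expectation (\<lambda>\<omega>. max (X (Mu l) \<omega> - \<Phi>) 0)"
          using easy[OF l] expectation_Mu[OF l, of "\<lambda>x. max (x - \<Phi>) 0"] by simp
        also have "\<dots> \<le> expectation (\<lambda>\<omega>. \<phi> l (X (Mu l) \<omega>) s)"
          using AE_Mu[OF l] \<Phi>(1) True by (intro integral_mono_AE i0 i1) (auto simp: \<phi>_def)
        finally show ?thesis .
      next
        case False
        define m where "m = mean (P i)"
        have m: "m \<le> \<Phi>" "m \<le> 1" using \<Phi>(2)[OF i] dist01_mean_bounds(2)[OF dist01[OF i]]
          by (auto simp: m_def)
        have i1: "integrable M (\<lambda>\<omega>. max (m - X (Mu l) \<omega>) 0)"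
          using AE_Mu[OF l] m by (intro integrable_const_bound[where B=1]) auto
        have "\<delta> \<le> expectation (\<lambda>\<omega>. max (m - X (Mu l) \<omega>) 0)"
          using nd[OF l i False] expectation_Mu[OF l, of "\<lambda>x. max (m - x) 0"] by (simp add: m_def)
        also have "\<dots> \<le> expectation (\<lambda>\<omega>. \<phi> l (X (Mu l) \<omega>) s)"
          using AE_Mu[OF l] m False by (intro integral_mono_AE i0 i1) (auto simp: \<phi>_def)
        finally show ?thesis .
      qed
    qed
    let ?E = "{\<omega> \<in> space M. \<forall>l<K. if l = i then \<Phi> < X (Mu l) \<omega> else X (Mu l) \<omega> < \<Phi>}"
    have "\<delta> ^ K = (\<Prod>l<K. \<delta>)" by simp
    also have "\<dots> \<le> (\<Prod>l<K. expectation (\<lambda>\<omega>. \<phi> l (X (Mu l) \<omega>) (successes 0 l (\<lambda>s. X s \<omega>))))"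
      using \<phi>\<delta> \<delta> by (intro prod_mono) (auto simp: successes_def)
    also have "\<dots> = expectation (\<lambda>\<omega>. \<Prod>l<K. \<phi> l (X (Mu l) \<omega>) (successes 0 l (\<lambda>s. X s \<omega>)))"
      by (rule expectation_prod_arms[symmetric, where B=1]) (auto simp: \<phi>_def)
    also have "\<dots> = expectation (indicator ?E)"
    proof (intro Bochner_Integration.integral_cong refl)
      fix \<omega> assume "\<omega> \<in> space M"
      then show "(\<Prod>l<K. \<phi> l (X (Mu l) \<omega>) (successes 0 l (\<lambda>s. X s \<omega>))) = indicator ?E \<omega>"
        by (auto simp: \<phi>_def indicator_def prod_zero_iff split: if_splits intro!: prod.neutral)
    qed
    also have "\<dots> = prob ?E" by simp
    also have "\<dots> \<le> ?p i"
    proof (rule finite_measure_mono)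
      show "?E \<subseteq> {\<omega> \<in> space M. best_arm K X \<omega> = i}"
      proof safe
        fix \<omega> assume a: "\<forall>l<K. if l = i then \<Phi> < X (Mu l) \<omega> else X (Mu l) \<omega> < \<Phi>"
        have gt: "\<Phi> < X (Mu i) \<omega>" using a i by metis
        have lt: "l < K \<Longrightarrow> l \<noteq> i \<Longrightarrow> X (Mu l) \<omega> < \<Phi>" for l using a by metis
        show "best_arm K X \<omega> = i" unfolding best_arm_def
        proof (rule Least_equality)
          show "i < K \<and> (\<forall>j<K. X (Mu j) \<omega> \<le> X (Mu i) \<omega>)"
            using i gt lt by (metis less_eq_real_def order_less_trans)
          fix y assume y: "y < K \<and> (\<forall>j<K. X (Mu j) \<omega> \<le> X (Mu y) \<omega>)"
          then have "y = i" using lt[of y] gt i by (metis not_less order_less_trans)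
          then show "i \<le> y" by simp
        qed
      qed
      show "{\<omega> \<in> space M. best_arm K X \<omega> = i} \<in> events"
        unfolding best_arm_def by measurable
    qed
    finally show ?thesis .
  qed
  then show ?thesis unfolding delta_TS_def using K
    by (subst Min_ge_iff) (auto simp: setcompr_eq_image intro!: exI[of _ 0])
qed

lemma N_TS_le:
  assumes K: "K \<ge> 2" and \<delta>: "\<delta> > 0" and \<Phi>: "0 \<le> \<Phi>" "\<And>i. i < K \<Longrightarrow> mean (P i) \<le> \<Phi>"
    and nd: "\<And>i j. i < K \<Longrightarrow> j < K \<Longrightarrow> i \<noteq> j \<Longrightarrow> \<delta> \<le> (\<integral>x. max (mean (P j) - x) 0 \<partial>P i)"
    and easy: "\<And>i. i < K \<Longrightarrow> \<delta> \<le> (\<integral>x. max (x - \<Phi>) 0 \<partial>P i)"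
    and CTS: "CTS \<ge> 0"
  shows "N_TS CTS K M X \<le> CTS * (1 / \<delta>\<^sup>2) * (real K * \<bar>ln \<delta>\<bar>)"
proof -
  have e: "\<delta> \<le> eps_TS K M X" by (rule eps_TS_ge[OF K nd])
  have d: "\<delta> ^ K \<le> delta_TS K M X" by (rule delta_TS_ge[OF K \<delta> \<Phi> nd easy])
  have dpos: "delta_TS K M X > 0" using d \<delta> by (smt (verit) zero_less_power)
  have "ln (1 / delta_TS K M X) = - ln (delta_TS K M X)" using dpos by (simp add: ln_div)
  also have "\<dots> \<le> - ln (\<delta> ^ K)" using d \<delta> dpos by simp
  also have "\<dots> = real K * (- ln \<delta>)" using \<delta> by (simp add: ln_realpow)
  also have "\<dots> \<le> real K * \<bar>ln \<delta>\<bar>" by (intro mult_left_mono) auto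
  finally have l: "ln (1 / delta_TS K M X) \<le> real K * \<bar>ln \<delta>\<bar>" .
  have p: "eps_TS K M X powr (-2) \<le> 1 / \<delta>\<^sup>2"
  proof -
    have "eps_TS K M X powr (-2) = 1 / (eps_TS K M X)\<^sup>2"
      using e \<delta> by (simp add: powr_minus divide_simps)
    also have "\<dots> \<le> 1 / \<delta>\<^sup>2" using e \<delta> by (intro divide_left_mono power_mono) auto
    finally show ?thesis .
  qed
  have "N_TS CTS K M X \<le> CTS * eps_TS K M X powr (-2) * (real K * \<bar>ln \<delta>\<bar>)"
    unfolding N_TS_def using l CTS by (intro mult_left_mono) auto
  also have "\<dots> \<le> CTS * (1 / \<delta>\<^sup>2) * (real K * \<bar>ln \<delta>\<bar>)"
    using p CTS by (intro mult_right_mono mult_left_mono) auto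
  finally show ?thesis .
qed

end

subsection \<open>Hard classes\<close>

lemma (in bandit) indep_Mu: "indep_vars (\<lambda>_. borel) (\<lambda>i. X (Mu i)) J"
proof -
  have "indep_vars (\<lambda>i. PiM {Mu i} (\<lambda>_. borel)) (\<lambda>i \<omega>. restrict (\<lambda>s. X s \<omega>) {Mu i}) J"
    by (rule indep_vars_restrict[OF indep]) (auto simp: disjoint_family_on_def)
  then have "indep_vars (\<lambda>_. borel) (\<lambda>i \<omega>. (\<lambda>x. x (Mu i)) (restrict (\<lambda>s. X s \<omega>) {Mu i})) J"
    by (rule indep_vars_compose2) (auto intro!: measurable_component_singleton)
  then show ?thesis by simp
qed

lemma (in bandit) L_val_ge:
  assumes j: "j < K" and q: "q \<in> arm_simplex K"
    and num: "n \<le> expectation (\<lambda>\<omega>. max (- (X (Mu j) \<omega> - (\<Sum>i<K. q i * X (Mu i) \<omega>))) 0)"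
    and den: "expectation (\<lambda>\<omega>. max (X (Mu j) \<omega> - (\<Sum>i<K. q i * X (Mu i) \<omega>)) 0) \<le> d"
    and pos: "0 < n" "0 < d"
  shows "ereal (n / d) \<le> L_val K M X"
proof -
  let ?n = "expectation (\<lambda>\<omega>. max (- (X (Mu j) \<omega> - (\<Sum>i<K. q i * X (Mu i) \<omega>))) 0)"
  let ?d = "expectation (\<lambda>\<omega>. max (X (Mu j) \<omega> - (\<Sum>i<K. q i * X (Mu i) \<omega>)) 0)"
  have d0: "?d \<ge> 0" by (intro integral_nonneg_AE) auto
  have "ereal (n / d) \<le> ereal ?n / ereal ?d"
  proof (cases "?d = 0")
    \<comment> \<open>In \<open>ereal\<close> a positive number divided by 0 is \<infinity>, so a
      vanishing denominator only helps.\<close>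
    case True
    then show ?thesis using num pos(1) by (simp add: divide_ereal_def)
  next
    case False
    then have "n / d \<le> ?n / ?d" using num den pos d0 by (intro frac_le) (auto simp: less_le)
    then show ?thesis using False by simp
  qed
  also have "\<dots> \<le> L_val K M X"
    unfolding L_val_def by (rule SUP_upper2[of "(j, q)"]) (use j q in auto)
  finally show ?thesis .
qed

text \<open>\<open>c\<close> stands for \<Phi> - \<delta>. A good prior with mean within \<delta>/4
  of \<Phi> leaves the gap 3/4 \<delta>, and \<epsilon> bounds the mass of the bad prior from
  \<open>c\<close> upwards.\<close>

locale hard_instance =
  fixes Q B :: "real measure" and m c \<delta> \<epsilon> :: real and n :: nat
  assumes Q: "dist01 Q" and B: "dist01 B" and n: "n > 0" and \<delta>: "\<delta> > 0" and c: "0 \<le> c"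
    and mQ: "c + 3 / 4 * \<delta> \<le> mean Q" and eB: "measure B {c..} \<le> \<epsilon>"
begin

definition prior :: "nat \<Rightarrow> real measure" where
  "prior i = (if i < n then Q else B)"

lemma mean_B: "mean B \<le> c + \<epsilon>"
proof -
  interpret prob_space B by (rule dist01_prob[OF B])
  have i1: "integrable B (\<lambda>x. x)" by (rule dist01_integrable[OF B, where B=1]) auto
  have i2: "integrable B (\<lambda>x. c + indicator {c..} x)"
    by (rule dist01_integrable[OF B, where B="c + 1"]) (use c in \<open>auto simp: indicator_def\<close>)
  have [simp]: "prob UNIV = 1" using prob_space by (simp add: dist01_space[OF B])
  have "mean B \<le> (\<integral>x. c + indicator {c..} x \<partial>B)"
    unfolding mean_def
    using dist01_AE[OF B] c by (intro integral_mono_AE i1 i2) (auto simp: indicator_def)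
  also have "\<dots> = c + measure B {c..}"
    using dist01_integrable[OF B, of "indicator {c..}" 1]
    by (subst Bochner_Integration.integral_add) (auto simp: prob_space dist01_space[OF B])
  finally show ?thesis using eB by simp
qed

text \<open>The ratio in \<open>L_val\<close> is tested on the bad arm against the uniform mixture
  of the good ones. Its numerator is at least the difference of the prior means. In the denominator
  the positive part is at most 1, and it vanishes unless the bad arm reaches \<open>c\<close> or the
  good average drops to \<open>c\<close>; the latter is a deviation of 3/4 \<delta> per arm.\<close>

lemma L_val_prior_ge:
  assumes real: "realization (Suc n) prior M X"
    and num: "0 < a" "a \<le> 3 / 4 * \<delta> - \<epsilon>"
    and den: "\<epsilon> + exp (- 9 / 8 * \<delta>\<^sup>2 * real n) \<le> d"
  shows "ereal (a / d) \<le> L_val (Suc n) M X"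
proof -
  interpret bandit "Suc n" prior M X
    by unfold_locales (use real Q B in \<open>auto simp: prior_def\<close>)
  define q where "q i = (if i < n then 1 / real n else 0)" for i :: nat
  define \<nu> where "\<nu> \<omega> = (\<Sum>i<n. X (Mu i) \<omega>)" for \<omega>
  have [measurable]: "\<nu> \<in> borel_measurable M" unfolding \<nu>_def by measurable
  have q: "q \<in> arm_simplex (Suc n)"
    using n by (auto simp: arm_simplex_def q_def)
  have qX: "(\<Sum>i<Suc n. q i * X (Mu i) \<omega>) = \<nu> \<omega> / real n" for \<omega>
    by (simp add: q_def \<nu>_def sum_divide_distrib)
  have \<nu>01: "AE \<omega> in M. 0 \<le> \<nu> \<omega> / real n \<and> \<nu> \<omega> / real n \<le> 1"
    using AE_Mu_all
  proof eventually_elim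
    case (elim \<omega>)
    then have "0 \<le> \<nu> \<omega>" "\<nu> \<omega> \<le> (\<Sum>i<n. 1)"
      unfolding \<nu>_def by (intro sum_nonneg sum_mono; simp)+
    then show ?case using n by simp
  qed
  have intX: "integrable M (X (Mu i))" if "i < Suc n" for i
    using AE_Mu[OF that] by (intro integrable_const_bound[where B=1]) auto
  have E\<nu>: "expectation \<nu> = real n * mean Q"
  proof -
    have "expectation \<nu> = (\<Sum>i<n. expectation (X (Mu i)))"
      unfolding \<nu>_def using intX by (intro Bochner_Integration.integral_sum) auto
    also have "\<dots> = (\<Sum>i<n. mean Q)"
      by (intro sum.cong) (auto simp: expectation_Mu_mean prior_def)
    finally show ?thesis by simp
  qed
  have int\<nu>: "integrable M (\<lambda>\<omega>. \<nu> \<omega> / real n)"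
    using \<nu>01 by (intro integrable_const_bound[where B=1]) auto
  have EX: "expectation (X (Mu n)) = mean B"
    by (simp add: expectation_Mu_mean prior_def)
  have int1: "integrable M (\<lambda>\<omega>. max (- (X (Mu n) \<omega> - \<nu> \<omega> / real n)) 0)"
    using int\<nu> intX[of n] by auto
  have "a \<le> mean Q - mean B" using num mQ mean_B by simp
  also have "\<dots> = expectation (\<lambda>\<omega>. \<nu> \<omega> / real n - X (Mu n) \<omega>)"
    using int\<nu> intX[of n] n by (simp add: E\<nu> EX)
  also have "\<dots> \<le> expectation (\<lambda>\<omega>. max (- (X (Mu n) \<omega> - \<nu> \<omega> / real n)) 0)"
    using int\<nu> intX[of n] int1 by (intro integral_mono) auto
  finally have num': "a \<le> expectation (\<lambda>\<omega>. max (- (X (Mu n) \<omega> - \<nu> \<omega> / real n)) 0)" .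
  have pB: "prob {\<omega> \<in> space M. c \<le> X (Mu n) \<omega>} \<le> \<epsilon>"
  proof -
    have "prob {\<omega> \<in> space M. c \<le> X (Mu n) \<omega>} = measure (distr M borel (X (Mu n))) {c..}"
      by (subst measure_distr) (auto intro!: arg_cong[where f=prob])
    also have "\<dots> = measure B {c..}" by (subst distr_Mu) (auto simp: prior_def)
    finally show ?thesis using eB by simp
  qed
  have pQ: "prob {\<omega> \<in> space M. \<nu> \<omega> \<le> real n * c} \<le> exp (- 9 / 8 * \<delta>\<^sup>2 * real n)"
  proof -
    interpret H: Hoeffding_ineq M "{..<n}" "\<lambda>i. X (Mu i)" "\<lambda>_. 0" "\<lambda>_. 1"
      "\<Sum>i<n. expectation (X (Mu i))"
    proof unfold_locales
      show "indep_vars (\<lambda>_. borel) (\<lambda>i. X (Mu i)) {..<n}" by (rule indep_Mu)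
      show "\<And>i. i \<in> {..<n} \<Longrightarrow> AE \<omega> in M. X (Mu i) \<omega> \<in> {0..1}"
        using AE_Mu by auto
    qed auto
    have E: "(\<Sum>i<n. expectation (X (Mu i))) = real n * mean Q"
      using E\<nu> intX by (simp add: \<nu>_def[abs_def])
    have "prob {\<omega> \<in> space M. \<nu> \<omega> \<le> real n * c}
      \<le> prob {\<omega> \<in> space M. (\<Sum>i<n. X (Mu i) \<omega>) \<le> (\<Sum>i<n. expectation (X (Mu i))) - real n * (3 / 4 * \<delta>)}"
    proof (rule finite_measure_mono)
      have "real n * c \<le> real n * mean Q - real n * (3 / 4 * \<delta>)"
        using mult_left_mono[OF mQ, of "real n"] by (simp add: algebra_simps)
      then show "{\<omega> \<in> space M. \<nu> \<omega> \<le> real n * c} \<subseteq> {\<omega> \<in> space M. (\<Sum>i<n. X (Mu i) \<omega>)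
          \<le> (\<Sum>i<n. expectation (X (Mu i))) - real n * (3 / 4 * \<delta>)}"
        unfolding E by (auto simp: \<nu>_def)
    qed measurable
    also have "\<dots> \<le> exp (- 2 * (real n * (3 / 4 * \<delta>))\<^sup>2 / (\<Sum>i<n. (1 - 0)\<^sup>2))"
      using \<delta> n by (intro H.Hoeffding_ineq_le) auto
    also have "\<dots> = exp (- 9 / 8 * \<delta>\<^sup>2 * real n)"
      using n by (simp add: power2_eq_square)
    finally show ?thesis .
  qed
  have "expectation (\<lambda>\<omega>. max (X (Mu n) \<omega> - \<nu> \<omega> / real n) 0)
      \<le> expectation (\<lambda>\<omega>. indicator {\<omega> \<in> space M. c \<le> X (Mu n) \<omega>} \<omega>
          + indicator {\<omega> \<in> space M. \<nu> \<omega> \<le> real n * c} \<omega>)"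
  proof (rule integral_mono_AE)
    show "integrable M (\<lambda>\<omega>. max (X (Mu n) \<omega> - \<nu> \<omega> / real n) 0)"
      using int\<nu> intX[of n] by auto
    show "integrable M (\<lambda>\<omega>. indicator {\<omega> \<in> space M. c \<le> X (Mu n) \<omega>} \<omega>
          + indicator {\<omega> \<in> space M. \<nu> \<omega> \<le> real n * c} \<omega> :: real)"
      by (intro Bochner_Integration.integrable_add integrable_real_indicator) (auto simp: emeasure_eq_measure)
    show "AE \<omega> in M. max (X (Mu n) \<omega> - \<nu> \<omega> / real n) 0
       \<le> indicator {\<omega> \<in> space M. c \<le> X (Mu n) \<omega>} \<omega> + indicator {\<omega> \<in> space M. \<nu> \<omega> \<le> real n * c} \<omega>"
      using \<nu>01 AE_Mu[OF lessI] AE_space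
    proof eventually_elim
      case (elim \<omega>)
      have "\<nu> \<omega> \<le> real n * c \<longleftrightarrow> \<nu> \<omega> / real n \<le> c" using n by (simp add: field_simps)
      then show ?case using elim by (auto simp: indicator_def)
    qed
  qed
  also have "\<dots> = prob {\<omega> \<in> space M. c \<le> X (Mu n) \<omega>} + prob {\<omega> \<in> space M. \<nu> \<omega> \<le> real n * c}"
    by (subst Bochner_Integration.integral_add) (auto simp: emeasure_eq_measure)
  finally have den': "expectation (\<lambda>\<omega>. max (X (Mu n) \<omega> - \<nu> \<omega> / real n) 0) \<le> d"
    using pB pQ den by linarith
  have "\<epsilon> \<ge> 0" using eB measure_nonneg order_trans by blast
  then have "d > 0" using den by (smt (verit) exp_gt_zero)
  then show ?thesis
    using L_val_ge[OF _ q, of n a d] num' den' num(1) unfolding qX by simp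
qed

end

theorem delta_hard_lower_bound:
  assumes \<delta>: "\<delta> > 0"
  shows "\<exists>c>0. \<forall>C::real measure set.
      C \<noteq> {} \<longrightarrow> (\<forall>P\<in>C. dist01 P) \<longrightarrow> delta_hard C \<delta> \<longrightarrow>
      (\<exists>K0. \<forall>K\<ge>K0. \<exists>P. consistent C K P \<and>
         (\<forall>i j. i \<le> j \<longrightarrow> j < K \<longrightarrow> mean (P j) \<le> mean (P i)) \<and>
         (\<forall>(M::'w measure) X. realization K P M X \<longrightarrow> R_LB K M X > ereal (exp (c * real K))))"
\<comment> \<open>The denominator of the ratio is of order exp (- \<delta>^2 K / 2). Half of this
  exponent is given up to absorb the factor \<delta>/4 in front, which leaves \<delta>^2/4.\<close>
proof (intro exI[of _ "\<delta>\<^sup>2 / 4"] conjI allI impI)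
  fix C :: "real measure set"
  assume ne: "C \<noteq> {}" and d: "\<forall>P\<in>C. dist01 P" and hard: "delta_hard C \<delta>"
  define c where "c = Phi C - \<delta>"
  have inf0: "(INF P\<in>C. measure P {c..}) = 0" using hard by (simp add: delta_hard_def c_def)
  \<comment> \<open>A negative \<open>c\<close> would give every prior full mass on
    \<open>{c..}\<close>. Nonnegativity yields \<delta> \<le> \<Phi> \<le> 1, on which the numerical
    estimates rely.\<close>
  have c0: "0 \<le> c"
  proof (rule ccontr)
    assume "\<not> 0 \<le> c"
    have "1 \<le> measure P {c..}" if "P \<in> C" for P
    proof -
      have dP: "dist01 P" using d that by auto
      interpret prob_space P by (rule dist01_prob[OF dP])
      have "measure P {0..1} \<le> measure P {c..}"
        using \<open>\<not> 0 \<le> c\<close> by (intro finite_measure_mono) (auto simp: dist01_sets[OF dP])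
      then show ?thesis using dP by (simp add: dist01_def)
    qed
    then have "1 \<le> (INF P\<in>C. measure P {c..})" using ne by (intro cINF_greatest) auto
    then show False using inf0 by simp
  qed
  have \<delta>1: "\<delta> \<le> 1" using c0 Phi_bounds(2)[OF d ne] by (simp add: c_def)
  obtain Q where Q: "Q \<in> C" "Phi C - \<delta> / 4 < mean Q"
  proof -
    have "\<exists>Q\<in>C. Phi C - \<delta> / 4 < mean Q"
      using \<delta> ne d dist01_mean_bounds(2) unfolding Phi_def
      by (subst less_cSUP_iff[symmetric]) (auto intro!: bdd_aboveI2[where M=1])
    then show ?thesis using that by blast
  qed
  show "\<exists>K0. \<forall>K\<ge>K0. \<exists>P. consistent C K P \<and>
         (\<forall>i j. i \<le> j \<longrightarrow> j < K \<longrightarrow> mean (P j) \<le> mean (P i)) \<and>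
         (\<forall>(M::'w measure) X. realization K P M X \<longrightarrow> R_LB K M X > ereal (exp (\<delta>\<^sup>2 / 4 * real K)))"
  \<comment> \<open>From 16/\<delta>^3 on, \<delta>^2 K / 4 exceeds 4/\<delta>, so exp (\<delta>^2 K
    / 4) outweighs the factor \<delta>/4. The added 2 guarantees at least one good arm beside the
    bad one.\<close>
  proof (intro exI[of _ "nat \<lceil>16 / \<delta> ^ 3\<rceil> + 2"] allI impI)
    fix K assume K: "nat \<lceil>16 / \<delta> ^ 3\<rceil> + 2 \<le> K"
    define n where "n = K - 1"
    have n: "K = Suc n" "n > 0" using K by (auto simp: n_def)
    have Kr: "16 / \<delta> ^ 3 < real K" using K by linarith
    \<comment> \<open>The infimum 0 need not be attained, so the bad prior is chosen anew for each
      \<open>K\<close>, rare enough not to spoil the exponential rate.\<close>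
    obtain B where B: "B \<in> C" "measure B {c..} < exp (- real K)"
      using cINF_less_iff[of C "\<lambda>P. measure P {c..}" "exp (- real K)"] ne inf0
        bdd_belowI2[of C 0 "\<lambda>P. measure P {c..}"]
      by auto
    interpret H: hard_instance Q B "mean Q" c \<delta> "exp (- real K)" n
      by unfold_locales (use Q B d n \<delta> c0 in \<open>auto simp: c_def\<close>)
    have big: "4 / \<delta> \<le> real K"
    proof -
      have "\<delta> ^ 3 \<le> \<delta>" using \<delta> \<delta>1 power_decreasing[of 1 3 \<delta>] by simp
      then have "4 / \<delta> \<le> 16 / \<delta> ^ 3" using \<delta> by (intro frac_le) auto
      then show ?thesis using Kr by simp
    qed
    have "4 / \<delta> \<le> exp (real K)" using big exp_ge_add_one_self[of "real K"] by linarith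
    then have small: "exp (- real K) \<le> \<delta> / 4" using \<delta> by (simp add: exp_minus field_simps)
    have sq1: "\<delta>\<^sup>2 \<le> 1" using \<delta> \<delta>1 by (simp add: power_le_one)
    have e1: "exp (- real K) \<le> exp (- \<delta>\<^sup>2 / 2 * real K)"
      using sq1 mult_right_mono[of "\<delta>\<^sup>2 / 2" 1 "real K"] by simp
    have e2: "exp (- 9 / 8 * \<delta>\<^sup>2 * real n) \<le> exp (- \<delta>\<^sup>2 / 2 * real K)"
    proof -
      have "1 / 2 * real K \<le> 9 / 8 * real n" using n by simp
      from mult_left_mono[OF this, of "\<delta>\<^sup>2"] show ?thesis by simp
    qed
    have den: "exp (- real K) + exp (- 9 / 8 * \<delta>\<^sup>2 * real n) \<le> 2 * exp (- \<delta>\<^sup>2 / 2 * real K)"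
      using e1 e2 by linarith
    have mB: "mean B \<le> mean Q" using H.mean_B small Q(2) \<delta> by (simp add: c_def)
    have rat: "exp (\<delta>\<^sup>2 / 4 * real K) < (\<delta> / 2) / (2 * exp (- \<delta>\<^sup>2 / 2 * real K))"
    proof -
      have "4 / \<delta> < \<delta>\<^sup>2 / 4 * real K"
        using Kr \<delta> by (simp add: field_simps power3_eq_cube power2_eq_square)
      also have "\<dots> < exp (\<delta>\<^sup>2 / 4 * real K)" using exp_ge_add_one_self[of "\<delta>\<^sup>2 / 4 * real K"] by linarith
      finally have "1 < \<delta> / 4 * exp (\<delta>\<^sup>2 / 4 * real K)" using \<delta> by (simp add: field_simps)
      then have "exp (\<delta>\<^sup>2 / 4 * real K) * 1
          < exp (\<delta>\<^sup>2 / 4 * real K) * (\<delta> / 4 * exp (\<delta>\<^sup>2 / 4 * real K))"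
        by (intro mult_strict_left_mono) auto
      also have "\<dots> = \<delta> / 4 * (exp (\<delta>\<^sup>2 / 4 * real K) * exp (\<delta>\<^sup>2 / 4 * real K))"
        by simp
      also have "\<dots> = \<delta> / 4 * exp (\<delta>\<^sup>2 / 2 * real K)"
        by (simp add: mult_exp_exp)
      also have "\<dots> = (\<delta> / 2) / (2 * exp (- \<delta>\<^sup>2 / 2 * real K))"
        by (simp add: exp_minus divide_simps)
      finally show ?thesis by simp
    qed
    show "\<exists>P. consistent C K P \<and>
         (\<forall>i j. i \<le> j \<longrightarrow> j < K \<longrightarrow> mean (P j) \<le> mean (P i)) \<and>
         (\<forall>(M::'w measure) X. realization K P M X \<longrightarrow> R_LB K M X > ereal (exp (\<delta>\<^sup>2 / 4 * real K)))"
    proof (intro exI[of _ H.prior] conjI allI impI)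
      show "consistent C K H.prior" using Q B by (auto simp: consistent_def H.prior_def)
      show "mean (H.prior j) \<le> mean (H.prior i)" if "i \<le> j" "j < K" for i j
        using that mB by (auto simp: H.prior_def)
      fix M :: "'w measure" and X assume "realization K H.prior M X"
      then have r: "realization (Suc n) H.prior M X" using n by simp
      have "ereal (exp (\<delta>\<^sup>2 / 4 * real K)) < ereal ((\<delta> / 2) / (2 * exp (- \<delta>\<^sup>2 / 2 * real K)))"
        using rat by simp
      also have "\<dots> \<le> L_val (Suc n) M X"
        by (rule H.L_val_prior_ge[OF r _ _ den]) (use \<delta> small in auto)
      also have "\<dots> \<le> R_LB K M X" by (simp add: R_LB_def n(1) max.coboundedI2)
      finally show "R_LB K M X > ereal (exp (\<delta>\<^sup>2 / 4 * real K))" .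
    qed
  qed
qed (use \<delta> in simp)

subsection \<open>The exploration algorithm\<close>

lemma length_hist [simp]: "length (hist A X \<omega> t) = t"
  by (induction t) (auto simp: Let_def)

text \<open>The n-th play of an arm reveals entry n of its tape, whatever happened in between. Hence
  the history of one arm is a prefix of its tape, and adaptivity affects only the length of that
  prefix.\<close>

lemma filter_hist:
  "filter (\<lambda>p. fst p = i) (hist A X \<omega> t)
    = map (\<lambda>n. (i, sample X i n \<omega>)) [0..<card {s. s < t \<and> rec_arm A X s \<omega> = i}]"
proof (induction t arbitrary: i)
  case (Suc t)
  define a where "a = rec_arm A X t \<omega>"
  define k where "k i = card {s. s < t \<and> rec_arm A X s \<omega> = i}" for i
  have IH: "filter (\<lambda>p. fst p = i) (hist A X \<omega> t) = map (\<lambda>n. (i, sample X i n \<omega>)) [0..<k i]" for i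
    using Suc.IH by (simp add: k_def)
  have h: "hist A X \<omega> (Suc t) = hist A X \<omega> t @ [(a, sample X a (k a) \<omega>)]"
    using arg_cong[OF IH[of a], of length] by (simp add: a_def rec_arm_def Let_def)
  show ?case
  proof (cases "i = a")
    case True
    have "{s. s < Suc t \<and> rec_arm A X s \<omega> = i} = insert t {s. s < t \<and> rec_arm A X s \<omega> = i}"
      using True by (auto simp: a_def less_Suc_eq)
    then have "card {s. s < Suc t \<and> rec_arm A X s \<omega> = i} = Suc (k i)" by (simp add: k_def)
    then show ?thesis using True by (simp add: h IH del: hist.simps)
  next
    case False
    have "{s. s < Suc t \<and> rec_arm A X s \<omega> = i} = {s. s < t \<and> rec_arm A X s \<omega> = i}"
      using False by (auto simp: a_def less_Suc_eq)
    then show ?thesis using False by (simp add: h IH k_def del: hist.simps)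
  qed
qed simp

text \<open>The second disjunct makes the last stage, whose threshold is 1, succeed for every value
  of the seed. So the sample counts are guaranteed surely and \<open>rec_arm_alg\<close> is a
  pointwise identity. For seeds below 1 nothing changes, as thresholds are at most 1.\<close>

definition hit :: "real \<Rightarrow> real \<Rightarrow> bool" where
  "hit u \<theta> \<longleftrightarrow> u < \<theta> \<or> 1 \<le> \<theta>"

lemma hit_mono: "hit u \<theta> \<Longrightarrow> \<theta> \<le> \<theta>' \<Longrightarrow> hit u \<theta>'"
  by (auto simp: hit_def)

text \<open>Stopping at \<open>N\<close> samples freezes the statistic of an arm once it has been
  explored, however often it is replayed.\<close>

definition count_ones :: "nat \<Rightarrow> (nat \<times> bool) list \<Rightarrow> nat \<Rightarrow> nat" where
  "count_ones N h i = length (filter snd (take N (filter (\<lambda>p. fst p = i) h)))"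

lemma count_ones_hist:
  assumes "N \<le> card {s. s < t \<and> rec_arm A X s \<omega> = i}"
  shows "count_ones N (hist A X \<omega> t) i = successes N i (\<lambda>s. X s \<omega>)"
proof -
  have "length (filter snd (map (\<lambda>n. (i, f n)) [0..<N])) = (\<Sum>n<N. of_bool (f n))" for f :: "nat \<Rightarrow> bool"
    by (induction N) auto
  with assms show ?thesis
    by (simp add: count_ones_def filter_hist take_map successes_def sample_def)
qed

text \<open>Time is divided into blocks of \<open>N\<close> rounds. Block 0 plays arm 0; the following blocks are
  numbered by pairs of an arm \<open>j \<ge> 1\<close> and a stage \<open>m \<le> R\<close>. The event that arm \<open>j\<close> has been
  explored by the end of stage \<open>m\<close> is that the seed hits \<open>thr j m\<close>, which is a function of the
  success counts \<open>\<sigma>\<close> of the earlier arms.\<close>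

locale explorer =
  fixes K N R :: nat and w :: "nat \<Rightarrow> nat \<Rightarrow> nat \<Rightarrow> real" and good :: "nat \<Rightarrow> bool" and c :: "nat \<Rightarrow> real"
  assumes K: "K \<ge> 2" and N: "N > 0"
    and w_nonneg: "\<And>j i s. 0 \<le> w j i s" and w_le_1: "\<And>j i s. w j i s \<le> 1"
    and c_0: "c 0 = 0" and c_R: "c R = 1" and c_mono: "\<And>m. c m \<le> c (Suc m)"
    and c_le_1: "\<And>m. c m \<le> 1"
begin

definition weight :: "nat \<Rightarrow> (nat \<Rightarrow> nat) \<Rightarrow> real" where
  "weight j \<sigma> = (\<Prod>i<j. w j i (\<sigma> i))"

definition thr :: "nat \<Rightarrow> nat \<Rightarrow> (nat \<Rightarrow> nat) \<Rightarrow> real" where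
  "thr j m \<sigma> = (1 - c m) * weight j \<sigma> + c m"

text \<open>Refers to the end of the preceding stage. The guard is needed at stage 0, where
  \<open>m - 1\<close> would again be 0 although arm \<open>j\<close> has no samples yet.\<close>

definition explored_before :: "real \<Rightarrow> (nat \<Rightarrow> nat) \<Rightarrow> nat \<Rightarrow> nat \<Rightarrow> bool" where
  "explored_before u \<sigma> j m \<longleftrightarrow> m > 0 \<and> hit u (thr j (m - 1) \<sigma>)"

text \<open>Consulting the count of \<open>j\<close> only where \<open>j\<close> already has samples
  makes the rule executable from the history. The other branch enlarges the explored event.\<close>

definition plays :: "real \<Rightarrow> (nat \<Rightarrow> nat) \<Rightarrow> nat \<Rightarrow> nat \<Rightarrow> bool" where
  "plays u \<sigma> j m \<longleftrightarrow> (if explored_before u \<sigma> j m then good (\<sigma> j) else hit u (thr j m \<sigma>))"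

definition block_arm :: "real \<Rightarrow> (nat \<Rightarrow> nat) \<Rightarrow> nat \<Rightarrow> nat" where
  "block_arm u \<sigma> b = (if b = 0 then 0 else
     let j = Suc ((b - 1) div Suc R); m = (b - 1) mod Suc R
     in if j < K \<and> plays u \<sigma> j m then j else 0)"

definition alg :: alg where
  "alg u h = block_arm u (count_ones N h) (length h div N)"

definition horizon :: nat where
  "horizon = N * Suc ((K - 1) * Suc R)"

lemma block_arm_less: "block_arm u \<sigma> b < K"
  using K by (auto simp: block_arm_def Let_def)

lemma alg_ok: "alg_ok K alg"
proof -
  have "(\<lambda>u. block_arm u \<sigma> b) \<in> borel \<rightarrow>\<^sub>M count_space UNIV" for \<sigma> b
    unfolding block_arm_def plays_def explored_before_def hit_def Let_def by measurable
  then show ?thesis by (auto simp: alg_ok_def alg_def block_arm_less)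
qed

lemma c_nonneg: "0 \<le> c m"
  by (induction m) (use c_0 c_mono order_trans in \<open>auto\<close>)

lemma weight_bounds: "0 \<le> weight j \<sigma>" "weight j \<sigma> \<le> 1"
  unfolding weight_def using w_nonneg w_le_1 by (auto intro: prod_nonneg prod_le_1)

lemma thr_eq: "thr j m \<sigma> = weight j \<sigma> + c m * (1 - weight j \<sigma>)"
  by (simp add: thr_def algebra_simps)

lemma thr_bounds: "0 \<le> thr j m \<sigma>" "thr j m \<sigma> \<le> 1"
proof -
  show "0 \<le> thr j m \<sigma>"
    unfolding thr_def using weight_bounds[of j \<sigma>] c_nonneg[of m] c_le_1[of m] by simp
  show "thr j m \<sigma> \<le> 1"
    using mult_left_mono[OF weight_bounds(2)[of j \<sigma>], of "1 - c m"] c_le_1[of m]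
    by (simp add: thr_def)
qed

lemma thr_mono: "thr j m \<sigma> \<le> thr j (Suc m) \<sigma>"
  unfolding thr_eq using c_mono[of m] weight_bounds[of j \<sigma>] by (intro add_left_mono mult_right_mono) auto

lemma explored_before_hit: "explored_before u \<sigma> j m \<Longrightarrow> hit u (thr j m \<sigma>)"
  using thr_mono[of j "m - 1" \<sigma>] by (auto simp: explored_before_def intro: hit_mono)

lemma hit_R: "hit u (thr j R \<sigma>)"
  by (simp add: hit_def thr_def c_R)

lemma block_arm_pair:
  assumes "0 < j" "j < K" "m \<le> R"
  shows "block_arm u \<sigma> (Suc ((j - 1) * Suc R + m)) = (if plays u \<sigma> j m then j else 0)"
proof -
  have "((j - 1) * Suc R + m) div Suc R = j - 1" "((j - 1) * Suc R + m) mod Suc R = m"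
    using assms by (auto simp del: mult_Suc_right)
  then show ?thesis using assms by (simp add: block_arm_def Let_def del: mult_Suc_right)
qed

lemma plays_cong:
  assumes "\<And>i. i < j \<Longrightarrow> \<sigma> i = \<sigma>' i" "explored_before u \<sigma> j m \<Longrightarrow> \<sigma> j = \<sigma>' j"
  shows "plays u \<sigma> j m = plays u \<sigma>' j m"
proof -
  have "weight j \<sigma> = weight j \<sigma>'" unfolding weight_def using assms(1) by (intro prod.cong) auto
  then have t: "thr j m \<sigma> = thr j m \<sigma>'" for m by (simp add: thr_def)
  then show ?thesis using assms(2) by (auto simp: plays_def explored_before_def)
qed

text \<open>At the first stage whose threshold is hit the arm is still unexplored, so this stage
  plays it.\<close>

lemma hit_imp_played:
  assumes "hit u (thr j m \<sigma>)"
  obtains m' where "m' \<le> m" "plays u \<sigma> j m'"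
proof -
  define m' where "m' = (LEAST m. hit u (thr j m \<sigma>))"
  have h: "hit u (thr j m' \<sigma>)" unfolding m'_def using assms by (rule LeastI)
  have "\<not> explored_before u \<sigma> j m'"
    unfolding explored_before_def using not_less_Least[of "m' - 1" "\<lambda>m. hit u (thr j m \<sigma>)"]
    by (auto simp: m'_def)
  then have "plays u \<sigma> j m'" using h by (simp add: plays_def)
  moreover have "m' \<le> m" unfolding m'_def using assms by (rule Least_le)
  ultimately show ?thesis using that by blast
qed

lemma card_block:
  assumes b: "Suc b * N \<le> t" and r: "\<And>s. s < t \<Longrightarrow> s div N = b \<Longrightarrow> rec_arm A X s \<omega> = i"
  shows "N \<le> card {s. s < t \<and> rec_arm A X s \<omega> = i}"
proof -
  have "{b * N..<Suc b * N} \<subseteq> {s. s < t \<and> rec_arm A X s \<omega> = i}"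
  proof
    fix s assume s: "s \<in> {b * N..<Suc b * N}"
    then have "s div N = b" by (intro div_nat_eqI) (auto simp: mult.commute)
    moreover have "s < t" using s b by auto
    ultimately show "s \<in> {s. s < t \<and> rec_arm A X s \<omega> = i}" using r by auto
  qed
  then have "card {b * N..<Suc b * N} \<le> card {s. s < t \<and> rec_arm A X s \<omega> = i}"
    by (intro card_mono) auto
  then show ?thesis by simp
qed

lemma card_explored:
  assumes prev: "\<And>s. s < t \<Longrightarrow> rec_arm A X s \<omega> = block_arm u \<sigma> (s div N)"
    and j: "0 < j" "j < K" "m \<le> R" and hit: "hit u (thr j m \<sigma>)"
    and t: "Suc ((j - 1) * Suc R + m) < t div N"
  shows "N \<le> card {s. s < t \<and> rec_arm A X s \<omega> = j}"
proof -
  obtain m' where m': "m' \<le> m" "plays u \<sigma> j m'" using hit by (rule hit_imp_played)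
  let ?b = "Suc ((j - 1) * Suc R + m')"
  have "Suc ?b \<le> t div N" using t m' by simp
  then have "Suc ?b * N \<le> t div N * N" by (rule mult_le_mono1)
  also have "\<dots> \<le> t" by simp
  finally show ?thesis
    by (rule card_block) (use prev block_arm_pair[OF j(1,2), of m' u \<sigma>] m' j(3) in auto)
qed

lemma card_arm_0:
  assumes prev: "\<And>s. s < t \<Longrightarrow> rec_arm A X s \<omega> = block_arm u \<sigma> (s div N)" and t: "0 < t div N"
  shows "N \<le> card {s. s < t \<and> rec_arm A X s \<omega> = 0}"
proof (rule card_block[of 0])
  have "1 * N \<le> t div N * N" using t by (intro mult_le_mono1) simp
  also have "\<dots> \<le> t" by simp
  finally show "Suc 0 * N \<le> t" by simp
  show "rec_arm A X s \<omega> = 0" if "s < t" "s div N = 0" for s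
    using prev[OF that(1)] that(2) by (simp add: block_arm_def)
qed

lemma card_arm:
  assumes prev: "\<And>s. s < t \<Longrightarrow> rec_arm A X s \<omega> = block_arm u \<sigma> (s div N)"
    and i: "i < K" and t: "i * Suc R < t div N"
  shows "N \<le> card {s. s < t \<and> rec_arm A X s \<omega> = i}"
proof (cases "i = 0")
  case True
  then show ?thesis using card_arm_0[OF prev] t by simp
next
  case False
  then have "i * Suc R = Suc ((i - 1) * Suc R + R)" by (cases i) auto
  then show ?thesis using False i t hit_R by (intro card_explored[OF prev, where m=R]) auto
qed

text \<open>Whenever a success count matters, the arm in question already has \<open>N\<close> samples, so the counts
  read off the history may be replaced by those of the full reward tape.\<close>

lemma rec_arm_alg:
  "rec_arm alg X t \<omega> = block_arm (X Seed \<omega>) (\<lambda>i. successes N i (\<lambda>s. X s \<omega>)) (t div N)"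
proof (induction t rule: less_induct)
  case (less t)
  define u where "u = X Seed \<omega>"
  define \<sigma> where "\<sigma> i = successes N i (\<lambda>s. X s \<omega>)" for i
  define \<sigma>' where "\<sigma>' = count_ones N (hist alg X \<omega> t)"
  \<comment> \<open>By the induction hypothesis all earlier rounds followed the tape-based rule, so
    numbers of samples can be read off from whole blocks instead of from the history.\<close>
  have prev: "rec_arm alg X s \<omega> = block_arm u \<sigma> (s div N)" if "s < t" for s
    using less[OF that] by (simp add: u_def \<sigma>_def[abs_def])
  have known: "\<sigma> i = \<sigma>' i" if "N \<le> card {s. s < t \<and> rec_arm alg X s \<omega> = i}" for i
    using count_ones_hist[OF that] by (simp add: \<sigma>_def \<sigma>'_def)
  have rec: "rec_arm alg X t \<omega> = block_arm u \<sigma>' (t div N)"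
    by (simp add: rec_arm_def alg_def u_def \<sigma>'_def)
  have "block_arm u \<sigma> (t div N) = block_arm u \<sigma>' (t div N)"
  proof (cases "t div N")
    case 0
    then show ?thesis by (simp add: block_arm_def)
  next
    case (Suc b)
    define j m where "j = Suc (b div Suc R)" and "m = b mod Suc R"
    have tb: "t div N = Suc ((j - 1) * Suc R + m)" "m \<le> R" unfolding Suc j_def m_def
      by (auto simp del: mult_Suc_right simp: less_Suc_eq_le[symmetric])
    have "plays u \<sigma> j m = plays u \<sigma>' j m" if jK: "j < K"
    proof (rule plays_cong)
      fix i assume i: "i < j"
      have "i \<le> j - 1" using i by simp
      then have "i * Suc R < t div N"
        unfolding tb(1) by (rule le_imp_less_Suc[OF trans_le_add1[OF mult_le_mono1]])
      then show "\<sigma> i = \<sigma>' i"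
        using i jK by (intro known card_arm[OF prev]) auto
    next
      \<comment> \<open>An arm explored before stage \<open>m\<close> filled one of its earlier
        blocks completely, and that alone yields \<open>N\<close> samples.\<close>
      assume e: "explored_before u \<sigma> j m"
      then show "\<sigma> j = \<sigma>' j"
        using jK tb by (intro known card_explored[OF prev, where m="m - 1"])
          (auto simp: explored_before_def j_def)
    qed
    then show ?thesis unfolding Suc by (auto simp: block_arm_def Let_def j_def m_def)
  qed
  then show ?case using rec by (simp add: u_def \<sigma>_def[abs_def])
qed

lemma card_rec_arm_alg:
  assumes i: "i < K"
  shows "N \<le> card {t. t < horizon \<and> rec_arm alg X t \<omega> = i}"
proof (rule card_arm[OF rec_arm_alg i])
  have "i * Suc R \<le> (K - 1) * Suc R" using i by (intro mult_le_mono1) auto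
  also have "\<dots> < horizon div N" using N by (simp add: horizon_def)
  finally show "i * Suc R < horizon div N" .
qed

end

subsection \<open>Incentive compatibility\<close>

lemma prod_lessThan_if_less:
  fixes f :: "nat \<Rightarrow> 'a :: comm_monoid_mult"
  assumes "j \<le> n"
  shows "(\<Prod>l<n. if l < j then f l else 1) = (\<Prod>l<j. f l)"
  using assms by (intro prod.mono_neutral_cong_right) auto

context bandit
begin

lemma AE_Seed_less_1: "AE \<omega> in M. X Seed \<omega> < 1"
proof -
  have "prob {\<omega> \<in> space M. X Seed \<omega> < 1} = measure (distr M borel (X Seed)) {..<1}"
    by (subst measure_distr) (auto intro!: arg_cong[where f=prob])
  also have "\<dots> = 1" unfolding distr_Seed by (rule measure_uniform_lessThan) auto
  finally show ?thesis by (subst (asm) prob_Collect_eq_1) auto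
qed

text \<open>Tilting by a product of one-arm weights keeps the arms independent and only moves the
  means of the arms below \<open>j\<close>, to \<open>v l\<close>. It is applied to the balanced
  weights and to the constant weight 1, that is, to the prior law.\<close>

lemma expectation_weighted:
  fixes wt :: "nat \<Rightarrow> nat \<Rightarrow> real" and g :: "nat \<Rightarrow> real"
  assumes j: "j < K" and k: "k < K"
    and wt: "\<And>l s. \<bar>wt l s\<bar> \<le> 1" and g: "\<And>s. \<bar>g s\<bar> \<le> 1"
    and v: "\<And>l. l < j \<Longrightarrow> expectation (\<lambda>\<omega>. wt l (successes N l (x_of \<omega>)) * X (Mu l) \<omega>)
          = v l * expectation (\<lambda>\<omega>. wt l (successes N l (x_of \<omega>)))"
      "\<And>l. j < l \<Longrightarrow> l < K \<Longrightarrow> v l = mean (P l)"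
  shows "expectation (\<lambda>\<omega>. (\<Prod>l<j. wt l (successes N l (x_of \<omega>))) * g (successes N j (x_of \<omega>)) * X (Mu k) \<omega>)
    = (\<Prod>l<j. expectation (\<lambda>\<omega>. wt l (successes N l (x_of \<omega>))))
      * (if k = j then expectation (\<lambda>\<omega>. g (successes N j (x_of \<omega>)) * X (Mu j) \<omega>)
         else expectation (\<lambda>\<omega>. g (successes N j (x_of \<omega>))) * v k)"
proof -
  define \<phi> where "\<phi> l x s = (if l < j then wt l s else 1) * (if l = j then g s else 1) * (if l = k then x else 1)"
    for l x s
  have "expectation (\<lambda>\<omega>. \<Prod>l<K. \<phi> l (X (Mu l) \<omega>) (successes N l (x_of \<omega>)))
    = (\<Prod>l<K. expectation (\<lambda>\<omega>. \<phi> l (X (Mu l) \<omega>) (successes N l (x_of \<omega>))))"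
  proof (rule expectation_prod_arms[where B=1])
    fix l x s assume x: "0 \<le> x" "x \<le> (1::real)"
    have "\<bar>if l < j then wt l s else 1\<bar> \<le> 1" "\<bar>if l = j then g s else 1\<bar> \<le> 1"
      "\<bar>if l = k then x else 1\<bar> \<le> 1" using wt g x by auto
    then show "\<bar>\<phi> l x s\<bar> \<le> 1" unfolding \<phi>_def abs_mult
      by (intro mult_le_one) auto
  qed (simp add: \<phi>_def)
  also have "(\<lambda>\<omega>. \<Prod>l<K. \<phi> l (X (Mu l) \<omega>) (successes N l (x_of \<omega>)))
    = (\<lambda>\<omega>. (\<Prod>l<j. wt l (successes N l (x_of \<omega>))) * g (successes N j (x_of \<omega>)) * X (Mu k) \<omega>)"
    using j k by (simp add: \<phi>_def prod.distrib prod_lessThan_if_less)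
  also have "(\<Prod>l<K. expectation (\<lambda>\<omega>. \<phi> l (X (Mu l) \<omega>) (successes N l (x_of \<omega>))))
    = (\<Prod>l<K. (if l < j then expectation (\<lambda>\<omega>. wt l (successes N l (x_of \<omega>))) else 1)
        * (if l = j then (if k = j then expectation (\<lambda>\<omega>. g (successes N j (x_of \<omega>)) * X (Mu j) \<omega>)
            else expectation (\<lambda>\<omega>. g (successes N j (x_of \<omega>)))) else 1)
        * (if l = k then (if k = j then 1 else v k) else 1))"
  proof (intro prod.cong refl)
    fix l assume "l \<in> {..<K}"
    then have l: "l < K" by simp
    consider "l < j" | "l = j" | "l > j" by linarith
    then show "expectation (\<lambda>\<omega>. \<phi> l (X (Mu l) \<omega>) (successes N l (x_of \<omega>)))
      = (if l < j then expectation (\<lambda>\<omega>. wt l (successes N l (x_of \<omega>))) else 1)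
        * (if l = j then (if k = j then expectation (\<lambda>\<omega>. g (successes N j (x_of \<omega>)) * X (Mu j) \<omega>)
            else expectation (\<lambda>\<omega>. g (successes N j (x_of \<omega>)))) else 1)
        * (if l = k then (if k = j then 1 else v k) else 1)"
      using v l by cases (auto simp: \<phi>_def expectation_Mu_mean prob_space)
  qed
  also have "\<dots> = (\<Prod>l<j. expectation (\<lambda>\<omega>. wt l (successes N l (x_of \<omega>))))
      * (if k = j then expectation (\<lambda>\<omega>. g (successes N j (x_of \<omega>)) * X (Mu j) \<omega>)
         else expectation (\<lambda>\<omega>. g (successes N j (x_of \<omega>))) * v k)"
    using j k by (simp add: prod.distrib prod_lessThan_if_less)
  finally show ?thesis .
qed

end

text \<open>The probability that \<open>j\<close> is explored after stage \<open>m\<close> is the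
  bracket on the right of \<open>step\<close>. That assumption bounds the growth of the schedule by
  what replaying on this event earns according to \<open>gain\<close>.\<close>

locale bandit_explorer = bandit K P M X + explorer K N R w good c
  for K P and M :: "'w measure" and X N R w good c +
  fixes \<Phi> \<eta> :: real
  assumes \<eta>: "\<eta> > 0"
    and sorted: "\<And>i j. i \<le> j \<Longrightarrow> j < K \<Longrightarrow> mean (P j) \<le> mean (P i)"
    and mean_le: "\<And>i. i < K \<Longrightarrow> mean (P i) \<le> \<Phi>"
    and balanced: "\<And>i j. i < j \<Longrightarrow> j < K \<Longrightarrow>
      expectation (\<lambda>\<omega>. w j i (successes N i (x_of \<omega>)) * (X (Mu i) \<omega> - mean (P j))) = 0"
    and gain: "\<And>j. j < K \<Longrightarrow>
      \<eta> \<le> expectation (\<lambda>\<omega>. of_bool (good (successes N j (x_of \<omega>))) * (X (Mu j) \<omega> - \<Phi>))"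
    and step: "\<And>j m. j < K \<Longrightarrow> c (Suc m) - c m
      \<le> \<eta> * ((1 - c m) * (\<Prod>i<j. expectation (\<lambda>\<omega>. w j i (successes N i (x_of \<omega>)))) + c m)"
begin

abbreviation (input) \<sigma> :: "'w \<Rightarrow> nat \<Rightarrow> nat" where
  "\<sigma> \<omega> \<equiv> (\<lambda>i. successes N i (x_of \<omega>))"

definition p :: "nat \<Rightarrow> real" where
  "p j = (\<Prod>i<j. expectation (\<lambda>\<omega>. w j i (\<sigma> \<omega> i)))"

text \<open>\<open>v j k\<close> is the mean of arm \<open>k\<close> under the law tilted by \<open>weight j\<close>, and \<open>val g j u k\<close> is the
  expectation of \<open>g (\<sigma> j)\<close> times the mean reward of \<open>k\<close> when arms other than \<open>j\<close> have means \<open>u\<close>.\<close>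

definition v :: "nat \<Rightarrow> nat \<Rightarrow> real" where
  "v j k = (if k < j then mean (P j) else mean (P k))"

definition val :: "(nat \<Rightarrow> real) \<Rightarrow> nat \<Rightarrow> (nat \<Rightarrow> real) \<Rightarrow> nat \<Rightarrow> real" where
  "val g j u k = (if k = j then expectation (\<lambda>\<omega>. g (\<sigma> \<omega> j) * X (Mu j) \<omega>)
      else expectation (\<lambda>\<omega>. g (\<sigma> \<omega> j)) * u k)"

lemma measurable_count_fun [measurable]: "(\<lambda>\<omega>. (f :: nat \<Rightarrow> real) (\<sigma> \<omega> i)) \<in> borel_measurable M"
  by (rule measurable_compose[OF successes_measurable]) simp

lemma weight_measurable [measurable]: "(\<lambda>\<omega>. weight j (\<sigma> \<omega>)) \<in> borel_measurable M"
  unfolding weight_def by measurable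

lemma integrable_count_fun:
  assumes "\<And>s. \<bar>f s\<bar> \<le> (1::real)"
  shows "integrable M (\<lambda>\<omega>. f (\<sigma> \<omega> i))"
  using assms by (intro integrable_const_bound[where B=1]) auto

lemma integrable_count_fun_Mu:
  assumes "\<And>s. \<bar>f s\<bar> \<le> (1::real)" "k < K"
  shows "integrable M (\<lambda>\<omega>. f (\<sigma> \<omega> i) * X (Mu k) \<omega>)"
proof (rule integrable_const_bound[where B=1])
  show "AE \<omega> in M. norm (f (\<sigma> \<omega> i) * X (Mu k) \<omega>) \<le> 1"
    using AE_Mu[OF assms(2)] by eventually_elim (use assms(1) in \<open>auto simp: abs_mult intro!: mult_le_one\<close>)
qed simp

lemma integrable_weight_count_fun_Mu:
  assumes "\<And>s. \<bar>f s\<bar> \<le> (1::real)" "k < K"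
  shows "integrable M (\<lambda>\<omega>. weight j (\<sigma> \<omega>) * f (\<sigma> \<omega> i) * X (Mu k) \<omega>)"
proof (rule integrable_const_bound[where B=1])
  show "AE \<omega> in M. norm (weight j (\<sigma> \<omega>) * f (\<sigma> \<omega> i) * X (Mu k) \<omega>) \<le> 1"
    using AE_Mu[OF assms(2)] 
    by eventually_elim (use assms(1) weight_bounds in \<open>auto simp: abs_mult intro!: mult_le_one\<close>)
qed simp

lemma expectation_weight_val:
  assumes j: "j < K" and k: "k < K" and g: "\<And>s. \<bar>g s\<bar> \<le> 1"
  shows "expectation (\<lambda>\<omega>. weight j (\<sigma> \<omega>) * g (\<sigma> \<omega> j) * X (Mu k) \<omega>) = p j * val g j (v j) k"
  unfolding weight_def p_def val_def
proof (rule expectation_weighted[OF j k _ g])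
  show "\<bar>w j l s\<bar> \<le> 1" for l s using w_nonneg w_le_1 by (simp add: abs_le_iff)
  show "v j l = mean (P l)" if "j < l" for l using that by (simp add: v_def)
  fix l assume l: "l < j"
  have wb: "\<bar>w j l s\<bar> \<le> 1" for s using w_nonneg[of j l s] w_le_1[of j l s] by simp
  have "l < K" using l j by simp
  have "0 = expectation (\<lambda>\<omega>. w j l (\<sigma> \<omega> l) * X (Mu l) \<omega> - w j l (\<sigma> \<omega> l) * mean (P j))"
    using balanced[OF l j] by (simp add: right_diff_distrib)
  also have "\<dots> = expectation (\<lambda>\<omega>. w j l (\<sigma> \<omega> l) * X (Mu l) \<omega>) - mean (P j) * expectation (\<lambda>\<omega>. w j l (\<sigma> \<omega> l))"
    using integrable_count_fun_Mu[of "w j l" l l] integrable_count_fun[of "w j l" l] wb \<open>l < K\<close>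
    by (subst Bochner_Integration.integral_diff) auto
  finally show "expectation (\<lambda>\<omega>. w j l (successes N l (x_of \<omega>)) * X (Mu l) \<omega>)
      = v j l * expectation (\<lambda>\<omega>. w j l (successes N l (x_of \<omega>)))"
    using l by (simp add: v_def)
qed

lemma expectation_val:
  assumes j: "j < K" and k: "k < K" and g: "\<And>s. \<bar>g s\<bar> \<le> 1"
  shows "expectation (\<lambda>\<omega>. g (\<sigma> \<omega> j) * X (Mu k) \<omega>) = val g j (\<lambda>i. mean (P i)) k"
proof -
  have "expectation (\<lambda>\<omega>. (\<Prod>l<j. (\<lambda>_ _. 1) l (successes N l (x_of \<omega>))) * g (successes N j (x_of \<omega>)) * X (Mu k) \<omega>)
    = (\<Prod>l<j. expectation (\<lambda>\<omega>. (\<lambda>_ _. 1) l (successes N l (x_of \<omega>))))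
      * (if k = j then expectation (\<lambda>\<omega>. g (successes N j (x_of \<omega>)) * X (Mu j) \<omega>)
         else expectation (\<lambda>\<omega>. g (successes N j (x_of \<omega>))) * (\<lambda>i. mean (P i)) k)"
    by (rule expectation_weighted[OF j k _ g, where wt="\<lambda>_ _. 1" and v="\<lambda>i. mean (P i)"])
       (use j in \<open>auto simp: expectation_Mu_mean prob_space\<close>)
  then show ?thesis by (simp add: val_def prob_space)
qed

text \<open>Once the seed is integrated out, the threshold acts as a mixture of
  \<open>weight j\<close> and the constant 1. The first part is evaluated under the tilted law and
  the second under the prior law.\<close>

lemma expectation_hit:
  assumes j: "j < K" and i: "i < K" and k: "k < K" and g: "\<And>s. \<bar>g s\<bar> \<le> 1"
  shows "integrable M (\<lambda>\<omega>. of_bool (hit (X Seed \<omega>) (thr j m (\<sigma> \<omega>))) * (g (\<sigma> \<omega> j) * (X (Mu i) \<omega> - X (Mu k) \<omega>)))"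
      (is "integrable M ?H")
    and "expectation (\<lambda>\<omega>. of_bool (hit (X Seed \<omega>) (thr j m (\<sigma> \<omega>))) * (g (\<sigma> \<omega> j) * (X (Mu i) \<omega> - X (Mu k) \<omega>)))
      = (1 - c m) * p j * (val g j (v j) i - val g j (v j) k)
        + c m * (val g j (\<lambda>i. mean (P i)) i - val g j (\<lambda>i. mean (P i)) k)"
proof -
  define \<theta> where "\<theta> x = thr j m (\<lambda>i. successes N i x)" for x
  define f where "f x = g (successes N j x) * (x (Mu i) - x (Mu k))" for x
  let ?A = "- {Seed}"
  have meas: "\<theta> \<in> borel_measurable (PiM ?A (\<lambda>_. borel))" "f \<in> borel_measurable (PiM ?A (\<lambda>_. borel))"
  proof -
    have [measurable]: "(\<lambda>x. x (Mu l)) \<in> borel_measurable (PiM ?A (\<lambda>_. borel :: real measure))" for l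
      by (auto intro!: measurable_component_singleton)
    have [measurable]: "(\<lambda>x. (h :: nat \<Rightarrow> real) (successes N l x)) \<in> borel_measurable (PiM ?A (\<lambda>_. borel))" for h l
      by (rule measurable_compose[OF measurable_successes]) auto
    show "\<theta> \<in> borel_measurable (PiM ?A (\<lambda>_. borel))"
      unfolding \<theta>_def[abs_def] thr_def weight_def by measurable
    show "f \<in> borel_measurable (PiM ?A (\<lambda>_. borel))"
      unfolding f_def[abs_def] by measurable
  qed
  have "successes N l (restrict x ?A) = successes N l x" for l x
    by (simp add: successes_def)
  then have "\<theta> (restrict x ?A) = \<theta> x" "f (restrict x ?A) = f x" for x
    by (simp_all add: \<theta>_def f_def)
  moreover have "AE \<omega> in M. 0 \<le> \<theta> (x_of \<omega>) \<and> \<theta> (x_of \<omega>) \<le> 1"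
    by (simp add: \<theta>_def thr_bounds)
  moreover have "AE \<omega> in M. \<bar>f (x_of \<omega>)\<bar> \<le> 1"
    using AE_Mu[OF i] AE_Mu[OF k]
    by eventually_elim (auto simp: f_def abs_mult g intro!: mult_le_one)
  ultimately have thr_int: "integrable M (\<lambda>\<omega>. of_bool (X Seed \<omega> < \<theta> (x_of \<omega>)) * f (x_of \<omega>))"
    "expectation (\<lambda>\<omega>. of_bool (X Seed \<omega> < \<theta> (x_of \<omega>)) * f (x_of \<omega>))
      = expectation (\<lambda>\<omega>. \<theta> (x_of \<omega>) * f (x_of \<omega>))"
    using expectation_threshold[OF distr_Seed meas, of 1] by blast+
  have H: "?H = (\<lambda>\<omega>. of_bool (hit (X Seed \<omega>) (\<theta> (x_of \<omega>))) * f (x_of \<omega>))"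
    by (simp add: \<theta>_def f_def)
  have [measurable]: "(\<lambda>\<omega>. \<theta> (x_of \<omega>)) \<in> borel_measurable M" "(\<lambda>\<omega>. f (x_of \<omega>)) \<in> borel_measurable M"
    unfolding \<theta>_def f_def thr_def by measurable
  have Hm: "?H \<in> borel_measurable M"
    unfolding \<theta>_def[symmetric] hit_def by measurable
  \<comment> \<open>\<open>hit\<close> differs from the strict comparison only for seeds that are at
    least 1, which is a null event.\<close>
  have AE: "AE \<omega> in M. of_bool (X Seed \<omega> < \<theta> (x_of \<omega>)) * f (x_of \<omega>) = ?H \<omega>"
    using AE_Seed_less_1
  proof eventually_elim
    case (elim \<omega>)
    then show ?case using thr_bounds(2)[of j m "\<sigma> \<omega>"]
      by (auto simp: H hit_def \<theta>_def f_def)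
  qed
  show "integrable M ?H"
    by (rule integrable_cong_AE_imp[OF thr_int(1) Hm AE])
  have iw: "integrable M (\<lambda>\<omega>. weight j (\<sigma> \<omega>) * g (\<sigma> \<omega> j) * X (Mu l) \<omega>)"
    and ig: "integrable M (\<lambda>\<omega>. g (\<sigma> \<omega> j) * X (Mu l) \<omega>)" if "l < K" for l
    using integrable_weight_count_fun_Mu[of g l] integrable_count_fun_Mu[of g l] that g by auto
  have "expectation ?H = expectation (\<lambda>\<omega>. of_bool (X Seed \<omega> < \<theta> (x_of \<omega>)) * f (x_of \<omega>))"
    using AE Hm by (intro integral_cong_AE) auto
  also have "\<dots> = expectation (\<lambda>\<omega>. (1 - c m) * (weight j (\<sigma> \<omega>) * g (\<sigma> \<omega> j) * X (Mu i) \<omega>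
      - weight j (\<sigma> \<omega>) * g (\<sigma> \<omega> j) * X (Mu k) \<omega>)
      + c m * (g (\<sigma> \<omega> j) * X (Mu i) \<omega> - g (\<sigma> \<omega> j) * X (Mu k) \<omega>))"
    unfolding thr_int(2) by (intro Bochner_Integration.integral_cong) (auto simp: \<theta>_def f_def thr_def algebra_simps)
  also have "\<dots> = (1 - c m) * (p j * val g j (v j) i - p j * val g j (v j) k)
      + c m * (val g j (\<lambda>i. mean (P i)) i - val g j (\<lambda>i. mean (P i)) k)"
    using iw[OF i] iw[OF k] ig[OF i] ig[OF k]
      expectation_weight_val[where g=g, OF j i g] expectation_weight_val[where g=g, OF j k g]
      expectation_val[where g=g, OF j i g] expectation_val[where g=g, OF j k g]
    by simp
  finally show "expectation ?H = (1 - c m) * p j * (val g j (v j) i - val g j (v j) k)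
        + c m * (val g j (\<lambda>i. mean (P i)) i - val g j (\<lambda>i. mean (P i)) k)"
    by (simp add: algebra_simps)
qed

lemma p_bounds: "0 \<le> p j" "p j \<le> 1"
proof -
  have *: "0 \<le> expectation (\<lambda>\<omega>. w j i (\<sigma> \<omega> i)) \<and> expectation (\<lambda>\<omega>. w j i (\<sigma> \<omega> i)) \<le> 1" for i
    using w_nonneg w_le_1 integrable_count_fun[of "w j i" i]
    by (intro conjI integral_nonneg_AE integral_le_const) (auto simp: abs_le_iff intro: order_trans[of _ 0])
  show "0 \<le> p j" unfolding p_def using * by (intro prod_nonneg) auto
  show "p j \<le> 1" unfolding p_def using * by (intro prod_le_1) auto
qed

definition gam :: "nat \<Rightarrow> real" where "gam j = expectation (\<lambda>\<omega>. of_bool (good (\<sigma> \<omega> j)))"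

lemma gam_bounds: "0 \<le> gam j" "gam j \<le> 1"
  using integrable_count_fun[of "\<lambda>s. of_bool (good s)" j] unfolding gam_def
  by (auto intro!: integral_nonneg_AE integral_le_const)

lemma val_one: 
  assumes "k < K" "k = j \<Longrightarrow> u k = mean (P k)"
  shows "val (\<lambda>_. 1) j u k = u k"
  using assms by (auto simp: val_def prob_space expectation_Mu_mean)

lemma val_good_self:
  assumes j: "j < K"
  shows "\<eta> + gam j * \<Phi> \<le> val (\<lambda>s. of_bool (good s)) j u j"
proof -
  have "\<eta> \<le> expectation (\<lambda>\<omega>. of_bool (good (\<sigma> \<omega> j)) * X (Mu j) \<omega> - of_bool (good (\<sigma> \<omega> j)) * \<Phi>)"
    using gain[OF j] by (simp only: right_diff_distrib)
  also have "\<dots> = expectation (\<lambda>\<omega>. of_bool (good (\<sigma> \<omega> j)) * X (Mu j) \<omega>) - gam j * \<Phi>"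
    using integrable_count_fun[of "\<lambda>s. of_bool (good s)" j]
      integrable_count_fun_Mu[of "\<lambda>s. of_bool (good s)" j j] j
    by (subst Bochner_Integration.integral_diff) (auto simp: gam_def)
  finally show ?thesis by (simp add: val_def)
qed

definition advantage :: "nat \<Rightarrow> nat \<Rightarrow> nat \<Rightarrow> nat \<Rightarrow> real" where
  "advantage j m i k = expectation (\<lambda>\<omega>. of_bool (plays (X Seed \<omega>) (\<sigma> \<omega>) j m) * (X (Mu i) \<omega> - X (Mu k) \<omega>))"

lemma advantage_0:
  assumes "j < K" "i < K" "k < K"
  shows "integrable M (\<lambda>\<omega>. of_bool (plays (X Seed \<omega>) (\<sigma> \<omega>) j 0) * (X (Mu i) \<omega> - X (Mu k) \<omega>))"
    and "advantage j 0 i k = p j * (v j i - v j k)"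
  using expectation_hit[OF assms, of "\<lambda>_. 1" 0] assms
  by (auto simp: plays_def explored_before_def c_0 val_one v_def advantage_def)

text \<open>Since explored events are nested, the play event is the explored event cut down to
  \<open>good\<close> counts, plus the next explored event minus the present one. Each of the three
  pieces is an instance of \<open>expectation_hit\<close>.\<close>

lemma advantage_Suc:
  assumes "j < K" "i < K" "k < K"
  shows "integrable M (\<lambda>\<omega>. of_bool (plays (X Seed \<omega>) (\<sigma> \<omega>) j (Suc m)) * (X (Mu i) \<omega> - X (Mu k) \<omega>))"
    and "advantage j (Suc m) i k =
      (1 - c m) * p j * (val (\<lambda>s. of_bool (good s)) j (v j) i - val (\<lambda>s. of_bool (good s)) j (v j) k)
      + c m * (val (\<lambda>s. of_bool (good s)) j (\<lambda>i. mean (P i)) i - val (\<lambda>s. of_bool (good s)) j (\<lambda>i. mean (P i)) k)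
      - ((1 - c m) * p j * (v j i - v j k) + c m * (mean (P i) - mean (P k)))
      + ((1 - c (Suc m)) * p j * (v j i - v j k) + c (Suc m) * (mean (P i) - mean (P k)))"
proof -
  let ?g = "\<lambda>s. of_bool (good s) :: real"
  let ?D = "\<lambda>\<omega>. X (Mu i) \<omega> - X (Mu k) \<omega>"
  let ?h = "\<lambda>m \<omega>. of_bool (hit (X Seed \<omega>) (thr j m (\<sigma> \<omega>))) :: real"
  have eq: "of_bool (plays (X Seed \<omega>) (\<sigma> \<omega>) j (Suc m)) * ?D \<omega>
    = ?h m \<omega> * (?g (\<sigma> \<omega> j) * ?D \<omega>) - ?h m \<omega> * (1 * ?D \<omega>) + ?h (Suc m) \<omega> * (1 * ?D \<omega>)" for \<omega>
    using explored_before_hit[of "X Seed \<omega>" "\<sigma> \<omega>" j "Suc m"]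
    by (auto simp: plays_def explored_before_def)
  note g = expectation_hit[OF assms, of ?g m]
  note h = expectation_hit[OF assms, of "\<lambda>_. 1"]
  show "integrable M (\<lambda>\<omega>. of_bool (plays (X Seed \<omega>) (\<sigma> \<omega>) j (Suc m)) * ?D \<omega>)"
    unfolding eq using g(1) h(1)[of m] h(1)[of "Suc m"]
    by (intro Bochner_Integration.integrable_add Bochner_Integration.integrable_diff) auto
  have "advantage j (Suc m) i k = expectation (\<lambda>\<omega>. ?h m \<omega> * (?g (\<sigma> \<omega> j) * ?D \<omega>))
      - expectation (\<lambda>\<omega>. ?h m \<omega> * (1 * ?D \<omega>)) + expectation (\<lambda>\<omega>. ?h (Suc m) \<omega> * (1 * ?D \<omega>))"
    unfolding advantage_def eq using g(1) h(1)[of m] h(1)[of "Suc m"]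
    by (subst Bochner_Integration.integral_add) (auto intro!: Bochner_Integration.integrable_diff)
  then show "advantage j (Suc m) i k =
      (1 - c m) * p j * (val ?g j (v j) i - val ?g j (v j) k)
      + c m * (val ?g j (\<lambda>i. mean (P i)) i - val ?g j (\<lambda>i. mean (P i)) k)
      - ((1 - c m) * p j * (v j i - v j k) + c m * (mean (P i) - mean (P k)))
      + ((1 - c (Suc m)) * p j * (v j i - v j k) + c (Suc m) * (mean (P i) - mean (P k)))"
    using g(2) h(2)[of m] h(2)[of "Suc m"] assms by (simp add: val_one v_def del: mult_1)
qed

text \<open>Stage 0 sees only the tilted law, under which no arm has a larger mean than
  \<open>j\<close>. Later, both parts of the mixture earn at least \<open>\<eta>\<close> per unit of
  probability from replaying, while newly explored seeds cost at most the increment of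
  \<open>c\<close>; \<open>step\<close> balances the two.\<close>

lemma advantage_self_nonneg:
  assumes j: "j < K" and k: "k < K" and kj: "k \<noteq> j"
  shows "0 \<le> advantage j m j k"
proof -
  let ?a = "\<lambda>i. mean (P i)"
  have vj: "v j j = ?a j" by (simp add: v_def)
  have V: "0 \<le> ?a j - v j k" using sorted[of j k] k by (auto simp: v_def)
  show ?thesis
  proof (cases m)
    case 0
    then show ?thesis using advantage_0(2)[OF j j k] V p_bounds(1) by (simp add: vj)
  next
    case (Suc m')
    let ?g = "\<lambda>s. of_bool (good s) :: real"
    let ?c = "c m'" and ?c' = "c (Suc m')"
    have vg: "\<eta> \<le> val ?g j u j - val ?g j u k" if "u k \<le> \<Phi>" for u
      using val_good_self[OF j, of u] mult_left_mono[OF that gam_bounds(1)[of j]] kj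
      by (simp add: val_def gam_def)
    have "v j k \<le> \<Phi>" using mean_le j k by (simp add: v_def)
    then have g1: "(1 - ?c) * p j * \<eta> \<le> (1 - ?c) * p j * (val ?g j (v j) j - val ?g j (v j) k)"
      using vg p_bounds(1) c_le_1 by (intro mult_left_mono) auto
    have g2: "?c * \<eta> \<le> ?c * (val ?g j ?a j - val ?g j ?a k)"
      using vg[of ?a] mean_le[OF k] c_nonneg by (intro mult_left_mono) auto
    \<comment> \<open>New exploration can hurt only against an earlier arm. There the tilted
      difference vanishes and the prior means differ by at most 1.\<close>
    have U: "-1 \<le> (?a j - ?a k) - p j * (?a j - v j k)"
    proof (cases "k < j")
      case True
      then show ?thesis
        using dist01_mean_bounds(1)[OF dist01[OF j]] dist01_mean_bounds(2)[OF dist01[OF k]] by (simp add: v_def)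
    next
      case False
      then have "p j * (?a j - v j k) \<le> 1 * (?a j - v j k)"
        using V p_bounds(2) by (intro mult_right_mono) auto
      then show ?thesis using False by (simp add: v_def)
    qed
    have g3: "(?c' - ?c) * (-1) \<le> (?c' - ?c) * ((?a j - ?a k) - p j * (?a j - v j k))"
      using U c_mono[of m'] by (intro mult_left_mono) auto
    have "?c' - ?c \<le> (1 - ?c) * p j * \<eta> + ?c * \<eta>"
      using step[OF j, of m'] by (simp add: p_def algebra_simps)
    then have "0 \<le> (1 - ?c) * p j * \<eta> + ?c * \<eta> + (?c' - ?c) * (-1)" by simp
    also have "\<dots> \<le> (1 - ?c) * p j * (val ?g j (v j) j - val ?g j (v j) k)
        + ?c * (val ?g j ?a j - val ?g j ?a k) + (?c' - ?c) * ((?a j - ?a k) - p j * (?a j - v j k))"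
      by (intro add_mono g1 g2 g3)
    also have "\<dots> = advantage j m j k"
      unfolding Suc advantage_Suc(2)[OF j j k] vj by (simp add: algebra_simps)
    finally show ?thesis .
  qed
qed

text \<open>Arm 0 is recommended off the play event, so its incentive is the right side minus the
  left. Against \<open>j\<close> this follows from the previous lemma with the sign reversed.
  Against any other arm, replaying only on good counts scales the nonnegative \<open>e\<close> down,
  and \<open>e\<close>, a mixture of a damped tilted difference and the prior difference, never
  exceeds the prior one.\<close>

lemma advantage_0_le:
  assumes j: "0 < j" "j < K" and k: "k < K"
  shows "advantage j m 0 k \<le> mean (P 0) - mean (P k)"
proof -
  let ?a = "\<lambda>i. mean (P i)"
  have K0: "0 < K" using j by simp
  have s: "?a k \<le> ?a 0" using sorted[of 0 k] k by simp
  consider "k = 0" | "k = j" | "k \<noteq> 0" "k \<noteq> j" by blast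
  then show ?thesis
  proof cases
    case 1
    then show ?thesis by (simp add: advantage_def)
  next
    case 2
    have "advantage j m 0 j = - advantage j m j 0"
      unfolding advantage_def by (subst integral_minus[symmetric]) (auto intro!: Bochner_Integration.integral_cong simp: algebra_simps)
    also have "\<dots> \<le> 0" using advantage_self_nonneg[OF j(2) K0] j by simp
    finally show ?thesis using s 2 by simp
  next
    case 3
    define d where "d = v j 0 - v j k"
    define \<Delta> where "\<Delta> = ?a 0 - ?a k"
    define e where "e m = (1 - c m) * p j * d + c m * \<Delta>" for m
    have d: "0 \<le> d" "d \<le> \<Delta>"
      using sorted[of j k] sorted[of 0 j] s j k by (auto simp: d_def \<Delta>_def v_def)
    have e0: "0 \<le> e m" for m unfolding e_def
      using d c_nonneg[of m] c_le_1[of m] p_bounds(1)[of j] by (intro add_nonneg_nonneg mult_nonneg_nonneg) auto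
    have e1: "e m \<le> \<Delta>" for m
    proof -
      have "p j * d \<le> 1 * \<Delta>" using d p_bounds[of j] by (intro mult_mono) auto
      then have "(1 - c m) * (p j * d) \<le> (1 - c m) * \<Delta>" using c_le_1[of m] by (intro mult_left_mono) auto
      then show ?thesis by (simp add: e_def algebra_simps)
    qed
    show ?thesis
    proof (cases m)
      case 0
      have "advantage j m 0 k = e 0" using advantage_0(2)[OF j(2) K0 k] 0 by (simp add: e_def d_def c_0)
      then show ?thesis using e1[of 0] by (simp add: \<Delta>_def)
    next
      case (Suc m')
      have "advantage j m 0 k = gam j * e m' - e m' + e (Suc m')"
        unfolding Suc advantage_Suc(2)[OF j(2) K0 k] using 3 j
        by (simp add: val_def e_def d_def \<Delta>_def gam_def algebra_simps)
      moreover have "gam j * e m' \<le> 1 * e m'" using gam_bounds e0 by (intro mult_right_mono) auto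
      ultimately show ?thesis using e1[of "Suc m'"] by (simp add: \<Delta>_def)
    qed
  qed
qed

lemma block_arm_incentive:
  assumes i: "i < K" and k: "k < K"
  shows "0 \<le> expectation (\<lambda>\<omega>. of_bool (block_arm (X Seed \<omega>) (\<sigma> \<omega>) b = i) * (X (Mu i) \<omega> - X (Mu k) \<omega>))"
proof -
  have intX: "integrable M (X (Mu l))" if "l < K" for l
    using AE_Mu[OF that] by (intro integrable_const_bound[where B=1]) auto
  have E: "expectation (\<lambda>\<omega>. X (Mu i) \<omega> - X (Mu k) \<omega>) = mean (P i) - mean (P k)"
    using intX i k by (simp add: expectation_Mu_mean)
  define j m where "j = Suc ((b - 1) div Suc R)" and "m = (b - 1) mod Suc R"
  show ?thesis
  proof (cases "b = 0 \<or> \<not> j < K")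
    case True
    then have "block_arm (X Seed \<omega>) (\<sigma> \<omega>) b = 0" for \<omega>
      by (auto simp: block_arm_def Let_def j_def)
    then show ?thesis using E sorted[of 0 k] k by auto
  next
    case False
    then have j: "0 < j" "j < K" by (auto simp: j_def)
    have arm: "block_arm (X Seed \<omega>) (\<sigma> \<omega>) b = (if plays (X Seed \<omega>) (\<sigma> \<omega>) j m then j else 0)" for \<omega>
      using False by (auto simp: block_arm_def Let_def j_def m_def)
    have int: "integrable M (\<lambda>\<omega>. of_bool (plays (X Seed \<omega>) (\<sigma> \<omega>) j m) * (X (Mu i) \<omega> - X (Mu k) \<omega>))"
      using advantage_0(1)[OF j(2) i k] advantage_Suc(1)[OF j(2) i k] by (cases m) auto
    consider "i = j" | "i = 0" | "i \<noteq> j" "i \<noteq> 0" by blast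
    then show ?thesis
    proof cases
      case 1
      have "of_bool (block_arm (X Seed \<omega>) (\<sigma> \<omega>) b = i) = (of_bool (plays (X Seed \<omega>) (\<sigma> \<omega>) j m) :: real)" for \<omega>
        using 1 j by (simp add: arm)
      then show ?thesis
        using advantage_self_nonneg[OF j(2) k, of m] 1 by (cases "k = j") (auto simp: advantage_def)
    next
      case 2
      have "of_bool (block_arm (X Seed \<omega>) (\<sigma> \<omega>) b = i) * (X (Mu i) \<omega> - X (Mu k) \<omega>)
        = (X (Mu i) \<omega> - X (Mu k) \<omega>) - of_bool (plays (X Seed \<omega>) (\<sigma> \<omega>) j m) * (X (Mu i) \<omega> - X (Mu k) \<omega>)" for \<omega>
        using 2 j by (simp add: arm)
      then have "expectation (\<lambda>\<omega>. of_bool (block_arm (X Seed \<omega>) (\<sigma> \<omega>) b = i) * (X (Mu i) \<omega> - X (Mu k) \<omega>))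
        = (mean (P i) - mean (P k)) - advantage j m i k"
        using int intX i k E by (simp add: advantage_def)
      then show ?thesis using advantage_0_le[OF j k, of m] 2 by simp
    next
      case 3
      then show ?thesis by (auto simp: arm)
    qed
  qed
qed

lemma BIC_alg: "BIC K alg T M X"
  unfolding BIC_def
proof (intro allI impI)
  fix t i k assume ik: "i < K" "k < K"
  have "expectation (\<lambda>\<omega>. indicator {\<omega> \<in> space M. rec_arm alg X t \<omega> = i} \<omega> * (X (Mu i) \<omega> - X (Mu k) \<omega>))
    = expectation (\<lambda>\<omega>. of_bool (block_arm (X Seed \<omega>) (\<sigma> \<omega>) (t div N) = i) * (X (Mu i) \<omega> - X (Mu k) \<omega>))"
    by (intro Bochner_Integration.integral_cong) (auto simp: rec_arm_alg indicator_def)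
  then show "0 \<le> cexp M (\<lambda>\<omega>. X (Mu i) \<omega> - X (Mu k) \<omega>) {\<omega> \<in> space M. rec_arm alg X t \<omega> = i}"
    unfolding cexp_def using block_arm_incentive[OF ik, of "t div N"] by simp
qed

end

subsection \<open>Choice of the weights\<close>

text \<open>Canonical law of the mean and the tape of one arm. The algorithm is fixed before any
  realization, so its weights must depend on the priors alone: they are integrals over this space,
  carried over to realizations by \<open>expectation_arm\<close>.\<close>

definition arm_space :: "real measure \<Rightarrow> nat \<Rightarrow> (src \<Rightarrow> real) measure" where
  "arm_space Q i = PiM (insert (Mu i) (range (Unif i)))
     (\<lambda>s. if s = Mu i then Q else uniform_measure lborel {0..1})"

lemma (in bandit) expectation_arm:
  assumes i: "i < K" and m: "\<And>s. (\<lambda>x. \<phi> x s) \<in> borel_measurable borel"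
  shows "expectation (\<lambda>\<omega>. \<phi> (X (Mu i) \<omega>) (successes N i (x_of \<omega>)))
    = (\<integral>x. (\<phi> :: real \<Rightarrow> nat \<Rightarrow> real) (x (Mu i)) (successes N i x) \<partial>arm_space (P i) i)"
proof -
  let ?B = "insert (Mu i) (range (Unif i))"
  let ?N = "PiM ?B (\<lambda>_. borel :: real measure)"
  have "distr M ?N (\<lambda>\<omega>. restrict (x_of \<omega>) ?B) = PiM ?B (\<lambda>s. distr M borel (X s))"
    using iffD1[OF indep_vars_iff_distr_eq_PiM'[where I="?B" and X=X and M'="\<lambda>_. borel"]
        indep_vars_subset[OF indep subset_UNIV]] by simp
  also have "\<dots> = arm_space (P i) i"
    unfolding arm_space_def by (intro PiM_cong) (auto simp: distr_Mu[OF i] distr_Unif)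
  finally have d: "arm_space (P i) i = distr M ?N (\<lambda>\<omega>. restrict (x_of \<omega>) ?B)" ..
  have r: "(\<lambda>\<omega>. restrict (x_of \<omega>) ?B) \<in> measurable M ?N"
    by (rule measurable_restrict) simp
  have [measurable]: "(\<lambda>x. x (Mu i)) \<in> borel_measurable ?N"
    by (rule measurable_component_singleton) simp
  have [measurable]: "successes N i \<in> measurable ?N (count_space UNIV)"
    by (rule measurable_successes) auto
  have f: "(\<lambda>x. \<phi> (x (Mu i)) (successes N i x)) \<in> borel_measurable ?N"
    by (rule measurable_compose_countable[where f="\<lambda>s x. \<phi> (x (Mu i)) s"])
      (auto intro: measurable_compose[OF _ m])
  have "successes N i (restrict x ?B) = successes N i x" for x
    by (simp add: successes_def)
  then show ?thesis unfolding d by (subst integral_distr[OF r f]) simp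
qed

text \<open>Weights of the form \<open>1\<close> on low counts and \<open>\<lambda>\<close> on high counts, with \<open>\<lambda>\<close> chosen so that the
  weighted mean is exactly \<open>\<tau>\<close>. The clipping to \<open>[0,1]\<close> is only for instances that have no realization.\<close>

definition low_part :: "nat \<Rightarrow> real measure \<Rightarrow> real \<Rightarrow> nat \<Rightarrow> real" where
  "low_part N Q \<tau> i = (\<integral>x. of_bool (real (successes N i x) \<le> real N * \<tau>) * (\<tau> - x (Mu i)) \<partial>arm_space Q i)"

definition high_part :: "nat \<Rightarrow> real measure \<Rightarrow> real \<Rightarrow> nat \<Rightarrow> real" where
  "high_part N Q \<tau> i = (\<integral>x. of_bool (\<not> real (successes N i x) \<le> real N * \<tau>) * (\<tau> - x (Mu i)) \<partial>arm_space Q i)"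

definition balance :: "nat \<Rightarrow> real measure \<Rightarrow> real \<Rightarrow> nat \<Rightarrow> nat \<Rightarrow> real" where
  "balance N Q \<tau> i s = (if real s \<le> real N * \<tau> then 1
     else max 0 (min 1 (low_part N Q \<tau> i / (- high_part N Q \<tau> i))))"

lemma balance_bounds: "0 \<le> balance N Q \<tau> i s" "balance N Q \<tau> i s \<le> 1"
  by (auto simp: balance_def)

lemma balance_abs: "\<bar>balance N Q \<tau> i s\<bar> \<le> 1"
  using balance_bounds by (simp add: abs_of_nonneg)

context bandit
begin

text \<open>Low counts contribute \<open>a \<ge> \<delta> / 2\<close> and high counts
  \<open>b\<close>, with \<open>a + b = \<tau> - mean (P i) \<le> 0\<close>. Hence \<open>b\<close>
  is negative, the ratio \<open>a / (- b)\<close> lies in [0,1], and the clipping is inactive. The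
  expected weight is at least \<open>a\<close> because
  \<open>\<tau> - X (Mu i) \<omega> \<le> 1\<close> almost surely.\<close>

lemma balance_correct:
  assumes i: "i < K" and \<delta>: "\<delta> > 0" and N: "real N \<ge> 4 / \<delta>\<^sup>2" and \<tau>: "0 \<le> \<tau>" "\<tau> \<le> 1" "\<tau> \<le> mean (P i)"
    and nd: "\<delta> \<le> (\<integral>x. max (\<tau> - x) 0 \<partial>P i)"
  shows "expectation (\<lambda>\<omega>. balance N (P i) \<tau> i (successes N i (x_of \<omega>)) * (X (Mu i) \<omega> - \<tau>)) = 0"
    and "\<delta> / 2 \<le> expectation (\<lambda>\<omega>. balance N (P i) \<tau> i (successes N i (x_of \<omega>)))"
proof -
  define S where "S \<omega> = successes N i (x_of \<omega>)" for \<omega>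
  define low where "low s = (of_bool (real s \<le> real N * \<tau>) :: real)" for s :: nat
  define high where "high s = (of_bool (\<not> real s \<le> real N * \<tau>) :: real)" for s :: nat
  define a where "a = low_part N (P i) \<tau> i"
  define b where "b = high_part N (P i) \<tau> i"
  have bd: "0 \<le> x \<Longrightarrow> x \<le> 1 \<Longrightarrow> \<bar>\<tau> - x\<bar> \<le> 1" for x using \<tau> by auto
  have aE: "a = expectation (\<lambda>\<omega>. low (S \<omega>) * (\<tau> - X (Mu i) \<omega>))"
    using expectation_arm[OF i, where \<phi>="\<lambda>x s. low s * (\<tau> - x)"] by (simp add: a_def low_part_def low_def S_def)
  have bE: "b = expectation (\<lambda>\<omega>. high (S \<omega>) * (\<tau> - X (Mu i) \<omega>))"
    using expectation_arm[OF i, where \<phi>="\<lambda>x s. high s * (\<tau> - x)"] by (simp add: b_def high_part_def high_def S_def)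
  have ia: "integrable M (\<lambda>\<omega>. low (S \<omega>) * (\<tau> - X (Mu i) \<omega>))" unfolding S_def
    by (rule integrable_arm[OF i, where \<phi>="\<lambda>x s. low s * (\<tau> - x)" and B=1]) (use bd in \<open>auto simp: low_def\<close>)
  have ib: "integrable M (\<lambda>\<omega>. high (S \<omega>) * (\<tau> - X (Mu i) \<omega>))" unfolding S_def
    by (rule integrable_arm[OF i, where \<phi>="\<lambda>x s. high s * (\<tau> - x)" and B=1]) (use bd in \<open>auto simp: high_def\<close>)
  have a: "\<delta> / 2 \<le> a"
    using expectation_below_threshold[OF i \<delta> N, of \<tau>] nd by (simp add: aE low_def S_def)
  have intX: "integrable M (X (Mu i))"
    using AE_Mu[OF i] by (intro integrable_const_bound[where B=1]) auto
  have "a + b = expectation (\<lambda>\<omega>. low (S \<omega>) * (\<tau> - X (Mu i) \<omega>) + high (S \<omega>) * (\<tau> - X (Mu i) \<omega>))"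
    using ia ib by (simp add: aE bE)
  also have "\<dots> = expectation (\<lambda>\<omega>. \<tau> - X (Mu i) \<omega>)"
    by (intro Bochner_Integration.integral_cong) (auto simp: low_def high_def)
  also have "\<dots> = \<tau> - mean (P i)" using intX i by (simp add: prob_space expectation_Mu_mean)
  finally have ab: "a + b \<le> 0" using \<tau> by simp
  define r where "r = a / (- b)"
  have b: "b < 0" using a ab \<delta> by linarith
  have r: "0 \<le> r" "r \<le> 1" unfolding r_def using a b ab \<delta> by (auto simp: divide_simps)
  have rb: "r * b = - a" unfolding r_def using b by simp
  have bal: "balance N (P i) \<tau> i s = low s + r * high s" for s
    unfolding balance_def r_def[unfolded a_def b_def, symmetric] using r by (simp add: low_def high_def)
  have "expectation (\<lambda>\<omega>. balance N (P i) \<tau> i (S \<omega>) * (X (Mu i) \<omega> - \<tau>))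
    = expectation (\<lambda>\<omega>. - (low (S \<omega>) * (\<tau> - X (Mu i) \<omega>)) - r * (high (S \<omega>) * (\<tau> - X (Mu i) \<omega>)))"
    unfolding bal by (intro Bochner_Integration.integral_cong) (auto simp: algebra_simps)
  also have "\<dots> = - a - r * b"
    using ia ib by (simp add: aE bE)
  finally show "expectation (\<lambda>\<omega>. balance N (P i) \<tau> i (successes N i (x_of \<omega>)) * (X (Mu i) \<omega> - \<tau>)) = 0"
    using rb by (simp add: S_def)
  have "integrable M (\<lambda>\<omega>. balance N (P i) \<tau> i (S \<omega>))" unfolding S_def
    by (rule integrable_arm[OF i, where \<phi>="\<lambda>x s. balance N (P i) \<tau> i s" and B=1])
       (simp_all add: balance_abs)
  moreover have "AE \<omega> in M. low (S \<omega>) * (\<tau> - X (Mu i) \<omega>) \<le> balance N (P i) \<tau> i (S \<omega>)"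
    using AE_Mu[OF i] 
  proof eventually_elim
    case (elim \<omega>)
    then show ?case using \<tau> balance_bounds(1)[of N "P i" \<tau> i "S \<omega>"]
      by (cases "real (S \<omega>) \<le> real N * \<tau>") (auto simp: low_def balance_def)
  qed
  ultimately have "a \<le> expectation (\<lambda>\<omega>. balance N (P i) \<tau> i (S \<omega>))"
    unfolding aE using ia by (intro integral_mono_AE)
  then show "\<delta> / 2 \<le> expectation (\<lambda>\<omega>. balance N (P i) \<tau> i (successes N i (x_of \<omega>)))"
    using a by (simp add: S_def)
qed

end

text \<open>Before truncation this solves the recursion from y to y + \<delta>/4 (y + q) with
  initial value 0, so y + q grows geometrically. Here \<open>q\<close> is a lower bound for the
  probability explored in stage 0.\<close>

definition growth :: "real \<Rightarrow> real \<Rightarrow> nat \<Rightarrow> real" where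
  "growth \<delta> q m = min 1 (q * ((1 + \<delta> / 4) ^ m - 1))"

text \<open>The explored probability \<open>(1 - y) * p + y\<close> is at least \<open>y\<close> and
  at least \<open>p\<close>, hence at least half of \<open>y + q\<close>. This is why the rate is
  \<delta>/4 although the gain is \<delta>/2.\<close>

lemma growth_step:
  assumes \<delta>: "0 < \<delta>" and q: "0 < q" "q \<le> p" "p \<le> 1"
  shows "growth \<delta> q (Suc m) - growth \<delta> q m \<le> \<delta> / 2 * ((1 - growth \<delta> q m) * p + growth \<delta> q m)"
proof -
  define y where "y = q * ((1 + \<delta> / 4) ^ m - 1)"
  have y0: "0 \<le> y" unfolding y_def using \<delta> q by (simp add: one_le_power)
  have ys: "q * ((1 + \<delta> / 4) ^ Suc m - 1) = y + \<delta> / 4 * (y + q)"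
    by (simp add: y_def algebra_simps)
  have g: "growth \<delta> q m = min 1 y" "growth \<delta> q (Suc m) = min 1 (y + \<delta> / 4 * (y + q))"
    unfolding growth_def ys y_def by simp_all
  show ?thesis
  proof (cases "1 \<le> y")
    case True
    then have "growth \<delta> q m = 1" by (simp add: g)
    moreover have "growth \<delta> q (Suc m) \<le> 1" by (simp add: growth_def)
    ultimately show ?thesis using \<delta> by simp
  next
    case False
    have 1: "y * p \<le> y" using y0 q by (simp add: mult_left_le)
    have 2: "0 \<le> (1 - p) * y" using y0 q by simp
    define A where "A = (1 - y) * p + y"
    have "y \<le> A" using False q by (simp add: A_def)
    moreover have "p \<le> A" using 2 by (simp add: A_def algebra_simps)
    ultimately have "y + q \<le> 2 * A" using q by linarith
    then have m1: "\<delta> / 4 * (y + q) \<le> \<delta> / 4 * (2 * A)" using \<delta> by (intro mult_left_mono) auto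
    have "growth \<delta> q (Suc m) \<le> y + \<delta> / 4 * (y + q)" unfolding g by simp
    with m1 have "growth \<delta> q (Suc m) - y \<le> \<delta> / 2 * A" by linarith
    moreover have "growth \<delta> q m = y" using False by (simp add: g)
    ultimately show ?thesis by (simp only: A_def)
  qed
qed

text \<open>By Bernoulli's inequality \<open>r\<close> stages at least double the power. After
  \<open>n\<close> doublings it has reached \<open>1 / q\<close>, and one more makes up for the
  subtracted 1.\<close>

lemma growth_reaches_1:
  assumes \<delta>: "0 < \<delta>" and r: "4 / \<delta> \<le> real r" and q: "1 / q \<le> 2 ^ n" "0 < q" "q \<le> 1"
  shows "growth \<delta> q (r * Suc n) = 1"
proof -
  have "1 \<le> real r * (\<delta> / 4)" using r \<delta> by (simp add: field_simps)
  then have "2 \<le> (1 + \<delta> / 4) ^ r"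
    using Bernoulli_inequality[of "\<delta> / 4" r] \<delta> by linarith
  then have "2 ^ Suc n \<le> ((1 + \<delta> / 4) ^ r) ^ Suc n" by (intro power_mono) auto
  then have "2 * 2 ^ n \<le> (1 + \<delta> / 4) ^ (r * Suc n)" by (simp only: power_mult power_Suc[symmetric])
  moreover have "1 \<le> 1 / q" using q by simp
  ultimately have "1 / q \<le> (1 + \<delta> / 4) ^ (r * Suc n) - 1" using q(1) by linarith
  then have "q * (1 / q) \<le> q * ((1 + \<delta> / 4) ^ (r * Suc n) - 1)" using q by (intro mult_left_mono) auto
  then show ?thesis using q by (simp add: growth_def)
qed

subsection \<open>Upper bound for easy classes\<close>

lemma sorted_instance_algorithm:
  fixes P :: "nat \<Rightarrow> real measure"
  assumes K: "K \<ge> 2" and P: "\<And>i. i < K \<Longrightarrow> dist01 (P i)" and \<delta>: "0 < \<delta>" "\<delta> \<le> 1"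
    and \<Phi>: "\<And>i. i < K \<Longrightarrow> mean (P i) \<le> \<Phi>"
    and nd: "\<And>i j. i < K \<Longrightarrow> j < K \<Longrightarrow> i \<noteq> j \<Longrightarrow> \<delta> \<le> (\<integral>x. max (mean (P j) - x) 0 \<partial>P i)"
    and easy: "\<And>i. i < K \<Longrightarrow> \<delta> \<le> (\<integral>x. max (x - \<Phi>) 0 \<partial>P i)"
    and sorted: "\<And>i j. i \<le> j \<Longrightarrow> j < K \<Longrightarrow> mean (P j) \<le> mean (P i)"
    and N: "4 / \<delta>\<^sup>2 \<le> real N" and r: "4 / \<delta> \<le> real r" and n: "(2 / \<delta>) ^ K \<le> 2 ^ n"
  defines "T \<equiv> N * Suc ((K - 1) * Suc (r * Suc n))"
  shows "\<exists>A. alg_ok K A \<and> (\<forall>(M::'w measure) X. realization K P M X \<longrightarrow> BIC K A T M X \<and>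
     (\<forall>\<omega>. \<forall>i<K. N \<le> card {t. t < T \<and> rec_arm A X t \<omega> = i}))"
proof -
  define R where "R = r * Suc n"
  \<comment> \<open>A lower bound for the stage 0 probabilities of all arms at once, each being a
    product of fewer than \<open>K\<close> factors of size at least \<delta>/2. So one schedule
    serves every arm.\<close>
  define q where "q = (\<delta> / 2) ^ K"
  define w where "w j i s = balance N (P i) (mean (P j)) i s" for j i s
  define good where "good s \<longleftrightarrow> real N * \<Phi> \<le> real s" for s :: nat
  have q: "0 < q" "q \<le> 1" using \<delta> by (auto simp: q_def power_le_one)
  have N0: "N > 0" using N \<delta> by (metis divide_pos_pos gr0I not_less of_nat_0 zero_less_numeral zero_less_power)
  have e: "explorer K N R w (growth \<delta> q)"
  proof
    show "growth \<delta> q R = 1" unfolding R_def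
      using r n q \<delta> by (intro growth_reaches_1) (auto simp: q_def power_divide)
    have "(1 + \<delta> / 4) ^ m \<le> (1 + \<delta> / 4) ^ Suc m" for m using \<delta> by (intro power_increasing) auto
    then show "growth \<delta> q m \<le> growth \<delta> q (Suc m)" for m
      unfolding growth_def using q by (intro min.mono mult_left_mono diff_right_mono) auto
  qed (use K N0 in \<open>auto simp: w_def balance_bounds growth_def\<close>)
  interpret E: explorer K N R w good "growth \<delta> q" by (rule e)
  have T: "T = E.horizon" by (simp only: T_def E.horizon_def) (simp only: R_def)
  have "BIC K E.alg T M X" if real: "realization K P M X" for M :: "'w measure" and X
  proof -
    interpret bandit K P M X by unfold_locales (use real P in auto)
    have bal: "expectation (\<lambda>\<omega>. w j i (successes N i (\<lambda>s. X s \<omega>)) * (X (Mu i) \<omega> - mean (P j))) = 0"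
      "\<delta> / 2 \<le> expectation (\<lambda>\<omega>. w j i (successes N i (\<lambda>s. X s \<omega>)))"
      if "i < j" "j < K" for i j
      unfolding w_def using that sorted[of i j] nd[of i j] dist01_mean_bounds[OF P[of j]]
      by (intro balance_correct[OF _ \<delta>(1) N]; simp)+
    interpret bandit_explorer K P M X N R w good "growth \<delta> q" \<Phi> "\<delta> / 2"
    proof
      show "\<delta> / 2 \<le> expectation (\<lambda>\<omega>. of_bool (good (successes N j (\<lambda>s. X s \<omega>))) * (X (Mu j) \<omega> - \<Phi>))"
        if j: "j < K" for j
        using expectation_above_threshold[OF j \<delta>(1) N, of \<Phi>] easy[OF j] by (simp add: good_def)
      fix j m assume j: "j < K"
      let ?p = "\<Prod>i<j. expectation (\<lambda>\<omega>. w j i (successes N i (\<lambda>s. X s \<omega>)))"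
      have w1: "expectation (\<lambda>\<omega>. w j i (successes N i (\<lambda>s. X s \<omega>))) \<le> 1" if "i < K" for i
      proof (rule integral_le_const)
        show "integrable M (\<lambda>\<omega>. w j i (successes N i (\<lambda>s. X s \<omega>)))"
          by (rule integrable_arm[OF that, where \<phi>="\<lambda>x s. w j i s" and B=1])
             (simp_all add: w_def balance_abs)
      qed (simp add: w_def balance_bounds)
      have "q \<le> (\<delta> / 2) ^ j" unfolding q_def using j \<delta> by (intro power_decreasing) auto
      also have "\<dots> = (\<Prod>i<j. \<delta> / 2)" by simp
      also have "\<dots> \<le> ?p" using bal(2) j \<delta> by (intro prod_mono) auto
      finally have "q \<le> ?p" .
      moreover have "?p \<le> 1"
        using w1 j by (intro prod_le_1) (auto simp: w_def balance_bounds intro!: integral_nonneg_AE)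
      ultimately show "growth \<delta> q (Suc m) - growth \<delta> q m
         \<le> \<delta> / 2 * ((1 - growth \<delta> q m) * ?p + growth \<delta> q m)"
        using \<delta> q by (intro growth_step) auto
    qed (use \<delta> sorted \<Phi> bal in auto)
    show ?thesis by (rule BIC_alg)
  qed
  moreover have "N \<le> card {t. t < T \<and> rec_arm E.alg X t \<omega> = i}"
    if "i < K" for i \<omega> and X :: "src \<Rightarrow> 'w \<Rightarrow> real"
    unfolding T by (rule E.card_rec_arm_alg[OF that])
  ultimately show ?thesis by (intro exI[of _ E.alg] conjI allI impI E.alg_ok)
qed

section \<open>Removing the ordering of the arms by relabelling\<close>

definition relabel_src :: "(nat \<Rightarrow> nat) \<Rightarrow> src \<Rightarrow> src" where
  "relabel_src \<pi> s = (case s of Mu i \<Rightarrow> Mu (\<pi> i) | Unif i n \<Rightarrow> Unif (\<pi> i) n | Seed \<Rightarrow> Seed)"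

text \<open>Conjugation by \<open>\<pi>\<close>: the inner algorithm believes to face the instance
  whose arm \<open>i\<close> is the original arm \<open>\<pi> i\<close>.\<close>

definition relabel_alg :: "(nat \<Rightarrow> nat) \<Rightarrow> alg \<Rightarrow> alg" where
  "relabel_alg \<pi> A u h = \<pi> (A u (map (map_prod (inv \<pi>) id) h))"

lemma realization_relabel:
  assumes \<pi>: "\<pi> permutes {..<K}" and r: "realization K P M X"
  shows "realization K (P \<circ> \<pi>) M (X \<circ> relabel_src \<pi>)"
proof -
  interpret prob_space M using r by (simp add: realization_def)
  have ind: "indep_vars (\<lambda>_. borel) X UNIV" using r by (simp add: realization_def)
  have inj: "inj (relabel_src \<pi>)"
    using permutes_inj[OF \<pi>] by (auto simp: inj_def relabel_src_def split: src.splits)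
  have "indep_vars (\<lambda>s. PiM {relabel_src \<pi> s} (\<lambda>_. borel)) (\<lambda>s \<omega>. restrict (\<lambda>s. X s \<omega>) {relabel_src \<pi> s}) UNIV"
    using inj by (intro indep_vars_restrict[OF ind]) (auto simp: disjoint_family_on_def inj_def)
  then have "indep_vars (\<lambda>_. borel)
      (\<lambda>s \<omega>. (\<lambda>x. x (relabel_src \<pi> s)) (restrict (\<lambda>s. X s \<omega>) {relabel_src \<pi> s})) UNIV"
    by (rule indep_vars_compose2) (auto intro!: measurable_component_singleton)
  then have "indep_vars (\<lambda>_. borel) (X \<circ> relabel_src \<pi>) UNIV" by (simp add: comp_def)
  moreover have "\<pi> i < K" if "i < K" for i using permutes_in_image[OF \<pi>, of i] that by simp
  ultimately show ?thesis using r
    by (simp add: realization_def relabel_src_def)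
qed

lemma hist_relabel:
  assumes \<pi>: "\<pi> permutes S"
  shows "hist A (X \<circ> relabel_src \<pi>) \<omega> t = map (map_prod (inv \<pi>) id) (hist (relabel_alg \<pi> A) X \<omega> t)"
proof (induction t)
  case (Suc t)
  define h where "h = hist (relabel_alg \<pi> A) X \<omega> t"
  define a where "a = A (X Seed \<omega>) (map (map_prod (inv \<pi>) id) h)"
  have "filter (\<lambda>p. inv \<pi> (fst p) = a) h = filter (\<lambda>p. fst p = \<pi> a) h"
    using permutes_inverses[OF \<pi>] by (intro filter_cong refl) metis
  then have len: "length (filter (\<lambda>p. fst p = a) (map (map_prod (inv \<pi>) id) h)) = length (filter (\<lambda>p. fst p = \<pi> a) h)"
    by (simp add: filter_map comp_def)
  have seed: "(X \<circ> relabel_src \<pi>) Seed = X Seed" by (simp add: relabel_src_def)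
  have play: "relabel_alg \<pi> A (X Seed \<omega>) h = \<pi> a" by (simp add: relabel_alg_def a_def)
  have smp: "sample (X \<circ> relabel_src \<pi>) a n \<omega> = sample X (\<pi> a) n \<omega>" for n
    by (simp add: sample_def relabel_src_def)
  show ?case
    unfolding hist.simps Let_def Suc.IH seed h_def[symmetric] a_def[symmetric] play len smp
    by (simp add: permutes_inverses[OF \<pi>] id_def)
qed simp

lemma rec_arm_relabel:
  assumes \<pi>: "\<pi> permutes S"
  shows "rec_arm (relabel_alg \<pi> A) X t \<omega> = \<pi> (rec_arm A (X \<circ> relabel_src \<pi>) t \<omega>)"
  unfolding rec_arm_def hist_relabel[OF \<pi>] by (simp add: relabel_alg_def relabel_src_def)

lemma alg_ok_relabel:
  assumes \<pi>: "\<pi> permutes {..<K}" and A: "alg_ok K A"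
  shows "alg_ok K (relabel_alg \<pi> A)"
proof -
  have "\<pi> i < K" if "i < K" for i using permutes_in_image[OF \<pi>, of i] that by simp
  moreover have "(\<lambda>u. \<pi> (A u h)) \<in> borel \<rightarrow>\<^sub>M count_space UNIV" for h
  proof -
    have "(\<lambda>u. A u h) \<in> borel \<rightarrow>\<^sub>M count_space UNIV" using A by (simp add: alg_ok_def)
    from measurable_compose[OF this, of \<pi> "count_space UNIV"] show ?thesis by simp
  qed
  ultimately show ?thesis using A by (simp add: alg_ok_def relabel_alg_def)
qed

lemma BIC_relabel:
  assumes \<pi>: "\<pi> permutes {..<K}" and B: "BIC K A T M (X \<circ> relabel_src \<pi>)"
  shows "BIC K (relabel_alg \<pi> A) T M X"
  unfolding BIC_def
proof (intro allI impI)
  fix t i k assume t: "t < T" and i: "i < K" and k: "k < K"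
    and pos: "measure M {\<omega> \<in> space M. rec_arm (relabel_alg \<pi> A) X t \<omega> = i} > 0"
  have inv: "inv \<pi> l < K" if "l < K" for l
    using permutes_in_image[OF permutes_inv[OF \<pi>], of l] that by simp
  have eq: "rec_arm (relabel_alg \<pi> A) X t \<omega> = i \<longleftrightarrow> rec_arm A (X \<circ> relabel_src \<pi>) t \<omega> = inv \<pi> i" for \<omega>
    unfolding rec_arm_relabel[OF \<pi>] using permutes_inverses[OF \<pi>] by metis
  have X: "(X \<circ> relabel_src \<pi>) (Mu (inv \<pi> l)) = X (Mu l)" for l
    by (simp add: relabel_src_def permutes_inverses[OF \<pi>])
  show "0 \<le> cexp M (\<lambda>\<omega>. X (Mu i) \<omega> - X (Mu k) \<omega>) {\<omega> \<in> space M. rec_arm (relabel_alg \<pi> A) X t \<omega> = i}"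
    using B[unfolded BIC_def, rule_format, OF t inv[OF i] inv[OF k]] pos unfolding eq X by simp
qed

lemma ex_sorting_permutation:
  fixes f :: "nat \<Rightarrow> real"
  obtains \<pi> where "\<pi> permutes {..<K}" "\<And>i j. i \<le> j \<Longrightarrow> j < K \<Longrightarrow> f (\<pi> j) \<le> f (\<pi> i)"
proof -
  define xs where "xs = sort_key (\<lambda>i. - f i) [0..<K]"
  define \<pi> where "\<pi> i = (if i < K then xs ! i else i)" for i
  have len: "length xs = K" and dist: "distinct xs" and elems: "set xs = {..<K}"
    by (auto simp: xs_def)
  have "bij_betw ((!) xs) {..<K} {..<K}" using bij_betw_nth[OF dist refl refl] by (simp only: len elems)
  then have "bij_betw \<pi> {..<K} {..<K}" by (rule bij_betw_cong[THEN iffD1, rotated]) (simp add: \<pi>_def)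
  then have "\<pi> permutes {..<K}" by (rule bij_imp_permutes) (simp add: \<pi>_def)
  moreover have "f (\<pi> j) \<le> f (\<pi> i)" if "i \<le> j" "j < K" for i j
  proof -
    have "sorted (map (\<lambda>i. - f i) xs)" by (simp add: xs_def)
    then have "map (\<lambda>i. - f i) xs ! i \<le> map (\<lambda>i. - f i) xs ! j"
      using that len by (intro sorted_nth_mono) auto
    then show ?thesis using that len by (simp add: \<pi>_def)
  qed
  ultimately show ?thesis using that by blast
qed

lemma instance_algorithm:
  fixes P :: "nat \<Rightarrow> real measure"
  assumes K: "K \<ge> 2" and P: "\<And>i. i < K \<Longrightarrow> dist01 (P i)" and \<delta>: "0 < \<delta>" "\<delta> \<le> 1"
    and \<Phi>: "\<And>i. i < K \<Longrightarrow> mean (P i) \<le> \<Phi>"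
    and nd: "\<And>i j. i < K \<Longrightarrow> j < K \<Longrightarrow> i \<noteq> j \<Longrightarrow> \<delta> \<le> (\<integral>x. max (mean (P j) - x) 0 \<partial>P i)"
    and easy: "\<And>i. i < K \<Longrightarrow> \<delta> \<le> (\<integral>x. max (x - \<Phi>) 0 \<partial>P i)"
    and N: "4 / \<delta>\<^sup>2 \<le> real N" and r: "4 / \<delta> \<le> real r" and n: "(2 / \<delta>) ^ K \<le> 2 ^ n"
  defines "T \<equiv> N * Suc ((K - 1) * Suc (r * Suc n))"
  shows "\<exists>A. alg_ok K A \<and> (\<forall>(M::'w measure) X. realization K P M X \<longrightarrow> BIC K A T M X \<and>
     (\<forall>\<omega>. \<forall>i<K. N \<le> card {t. t < T \<and> rec_arm A X t \<omega> = i}))"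
proof -
  obtain \<pi> where \<pi>: "\<pi> permutes {..<K}" and s: "\<And>i j. i \<le> j \<Longrightarrow> j < K \<Longrightarrow> mean (P (\<pi> j)) \<le> mean (P (\<pi> i))"
    using ex_sorting_permutation[of K "\<lambda>i. mean (P i)"] by blast
  have lt: "\<pi> i < K" if "i < K" for i using permutes_in_image[OF \<pi>, of i] that by simp
  have neq: "\<pi> i \<noteq> \<pi> j" if "i \<noteq> j" for i j using permutes_inj[OF \<pi>] that by (auto simp: inj_def)
  have "\<exists>A. alg_ok K A \<and> (\<forall>(M::'w measure) X. realization K (P \<circ> \<pi>) M X \<longrightarrow> BIC K A T M X \<and>
     (\<forall>\<omega>. \<forall>i<K. N \<le> card {t. t < T \<and> rec_arm A X t \<omega> = i}))"
    unfolding T_def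
    by (rule sorted_instance_algorithm[OF K _ \<delta> _ _ _ _ N r n, of _ \<Phi>])
       (use lt neq P \<Phi> nd easy s in auto)
  then obtain A where A: "alg_ok K A" and AM: "\<And>(M::'w measure) X. realization K (P \<circ> \<pi>) M X \<Longrightarrow> BIC K A T M X \<and>
     (\<forall>\<omega>. \<forall>i<K. N \<le> card {t. t < T \<and> rec_arm A X t \<omega> = i})" by blast
  show ?thesis
  proof (intro exI[of _ "relabel_alg \<pi> A"] conjI allI impI)
    show "alg_ok K (relabel_alg \<pi> A)" by (rule alg_ok_relabel[OF \<pi> A])
    fix M :: "'w measure" and X assume "realization K P M X"
    note * = AM[OF realization_relabel[OF \<pi> this]]
    show "BIC K (relabel_alg \<pi> A) T M X" using * by (intro BIC_relabel[OF \<pi>]) auto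
    fix \<omega> i assume i: "i < K"
    have inv: "inv \<pi> i < K" using permutes_in_image[OF permutes_inv[OF \<pi>], of i] i by simp
    have "rec_arm (relabel_alg \<pi> A) X t \<omega> = i \<longleftrightarrow> rec_arm A (X \<circ> relabel_src \<pi>) t \<omega> = inv \<pi> i" for t
      unfolding rec_arm_relabel[OF \<pi>] using permutes_inverses[OF \<pi>] by metis
    then show "N \<le> card {t. t < T \<and> rec_arm (relabel_alg \<pi> A) X t \<omega> = i}" using * inv by simp
  qed
qed

section \<open>Counting the rounds\<close>

lemma round_bound:
  assumes K: "K \<ge> (2::nat)" and \<delta>: "0 < \<delta>" "\<delta> \<le> (1::real)" and C: "0 < CTS"
  obtains N r n where "4 / \<delta>\<^sup>2 \<le> real N" "4 / \<delta> \<le> real r" "(2 / \<delta>) ^ K \<le> 2 ^ n"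
    "CTS * (1 / \<delta>\<^sup>2) * (real K * \<bar>ln \<delta>\<bar>) \<le> real N"
    "real (N * Suc ((K - 1) * Suc (r * Suc n)))
      \<le> 10 * (CTS + 5) * real K ^ 3 / \<delta> ^ 4 * (2 + ln (real K) + \<bar>ln \<delta>\<bar>) ^ 2"
proof -
  define \<Lambda> where "\<Lambda> = 2 + ln (real K) + \<bar>ln \<delta>\<bar>"
  \<comment> \<open>One block length meets two demands: \<open>4 / \<delta>\<^sup>2\<close> samples
    for the empirical mean, covered by the summand 4, and the bound for \<open>N_TS\<close>, covered
    by \<open>CTS\<close>.\<close>
  define N where "N = nat \<lceil>(CTS + 4) * (real K * \<Lambda> / \<delta>\<^sup>2)\<rceil>"
  define r where "r = nat \<lceil>4 / \<delta>\<rceil>"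
  define l where "l = nat \<lceil>log 2 (2 / \<delta>)\<rceil>"
  \<comment> \<open>\<open>l\<close> doublings exceed 2/\<delta>, so \<open>l * K\<close> doublings
    exceed its \<open>K\<close>-th power. The tiny initial exploration probability therefore costs
    only a factor linear in \<open>K\<close>.\<close>
  define n where "n = l * K"
  have lnK: "0 \<le> ln (real K)" using K by simp
  have \<Lambda>: "2 + \<bar>ln \<delta>\<bar> \<le> \<Lambda>" "2 \<le> \<Lambda>" using lnK by (auto simp: \<Lambda>_def)
  have \<delta>2: "1 \<le> 1 / \<delta>\<^sup>2" using \<delta> by (simp add: power_le_one)
  have K\<Lambda>: "4 \<le> real K * \<Lambda>" using mult_mono[of 2 "real K" 2 \<Lambda>] K \<Lambda> by simp
  define Y where "Y = real K * \<Lambda> / \<delta>\<^sup>2"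
  have Yd: "4 / \<delta>\<^sup>2 \<le> Y" unfolding Y_def using K\<Lambda> \<delta> by (intro divide_right_mono) auto
  then have Y1: "1 \<le> Y" using \<delta>2 by (simp add: field_simps)
  have Nlo: "(CTS + 4) * Y \<le> real N" unfolding N_def Y_def by linarith
  have Nhi: "real N \<le> (CTS + 5) * Y"
  proof -
    have "0 \<le> (CTS + 4) * Y" using C Y1 by simp
    then have "real N \<le> (CTS + 4) * Y + 1" unfolding N_def Y_def[symmetric] by linarith
    also have "\<dots> \<le> (CTS + 5) * Y" using Y1 by (simp add: algebra_simps)
    finally show ?thesis .
  qed
  have r: "4 / \<delta> \<le> real r" "real r \<le> 5 / \<delta>"
  proof -
    show "4 / \<delta> \<le> real r" unfolding r_def by linarith
    have "0 \<le> 4 / \<delta>" using \<delta> by simp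
    then have "real r \<le> 4 / \<delta> + 1" unfolding r_def by linarith
    also have "\<dots> \<le> 5 / \<delta>" using \<delta> by (simp add: field_simps)
    finally show "real r \<le> 5 / \<delta>" .
  qed
  have l0: "log 2 (2 / \<delta>) \<le> real l" unfolding l_def by linarith
  have l1: "real l \<le> 2 + 2 * \<bar>ln \<delta>\<bar>"
  proof -
    have eq: "log 2 (2 / \<delta>) = 1 + \<bar>ln \<delta>\<bar> / ln 2" using \<delta> by (simp add: log_def ln_div diff_divide_distrib)
    have "\<bar>ln \<delta>\<bar> / ln 2 \<le> \<bar>ln \<delta>\<bar> / (1 / 2)"
      using ln2_ge_two_thirds by (intro divide_left_mono) auto
    then have hi: "log 2 (2 / \<delta>) \<le> 1 + 2 * \<bar>ln \<delta>\<bar>" using eq by simp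
    have lo: "0 \<le> log 2 (2 / \<delta>)" using eq by simp
    have "real (nat \<lceil>x\<rceil>) \<le> x + 1" if "0 \<le> x" for x :: real using that by linarith
    from order_trans[OF this[OF lo] add_right_mono[OF hi, of 1]] show ?thesis by (simp add: l_def)
  qed
  have "2 / \<delta> \<le> 2 ^ l"
  proof -
    have "2 / \<delta> = 2 powr log 2 (2 / \<delta>)" using \<delta> by simp
    also have "\<dots> \<le> 2 powr real l" using l0 by (intro powr_mono) auto
    finally show ?thesis by (simp add: powr_realpow)
  qed
  then have n: "(2 / \<delta>) ^ K \<le> 2 ^ n"
    unfolding n_def power_mult using \<delta> by (intro power_mono) auto
  have S: "real (Suc (r * Suc n)) \<le> 10 * real K * \<Lambda> / \<delta>"
  proof -
    have "real (Suc n) \<le> real K * (2 * \<Lambda> - 2) + 1"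
      unfolding n_def using l1 \<Lambda> mult_left_mono[of "real l" "2 * \<Lambda> - 2" "real K"] by (simp add: mult.commute)
    also have "\<dots> \<le> 2 * real K * \<Lambda> - 3" using K by (simp add: algebra_simps)
    finally have n1: "real (Suc n) \<le> 2 * real K * \<Lambda> - 3" .
    have "real (Suc (r * Suc n)) = 1 + real r * real (Suc n)" by (simp only: of_nat_Suc of_nat_mult)
    also have "\<dots> \<le> 5 / \<delta> + 5 / \<delta> * real (Suc n)"
      using r(2) \<delta> by (intro add_mono mult_right_mono) (auto simp: field_simps)
    also have "\<dots> = 5 / \<delta> * (1 + real (Suc n))" by (simp only: distrib_left mult_1_right)
    also have "\<dots> \<le> 5 / \<delta> * (2 * real K * \<Lambda>)" using n1 \<delta> by (intro mult_left_mono) auto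
    finally show ?thesis by (simp add: mult_ac)
  qed
  have T: "real (N * Suc ((K - 1) * Suc (r * Suc n)))
      \<le> 10 * (CTS + 5) * real K ^ 3 / \<delta> ^ 4 * \<Lambda> ^ 2"
  proof -
    define Z where "Z = Suc (r * Suc n)"
    have "Suc ((K - 1) * Z) \<le> Z + (K - 1) * Z" by (simp add: Z_def)
    also have "\<dots> = K * Z" using K by (cases K) auto
    finally have "real (N * Suc ((K - 1) * Z)) \<le> real (N * (K * Z))"
      by (intro of_nat_mono mult_le_mono) auto
    also have "\<dots> = real N * (real K * real Z)" by simp
    also have "\<dots> \<le> ((CTS + 5) * Y) * (real K * (10 * real K * \<Lambda> / \<delta>))"
      using Nhi S C Y1 by (intro mult_mono) (auto simp: Z_def simp del: of_nat_Suc)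
    also have "\<dots> = 10 * (CTS + 5) * real K ^ 3 * \<Lambda> ^ 2 / \<delta> ^ 3"
      by (simp add: Y_def power2_eq_square power3_eq_cube)
    \<comment> \<open>The count obtained so far is of order K^3/\<delta>^3 up to logarithms;
      \<delta> \<le> 1 allows the weaker power 4.\<close>
    also have "\<dots> \<le> 10 * (CTS + 5) * real K ^ 3 * \<Lambda> ^ 2 / \<delta> ^ 4"
      using \<delta> C by (intro divide_left_mono power_decreasing) auto
    finally show ?thesis by (simp add: Z_def)
  qed
  show ?thesis
  proof (rule that[OF _ r(1) n])
    have CY: "0 \<le> CTS * Y" using C Y1 by simp
    have "(CTS + 4) * Y = CTS * Y + 4 * Y" by (simp add: algebra_simps)
    then show "4 / \<delta>\<^sup>2 \<le> real N" using Nlo Yd CY Y1 by linarith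
    have "CTS * (1 / \<delta>\<^sup>2) * (real K * \<bar>ln \<delta>\<bar>) \<le> CTS * (1 / \<delta>\<^sup>2) * (real K * \<Lambda>)"
      using C \<Lambda> by (intro mult_left_mono) auto
    also have "\<dots> = CTS * Y" by (simp add: Y_def)
    also have "\<dots> \<le> (CTS + 4) * Y" using Y1 by (simp add: algebra_simps)
    finally show "CTS * (1 / \<delta>\<^sup>2) * (real K * \<bar>ln \<delta>\<bar>) \<le> real N" using Nlo by linarith
  qed (use T in \<open>simp add: \<Lambda>_def\<close>)
qed

theorem delta_easy_upper_bound:
  assumes CTS: "CTS > (0::real)"
  shows "\<exists>A>0. \<exists>p::nat. \<forall>(C::real measure set) (\<delta>::real).
      C \<noteq> {} \<longrightarrow> (\<forall>P\<in>C. dist01 P) \<longrightarrow> \<delta> > 0 \<longrightarrow>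
      delta_easy C \<delta> \<longrightarrow> delta_nondominant C \<delta> \<longrightarrow>
      (\<forall>K\<ge>2. \<forall>P. consistent C K P \<longrightarrow>
         (\<exists>(T::nat) (Alg::alg).
            real T \<le> A * real K ^ 3 / \<delta> ^ 4 * (2 + ln (real K) + \<bar>ln \<delta>\<bar>) ^ p \<and>
            alg_ok K Alg \<and>
            (\<forall>(M::'w measure) X. realization K P M X \<longrightarrow>
               BIC K Alg T M X \<and>
               (AE \<omega> in M. \<forall>i<K. N_TS CTS K M X \<le> real (card {t. t < T \<and> rec_arm Alg X t \<omega> = i})))))"
proof -
  have pos: "0 < 10 * (CTS + 5)" using CTS by simp
  show ?thesis
  proof (rule exI[of _ "10 * (CTS + 5)"], rule conjI[OF pos], rule exI[of _ "2::nat"], intro allI impI)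
    fix C :: "real measure set" and \<delta> :: real and K P
    assume ne: "C \<noteq> {}" and d: "\<forall>P\<in>C. dist01 P" and \<delta>: "\<delta> > 0" and easy: "delta_easy C \<delta>"
      and nd: "delta_nondominant C \<delta>" and K: "2 \<le> K" and con: "consistent C K P"
    have PC: "P i \<in> C" if "i < K" for i using con that by (simp add: consistent_def)
    have P: "dist01 (P i)" if "i < K" for i using PC[OF that] d by blast
    have \<Phi>0: "0 \<le> Phi C" using Phi_bounds[OF d ne] by simp
    have \<Phi>: "mean (P i) \<le> Phi C" if "i < K" for i using mean_le_Phi[OF d PC[OF that]] .
    have nd': "\<delta> \<le> (\<integral>x. max (mean (P j) - x) 0 \<partial>P i)" if "i < K" "j < K" "i \<noteq> j" for i j
      using nd con that unfolding delta_nondominant_def by blast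
    have easy': "\<delta> \<le> (\<integral>x. max (x - Phi C) 0 \<partial>P i)" if "i < K" for i
    proof -
      have "(INF P\<in>C. (\<integral>x. max (x - Phi C) 0 \<partial>P)) \<le> (\<integral>x. max (x - Phi C) 0 \<partial>P i)"
        using PC[OF that] by (intro cINF_lower bdd_belowI2[where m=0] integral_nonneg_AE) auto
      then show ?thesis using easy by (simp add: delta_easy_def)
    qed
    \<comment> \<open>The excess of a [0,1]-valued mean over \<Phi> \<ge> 0 is at most 1, so
      easiness itself forces \<delta> \<le> 1.\<close>
    have \<delta>1: "\<delta> \<le> 1"
    proof -
      have d0: "dist01 (P 0)" using P K by simp
      interpret prob_space "P 0" by (rule dist01_prob[OF d0])
      have "(\<integral>x. max (x - Phi C) 0 \<partial>P 0) \<le> 1"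
        using dist01_AE[OF d0] \<Phi>0
        by (intro integral_le_const dist01_integrable[OF d0, where B=1]) auto
      then show ?thesis using easy'[of 0] K by simp
    qed
    obtain N r n where N: "4 / \<delta>\<^sup>2 \<le> real N" and r: "4 / \<delta> \<le> real r" and n: "(2 / \<delta>) ^ K \<le> 2 ^ n"
      and NTS: "CTS * (1 / \<delta>\<^sup>2) * (real K * \<bar>ln \<delta>\<bar>) \<le> real N"
      and T: "real (N * Suc ((K - 1) * Suc (r * Suc n)))
        \<le> 10 * (CTS + 5) * real K ^ 3 / \<delta> ^ 4 * (2 + ln (real K) + \<bar>ln \<delta>\<bar>) ^ 2"
      using round_bound[OF K \<delta> \<delta>1 CTS] by blast
    let ?T = "N * Suc ((K - 1) * Suc (r * Suc n))"
    have "\<exists>A. alg_ok K A \<and> (\<forall>(M::'w measure) X. realization K P M X \<longrightarrow> BIC K A ?T M X \<and>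
       (\<forall>\<omega>. \<forall>i<K. N \<le> card {t. t < ?T \<and> rec_arm A X t \<omega> = i}))"
      by (rule instance_algorithm[OF K P \<delta> \<delta>1 \<Phi> nd' easy' N r n])
    then obtain A where A: "alg_ok K A" and AM: "\<And>(M::'w measure) X. realization K P M X \<Longrightarrow> BIC K A ?T M X \<and>
       (\<forall>\<omega>. \<forall>i<K. N \<le> card {t. t < ?T \<and> rec_arm A X t \<omega> = i})"
      by (elim exE conjE) presburger
    show "\<exists>T Alg. real T \<le> 10 * (CTS + 5) * real K ^ 3 / \<delta> ^ 4 * (2 + ln (real K) + \<bar>ln \<delta>\<bar>) ^ 2 \<and>
        alg_ok K Alg \<and> (\<forall>(M::'w measure) X. realization K P M X \<longrightarrow> BIC K Alg T M X \<and>
           (AE \<omega> in M. \<forall>i<K. N_TS CTS K M X \<le> real (card {t. t < T \<and> rec_arm Alg X t \<omega> = i})))"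
    proof (intro exI[of _ ?T] exI[of _ A] conjI allI impI T A)
      fix M :: "'w measure" and X assume real: "realization K P M X"
      then show "BIC K A ?T M X" using AM by blast
      interpret bandit K P M X by unfold_locales (use real P in auto)
      have "N_TS CTS K M X \<le> real N"
        using N_TS_le[OF K \<delta> \<Phi>0 \<Phi> nd' easy', of CTS] CTS NTS by simp
      then show "AE \<omega> in M. \<forall>i<K. N_TS CTS K M X \<le> real (card {t. t < ?T \<and> rec_arm A X t \<omega> = i})"
        using AM[OF real] by (intro AE_I2 allI impI) (meson of_nat_mono order_trans)
    qed
  qed
qed

theorem theorem5p4:
  shows
  "(\<forall>CTS>0. \<exists>A>0. \<exists>p::nat. \<forall>(C::real measure set) (\<delta>::real).
      C \<noteq> {} \<longrightarrow> (\<forall>P\<in>C. dist01 P) \<longrightarrow> \<delta> > 0 \<longrightarrow>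
      delta_easy C \<delta> \<longrightarrow> delta_nondominant C \<delta> \<longrightarrow>
      (\<forall>K\<ge>2. \<forall>P. consistent C K P \<longrightarrow>
         (\<exists>(T::nat) (Alg::alg).
            real T \<le> A * real K ^ 3 / \<delta> ^ 4 * (2 + ln (real K) + \<bar>ln \<delta>\<bar>) ^ p \<and>
            alg_ok K Alg \<and>
            (\<forall>(M::'w measure) X. realization K P M X \<longrightarrow>
               BIC K Alg T M X \<and>
               (AE \<omega> in M. \<forall>i<K. N_TS CTS K M X \<le> real (card {t. t < T \<and> rec_arm Alg X t \<omega> = i}))))))
   \<and>
   (\<forall>\<delta>>0. \<exists>c>0. \<forall>C::real measure set.
      C \<noteq> {} \<longrightarrow> (\<forall>P\<in>C. dist01 P) \<longrightarrow> delta_hard C \<delta> \<longrightarrow>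
      (\<exists>K0. \<forall>K\<ge>K0. \<exists>P. consistent C K P \<and>
         (\<forall>i j. i \<le> j \<longrightarrow> j < K \<longrightarrow> mean (P j) \<le> mean (P i)) \<and>
         (\<forall>(M::'w measure) X. realization K P M X \<longrightarrow> R_LB K M X > ereal (exp (c * real K)))))
   \<and>
   (\<forall>C::real measure set.
      finite C \<longrightarrow> C \<noteq> {} \<longrightarrow> (\<forall>P\<in>C. dist01 P) \<longrightarrow>
      Min (sup_supp ` C) \<noteq> Phi C \<longrightarrow>
      (\<exists>\<delta>>0. delta_easy C \<delta> \<or> delta_hard C \<delta>))"
proof (intro conjI allI impI)
  show "\<exists>\<delta>>0. delta_easy C \<delta> \<or> delta_hard C \<delta>"
    if "finite C" "C \<noteq> {}" "\<forall>P\<in>C. dist01 P" "Min (sup_supp ` C) \<noteq> Phi C" for C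
    using finite_class_easy_or_hard[OF that] .
qed (rule delta_easy_upper_bound delta_hard_lower_bound; assumption)+

end
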